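(* Let $\mathfrak{T}$ be the original Tsirelson space. The space $\mathfrak{T}(c_0)$, i.e. the $\mathfrak{T}$-direct sum of infinitely many (countably many) copies of $c_0$, has Szlenk power type $1$ but does not have summable Szlenk index.
   Context: Tsirelson space. Let $T$ be the completion of $c_{00}$ (finitely supported scalar sequences) under the unique norm satisfying $$\|x\|=\max\Bigl\{\|x\|_{c_0},\ \tfrac12\sup\Bigl\{\sum_{j=1}^k\|E_jx\|:\ k\in\mathbb{N},\ \{k\}<E_1<\cdots<E_k\Bigr\}\Bigr\}\qquad(x\in c_{00}),$$ where $E_1,\dots,E_k$ are finite subsets of $\mathbb{N}$, $Ex=\mathbf{1}_E\cdot x$, and $E<F$ means $\max E<\min F$ or one of the sets is empty. $T$ is reflexive and its unit vectors form a normalized $1$-unconditional basis. The original Tsirelson space $\mathfrak{T}$ is the Banach space with $\mathfrak{T}^*=T$, i.e. $\mathfrak{T}=T^*$, with its normalized $1$-unconditional basis $(e_n)$ of functionals biorthogonal to the unit vector basis of $T$. Direct sum. $\mathfrak{T}(c_0)$ is the Banach space of all sequences $(x_n)_{n=1}^\infty$ in $c_0$ for which $\sum_n\|x_n\|e_n$ converges in $\mathfrak{T}$, with norm $\|(x_n)\|=\bigl\|\sum_n\|x_n\|e_n\bigr\|_{\mathfrak{T}}$. Szlenk index. For a Banach space $X$, a weak$^*$-compact set $K\subset X^*$ and $\varepsilon>0$, put $\iota_\varepsilon K=\{x^*\in K:\ \mathrm{diam}(K\cap U)>\varepsilon$ for every weak$^*$-open neighborhood $U$ of $x^*\}$ (norm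 diameter), with iterates $\iota_\varepsilon^0K=K$, $\iota_\varepsilon^{\alpha+1}K=\iota_\varepsilon(\iota_\varepsilon^\alpha K)$ and intersections at limit ordinals. $\mathrm{Sz}(X,\varepsilon)$ is the least ordinal $\alpha$ with $\iota_\varepsilon^\alpha B_{X^*}=\varnothing$ ($B_{X^*}$ the closed unit ball of $X^*$), and $\mathrm{Sz}(X)=\sup_{\varepsilon>0}\mathrm{Sz}(X,\varepsilon)$. For $X$ with $\mathrm{Sz}(X)\leq\omega$ (equivalently, all $\mathrm{Sz}(X,\varepsilon)$ finite), the Szlenk power type is $p(X)=\inf\{q\geq1:\ \sup_{0<\varepsilon<1}\varepsilon^q\,\mathrm{Sz}(X,\varepsilon)<\infty\}$; an assertion about its value includes $\mathrm{Sz}(X)\leq\omega$. $X$ has summable Szlenk index if there is a constant $M$ such that for all $n$ and all positive $\varepsilon_1,\ldots,\varepsilon_n$ with $\iota_{\varepsilon_1}\cdots\iota_{\varepsilon_n}B_{X^*}\neq\varnothing$ one has $\sum_{i=1}^n\varepsilon_i\leq M$. *)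

theory Defs
  imports "HOL-Analysis.Analysis"
begin

section \<open>Tsirelson space\<close>

subsection \<open>Finitely supported sequences\<close>

text \<open>
  The scalar field is a type variable, to be instantiated by \<^typ>\<open>real\<close> and by \<^typ>\<open>complex\<close>.
  Sequences are indexed from \<open>1\<close> in the mathematics and from \<open>0\<close> here: the coordinate
  with number \<open>Suc i\<close> is the value at \<open>i\<close>. Sets of coordinates are sets of coordinate numbers.
\<close>

typedef (overloaded) 'k c00 = "{x :: nat \<Rightarrow> 'k::zero. finite {i. x i \<noteq> 0}}"
  morphisms coord Abs_c00
  by (rule exI[of _ "\<lambda>_. 0"]) simp

setup_lifting type_definition_c00

lemma c00_eqI: "(\<And>i. coord x i = coord y i) \<Longrightarrow> x = y"
  by transfer auto

lemma finite_support [simp]: "finite {i. coord x i \<noteq> 0}"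
  using coord[of x] by simp

instantiation c00 :: (real_normed_field) real_vector
begin

lift_definition zero_c00 :: "'a c00" is "\<lambda>_. 0" by simp

lift_definition plus_c00 :: "'a c00 \<Rightarrow> 'a c00 \<Rightarrow> 'a c00" is "\<lambda>x y i. x i + y i"
  subgoal for x y by (rule finite_subset[of _ "{i. x i \<noteq> 0} \<union> {i. y i \<noteq> 0}"]) auto
  done

lift_definition uminus_c00 :: "'a c00 \<Rightarrow> 'a c00" is "\<lambda>x i. - x i" by simp

lift_definition minus_c00 :: "'a c00 \<Rightarrow> 'a c00 \<Rightarrow> 'a c00" is "\<lambda>x y i. x i - y i"
  subgoal for x y by (rule finite_subset[of _ "{i. x i \<noteq> 0} \<union> {i. y i \<noteq> 0}"]) auto
  done

lift_definition scaleR_c00 :: "real \<Rightarrow> 'a c00 \<Rightarrow> 'a c00" is "\<lambda>r x i. r *\<^sub>R x i"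
  subgoal for r x by (rule finite_subset[of _ "{i. x i \<noteq> 0}"]) auto
  done

instance
  by standard (transfer; simp add: algebra_simps)+

end

lift_definition scale_c00 :: "'k::real_normed_field \<Rightarrow> 'k c00 \<Rightarrow> 'k c00" is "\<lambda>c x i. c * x i"
  subgoal for c x by (rule finite_subset[of _ "{i. x i \<noteq> 0}"]) auto
  done

lift_definition unit_c00 :: "nat \<Rightarrow> 'k::real_normed_field c00" is "\<lambda>n i. if i = n then 1 else 0"
  by simp

lift_definition proj_c00 :: "nat set \<Rightarrow> 'k::real_normed_field c00 \<Rightarrow> 'k c00"
  is "\<lambda>E x i. if Suc i \<in> E then x i else 0"
  subgoal for E x by (rule finite_subset[of _ "{i. x i \<noteq> 0}"]) auto
  done

lemmas coord_simps [simp] =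
  zero_c00.rep_eq plus_c00.rep_eq uminus_c00.rep_eq minus_c00.rep_eq scaleR_c00.rep_eq
  scale_c00.rep_eq unit_c00.rep_eq proj_c00.rep_eq


subsection \<open>The Tsirelson norm\<close>

definition sup_c00 :: "'k::real_normed_field c00 \<Rightarrow> real" where
  "sup_c00 x = (SUP i. norm (coord x i))"

definition set_before :: "nat set \<Rightarrow> nat set \<Rightarrow> bool" (infix "\<lless>" 50) where
  "E \<lless> F \<longleftrightarrow> E = {} \<or> F = {} \<or> Max E < Min F"

text \<open>
  The chain \<open>{k} < E\<^sub>1 < \<dots> < E\<^sub>k\<close> relates every two of its members. Comparing only neighbours
  would allow an empty set to reset the order, and then the norm would not exist.
\<close>

definition tsirelson_admissible :: "nat \<Rightarrow> (nat \<Rightarrow> nat set) \<Rightarrow> bool" where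
  "tsirelson_admissible k E \<longleftrightarrow> k \<ge> 1 \<and>
     (\<forall>j\<in>{1..k}. finite (E j) \<and> {k} \<lless> E j) \<and>
     (\<forall>i\<in>{1..k}. \<forall>j\<in>{1..k}. i < j \<longrightarrow> E i \<lless> E j)"

definition tsirelson_sums :: "('k::real_normed_field c00 \<Rightarrow> real) \<Rightarrow> 'k c00 \<Rightarrow> real set" where
  "tsirelson_sums N x = {\<Sum>j=1..k. N (proj_c00 (E j) x) | k E. tsirelson_admissible k E}"

definition tsirelson_rhs :: "('k::real_normed_field c00 \<Rightarrow> real) \<Rightarrow> 'k c00 \<Rightarrow> real" where
  "tsirelson_rhs N x = max (sup_c00 x) (1/2 * Sup (tsirelson_sums N x))"

definition is_norm_c00 :: "('k::real_normed_field c00 \<Rightarrow> real) \<Rightarrow> bool" where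
  "is_norm_c00 N \<longleftrightarrow> (\<forall>x. N x = 0 \<longleftrightarrow> x = 0) \<and> (\<forall>x y. N (x + y) \<le> N x + N y) \<and>
     (\<forall>c x. N (scale_c00 c x) = norm c * N x)"

definition tsirelson_norm :: "'k::real_normed_field c00 \<Rightarrow> real" where
  "tsirelson_norm = (THE N. is_norm_c00 N \<and> (\<forall>x. N x = tsirelson_rhs N x))"

definition is_seminorm_c00 :: "('k::real_normed_field c00 \<Rightarrow> real) \<Rightarrow> bool" where
  "is_seminorm_c00 N \<longleftrightarrow> (\<forall>x y. N (x + y) \<le> N x + N y) \<and>
     (\<forall>c x. N (scale_c00 c x) = norm c * N x)"

lemma is_seminorm_c00_add: "is_seminorm_c00 N \<Longrightarrow> N (x + y) \<le> N x + N y"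
  and is_seminorm_c00_scale: "is_seminorm_c00 N \<Longrightarrow> N (scale_c00 c x) = norm c * N x"
  by (auto simp: is_seminorm_c00_def)

lemma is_norm_imp_seminorm: "is_norm_c00 N \<Longrightarrow> is_seminorm_c00 N"
  by (auto simp: is_norm_c00_def is_seminorm_c00_def)

lemma scale_c00_0 [simp]: "scale_c00 0 x = 0" "scale_c00 c 0 = 0"
  by (auto intro!: c00_eqI)

lemma seminorm_zero: "is_seminorm_c00 N \<Longrightarrow> N 0 = 0"
  using is_seminorm_c00_scale[of N 0 0] by simp

lemma seminorm_nonneg: assumes "is_seminorm_c00 N" shows "0 \<le> N x"
proof -
  have "scale_c00 (-1) x = - x" by (auto intro!: c00_eqI)
  then have "N (- x) = N x" using is_seminorm_c00_scale[OF assms, of "-1" x] by simp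
  then show ?thesis
    using is_seminorm_c00_add[OF assms, of x "- x"] seminorm_zero[OF assms] by simp
qed

lemma bdd_above_coords: "bdd_above (range (\<lambda>i. norm (coord x i)))"
proof (rule bdd_aboveI)
  fix y assume "y \<in> range (\<lambda>i. norm (coord x i))"
  then obtain i where y: "y = norm (coord x i)" by auto
  show "y \<le> (\<Sum>i | coord x i \<noteq> 0. norm (coord x i))"
  proof (cases "coord x i = 0")
    case False
    then show ?thesis unfolding y by (intro member_le_sum) auto
  qed (simp add: y sum_nonneg)
qed

lemma coord_le_sup_c00: "norm (coord x i) \<le> sup_c00 x"
  unfolding sup_c00_def by (rule cSUP_upper[OF _ bdd_above_coords]) simp

lemma sup_c00_le: "(\<And>i. norm (coord x i) \<le> c) \<Longrightarrow> sup_c00 x \<le> c"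
  unfolding sup_c00_def by (rule cSUP_least) auto

lemma sup_c00_nonneg: "0 \<le> sup_c00 x"
  using coord_le_sup_c00[of x 0] norm_ge_zero order_trans by blast

lemma scale_le_via_inverse:
  fixes N :: "'k::real_normed_field c00 \<Rightarrow> real"
  assumes le: "\<And>c x. N (scale_c00 c x) \<le> norm c * N x" and nn: "\<And>x. 0 \<le> N x"
  shows "N (scale_c00 c x) = norm c * N x"
proof (cases "c = 0")
  case True
  then show ?thesis using le[of c x] nn[of "scale_c00 c x"] by simp
next
  case False
  have "x = scale_c00 (inverse c) (scale_c00 c x)" using False by (auto intro!: c00_eqI)
  then have "N x \<le> norm (inverse c) * N (scale_c00 c x)" using le by metis
  then have "norm c * N x \<le> N (scale_c00 c x)"
    using False by (simp add: norm_inverse norm_divide divide_simps mult.commute)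
  with le[of c x] show ?thesis by simp
qed

lemma seminorm_sup_c00: "is_seminorm_c00 (sup_c00 :: 'k::real_normed_field c00 \<Rightarrow> real)"
  unfolding is_seminorm_c00_def
proof (intro conjI allI)
  fix x y :: "'k c00" and c :: 'k
  show "sup_c00 (x + y) \<le> sup_c00 x + sup_c00 y"
    by (rule sup_c00_le) (auto intro: norm_triangle_le add_mono coord_le_sup_c00)
  show "sup_c00 (scale_c00 c x) = norm c * sup_c00 x"
    by (rule scale_le_via_inverse)
      (auto intro!: sup_c00_le mult_left_mono coord_le_sup_c00 sup_c00_nonneg simp: norm_mult)
qed

lemma set_before_less: "E \<lless> F \<Longrightarrow> finite E \<Longrightarrow> finite F \<Longrightarrow> m \<in> E \<Longrightarrow> n \<in> F \<Longrightarrow> m < n"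
  unfolding set_before_def by (metis Max_ge Min_le empty_iff le_less_trans order_less_le_trans)

lemma admissible_disjoint:
  assumes "tsirelson_admissible k E" "i \<in> {1..k}" "j \<in> {1..k}" "n \<in> E i" "n \<in> E j"
  shows "i = j"
  using assms set_before_less[of "E i" "E j" n n] set_before_less[of "E j" "E i" n n]
  unfolding tsirelson_admissible_def by (metis less_irrefl nat_neq_iff)

lemma admissible_empty: "tsirelson_admissible 1 (\<lambda>_. {})"
  by (auto simp: tsirelson_admissible_def set_before_def)

lemma tsirelson_sums_nonempty: "tsirelson_sums N x \<noteq> {}"
  using admissible_empty by (auto simp: tsirelson_sums_def)

lemma admissible_sum_le:
  fixes x :: "'k::real_normed_field c00"
  assumes N: "\<And>y. N y \<le> (\<Sum>i | coord y i \<noteq> 0. norm (coord y i) * w i)"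
    and w: "\<And>i. 0 \<le> w i" and E: "tsirelson_admissible k E"
  shows "(\<Sum>j=1..k. N (proj_c00 (E j) x)) \<le> (\<Sum>i | coord x i \<noteq> 0. norm (coord x i) * w i)"
proof -
  let ?t = "\<lambda>i. norm (coord x i) * w i"
  have "(\<Sum>j=1..k. N (proj_c00 (E j) x)) \<le>
      (\<Sum>j=1..k. \<Sum>i | coord x i \<noteq> 0. if Suc i \<in> E j then ?t i else 0)"
  proof (rule sum_mono)
    fix j
    have "N (proj_c00 (E j) x) \<le>
        (\<Sum>i | coord (proj_c00 (E j) x) i \<noteq> 0. norm (coord (proj_c00 (E j) x) i) * w i)"
      by (rule N)
    also have "\<dots> = (\<Sum>i | coord x i \<noteq> 0. if Suc i \<in> E j then ?t i else 0)"
      by (rule sum.mono_neutral_cong_left) auto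
    finally show "N (proj_c00 (E j) x) \<le> \<dots>" .
  qed
  also have "\<dots> = (\<Sum>i | coord x i \<noteq> 0. \<Sum>j=1..k. if Suc i \<in> E j then ?t i else 0)"
    by (rule sum.swap)
  also have "\<dots> \<le> (\<Sum>i | coord x i \<noteq> 0. ?t i)"
  proof (rule sum_mono)
    fix i
    let ?J = "{j \<in> {1..k}. Suc i \<in> E j}"
    have "(\<Sum>j=1..k. if Suc i \<in> E j then ?t i else 0) = (\<Sum>j\<in>?J. ?t i)"
      by (rule sum.mono_neutral_cong_right) auto
    also have "\<dots> = real (card ?J) * ?t i" by simp
    also have "\<dots> \<le> 1 * ?t i"
    proof (rule mult_right_mono)
      have "card ?J \<le> Suc 0"
        by (subst card_le_Suc0_iff_eq) (use admissible_disjoint[OF E] in auto)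
      then show "real (card ?J) \<le> 1" by simp
    qed (use w in auto)
    finally show "(\<Sum>j=1..k. if Suc i \<in> E j then ?t i else 0) \<le> ?t i" by simp
  qed
  finally show ?thesis .
qed

lemma c00_expand:
  fixes x :: "'k::real_normed_field c00"
  assumes "finite S" "{i. coord x i \<noteq> 0} \<subseteq> S"
  shows "x = (\<Sum>i\<in>S. scale_c00 (coord x i) (unit_c00 i))"
proof (rule c00_eqI)
  fix n
  have *: "coord (\<Sum>i\<in>S. f i) n = (\<Sum>i\<in>S. coord (f i) n)" for f :: "nat \<Rightarrow> 'k c00"
    using assms(1) by (induction S) auto
  show "coord x n = coord (\<Sum>i\<in>S. scale_c00 (coord x i) (unit_c00 i)) n"
    using assms by (auto simp: * if_distrib cong: if_cong)
qed

lemma seminorm_sum: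
  assumes "is_seminorm_c00 N"
  shows "finite S \<Longrightarrow> N (\<Sum>i\<in>S. f i) \<le> (\<Sum>i\<in>S. N (f i))"
proof (induction S rule: finite_induct)
  case (insert a S)
  then show ?case using is_seminorm_c00_add[OF assms, of "f a" "sum f S"] by simp
qed (simp add: seminorm_zero[OF assms])

lemma seminorm_le_weighted:
  assumes "is_seminorm_c00 N"
  shows "N x \<le> (\<Sum>i | coord x i \<noteq> 0. norm (coord x i) * N (unit_c00 i))"
  using seminorm_sum[OF assms finite_support, of "\<lambda>i. scale_c00 (coord x i) (unit_c00 i)" x]
  by (simp add: c00_expand[OF finite_support order_refl, symmetric] is_seminorm_c00_scale[OF assms])

lemma bdd_above_tsirelson_sums:
  assumes "is_seminorm_c00 N" shows "bdd_above (tsirelson_sums N x)"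
  unfolding tsirelson_sums_def
  by (rule bdd_aboveI[where M = "\<Sum>i | coord x i \<noteq> 0. norm (coord x i) * N (unit_c00 i)"])
    (auto simp del: One_nat_def intro!: admissible_sum_le seminorm_le_weighted[OF assms] seminorm_nonneg[OF assms])

lemma sup_le_tsirelson_rhs: "sup_c00 x \<le> tsirelson_rhs N x"
  by (simp add: tsirelson_rhs_def)

lemma sum_le_tsirelson_rhs:
  assumes "is_seminorm_c00 N" "tsirelson_admissible k E"
  shows "(\<Sum>j=1..k. N (proj_c00 (E j) x)) \<le> 2 * tsirelson_rhs N x"
proof -
  have "(\<Sum>j=1..k. N (proj_c00 (E j) x)) \<le> Sup (tsirelson_sums N x)"
    by (rule cSup_upper[OF _ bdd_above_tsirelson_sums[OF assms(1)]])
      (use assms(2) in \<open>auto simp: tsirelson_sums_def\<close>)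
  then show ?thesis by (simp add: tsirelson_rhs_def)
qed

lemma tsirelson_rhs_le:
  assumes "sup_c00 x \<le> c"
    and "\<And>k E. tsirelson_admissible k E \<Longrightarrow> (\<Sum>j=1..k. N (proj_c00 (E j) x)) \<le> 2 * c"
  shows "tsirelson_rhs N x \<le> c"
proof -
  have "Sup (tsirelson_sums N x) \<le> 2 * c"
    by (rule cSup_least[OF tsirelson_sums_nonempty]) (use assms(2) in \<open>auto simp: tsirelson_sums_def\<close>)
  then show ?thesis using assms(1) by (simp add: tsirelson_rhs_def)
qed

lemma proj_c00_add: "proj_c00 E (x + y) = proj_c00 E x + proj_c00 E y"
  and proj_c00_scale: "proj_c00 E (scale_c00 c x) = scale_c00 c (proj_c00 E x)"
  by (auto intro!: c00_eqI)

lemma tsirelson_rhs_nonneg: "0 \<le> tsirelson_rhs N x"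
  using sup_c00_nonneg sup_le_tsirelson_rhs order_trans by blast

lemma seminorm_tsirelson_rhs:
  fixes N :: "'k::real_normed_field c00 \<Rightarrow> real"
  assumes N: "is_seminorm_c00 N" shows "is_seminorm_c00 (tsirelson_rhs N)"
  unfolding is_seminorm_c00_def
proof (intro conjI allI)
  fix x y :: "'k c00" and c :: 'k
  show "tsirelson_rhs N (x + y) \<le> tsirelson_rhs N x + tsirelson_rhs N y"
  proof (rule tsirelson_rhs_le)
    show "sup_c00 (x + y) \<le> tsirelson_rhs N x + tsirelson_rhs N y"
      using is_seminorm_c00_add[OF seminorm_sup_c00, of x y]
        sup_le_tsirelson_rhs[of x N] sup_le_tsirelson_rhs[of y N] by linarith
    fix k E assume E: "tsirelson_admissible k E"
    have "(\<Sum>j=1..k. N (proj_c00 (E j) (x + y))) \<le>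
        (\<Sum>j=1..k. N (proj_c00 (E j) x)) + (\<Sum>j=1..k. N (proj_c00 (E j) y))"
      unfolding sum.distrib[symmetric] proj_c00_add by (intro sum_mono is_seminorm_c00_add[OF N])
    then show "(\<Sum>j=1..k. N (proj_c00 (E j) (x + y))) \<le>
        2 * (tsirelson_rhs N x + tsirelson_rhs N y)"
      by (rule order_trans)
        (use add_mono[OF sum_le_tsirelson_rhs[OF N E, of x] sum_le_tsirelson_rhs[OF N E, of y]] in simp)
  qed
  show "tsirelson_rhs N (scale_c00 c x) = norm c * tsirelson_rhs N x"
  proof (rule scale_le_via_inverse)
    fix c :: 'k and x :: "'k c00"
    show "tsirelson_rhs N (scale_c00 c x) \<le> norm c * tsirelson_rhs N x"
    proof (rule tsirelson_rhs_le)
      show "sup_c00 (scale_c00 c x) \<le> norm c * tsirelson_rhs N x"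
        by (simp add: is_seminorm_c00_scale[OF seminorm_sup_c00] sup_le_tsirelson_rhs mult_left_mono)
      fix k E assume E: "tsirelson_admissible k E"
      have "(\<Sum>j=1..k. N (proj_c00 (E j) (scale_c00 c x))) = norm c * (\<Sum>j=1..k. N (proj_c00 (E j) x))"
        by (simp add: proj_c00_scale is_seminorm_c00_scale[OF N] sum_distrib_left)
      also have "\<dots> \<le> norm c * (2 * tsirelson_rhs N x)"
        by (intro mult_left_mono sum_le_tsirelson_rhs[OF N E]) auto
      finally show "(\<Sum>j=1..k. N (proj_c00 (E j) (scale_c00 c x))) \<le> 2 * (norm c * tsirelson_rhs N x)"
        by simp
    qed
  qed (rule tsirelson_rhs_nonneg)
qed

lemma tsirelson_rhs_mono:
  assumes "is_seminorm_c00 M" "\<And>y. N y \<le> M y"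
  shows "tsirelson_rhs N x \<le> tsirelson_rhs M x"
  by (rule tsirelson_rhs_le[OF sup_le_tsirelson_rhs])
    (rule order_trans[OF sum_mono sum_le_tsirelson_rhs[OF assms(1)]], rule assms(2))

definition tsirelson_iter :: "nat \<Rightarrow> 'k::real_normed_field c00 \<Rightarrow> real" where
  "tsirelson_iter m = (tsirelson_rhs ^^ m) sup_c00"

lemma tsirelson_iter_0: "tsirelson_iter 0 = sup_c00"
  and tsirelson_iter_Suc: "tsirelson_iter (Suc m) = tsirelson_rhs (tsirelson_iter m)"
  by (simp_all add: tsirelson_iter_def)

lemma seminorm_tsirelson_iter: "is_seminorm_c00 (tsirelson_iter m)"
  by (induction m) (simp_all add: tsirelson_iter_0 tsirelson_iter_Suc seminorm_sup_c00 seminorm_tsirelson_rhs)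

lemma tsirelson_iter_mono: "tsirelson_iter m x \<le> tsirelson_iter (Suc m) x"
proof (induction m arbitrary: x)
  case 0
  show ?case by (simp add: tsirelson_iter_0 tsirelson_iter_Suc sup_le_tsirelson_rhs)
next
  case (Suc m)
  show ?case
    unfolding tsirelson_iter_Suc[of "Suc m"] tsirelson_iter_Suc[of m]
    using tsirelson_rhs_mono[OF seminorm_tsirelson_iter[of "Suc m"] Suc.IH, of x]
    by (simp add: tsirelson_iter_Suc)
qed

lemma tsirelson_iter_le: "tsirelson_iter m x \<le> (\<Sum>i | coord x i \<noteq> 0. norm (coord x i))"
proof (induction m arbitrary: x)
  case 0
  have "norm (coord x i) \<le> (\<Sum>i | coord x i \<noteq> 0. norm (coord x i))" for i
    by (cases "coord x i = 0") (auto intro: sum_nonneg member_le_sum)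
  then show ?case unfolding tsirelson_iter_0 by (rule sup_c00_le)
next
  case (Suc m)
  have *: "norm (coord x i) \<le> (\<Sum>i | coord x i \<noteq> 0. norm (coord x i))" for i
    by (cases "coord x i = 0") (auto intro: sum_nonneg member_le_sum)
  show ?case unfolding tsirelson_iter_Suc
  proof (rule tsirelson_rhs_le)
    show "sup_c00 x \<le> (\<Sum>i | coord x i \<noteq> 0. norm (coord x i))" using * by (rule sup_c00_le)
    fix k E assume "tsirelson_admissible k E"
    then have "(\<Sum>j=1..k. tsirelson_iter m (proj_c00 (E j) x)) \<le>
        (\<Sum>i | coord x i \<noteq> 0. norm (coord x i))"
      using admissible_sum_le[of "tsirelson_iter m" "\<lambda>_. 1" k E x] Suc.IH by simp
    moreover have "0 \<le> (\<Sum>i | coord x i \<noteq> 0. norm (coord x i))" by (simp add: sum_nonneg)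
    ultimately show "(\<Sum>j=1..k. tsirelson_iter m (proj_c00 (E j) x)) \<le>
        2 * (\<Sum>i | coord x i \<noteq> 0. norm (coord x i))" by linarith
  qed
qed

definition tsirelson_limit :: "'k::real_normed_field c00 \<Rightarrow> real" where
  "tsirelson_limit x = (SUP m. tsirelson_iter m x)"

lemma bdd_above_tsirelson_iter: "bdd_above (range (\<lambda>m. tsirelson_iter m x))"
  using tsirelson_iter_le by (auto intro!: bdd_aboveI)

lemma tsirelson_iter_le_limit: "tsirelson_iter m x \<le> tsirelson_limit x"
  unfolding tsirelson_limit_def by (rule cSUP_upper[OF _ bdd_above_tsirelson_iter]) simp

lemma tsirelson_iter_tendsto: "(\<lambda>m. tsirelson_iter m x) \<longlonglongrightarrow> tsirelson_limit x"
  unfolding tsirelson_limit_def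
  by (rule LIMSEQ_incseq_SUP[OF bdd_above_tsirelson_iter])
    (simp add: incseq_SucI tsirelson_iter_mono)

lemma seminorm_tsirelson_limit: "is_seminorm_c00 (tsirelson_limit :: 'k::real_normed_field c00 \<Rightarrow> real)"
  unfolding is_seminorm_c00_def
proof (intro conjI allI)
  fix x y :: "'k c00" and c :: 'k
  show "tsirelson_limit (x + y) \<le> tsirelson_limit x + tsirelson_limit y"
    by (rule LIMSEQ_le[OF tsirelson_iter_tendsto tendsto_add[OF tsirelson_iter_tendsto tsirelson_iter_tendsto]])
      (intro exI[of _ 0] allI impI is_seminorm_c00_add[OF seminorm_tsirelson_iter])
  have "(\<lambda>m. tsirelson_iter m (scale_c00 c x)) \<longlonglongrightarrow> norm c * tsirelson_limit x"
    unfolding is_seminorm_c00_scale[OF seminorm_tsirelson_iter]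
    by (intro tendsto_mult_left tsirelson_iter_tendsto)
  then show "tsirelson_limit (scale_c00 c x) = norm c * tsirelson_limit x"
    using tsirelson_iter_tendsto LIMSEQ_unique by blast
qed

lemma tsirelson_limit_eq:
  fixes x :: "'k::real_normed_field c00"
  shows "tsirelson_limit x = tsirelson_rhs tsirelson_limit x"
proof (rule antisym)
  show "tsirelson_limit x \<le> tsirelson_rhs tsirelson_limit x"
    unfolding tsirelson_limit_def[of x]
  proof (rule cSUP_least)
    fix m
    have "tsirelson_iter m x \<le> tsirelson_iter (Suc m) x" by (rule tsirelson_iter_mono)
    also have "\<dots> \<le> tsirelson_rhs tsirelson_limit x"
      unfolding tsirelson_iter_Suc
      by (rule tsirelson_rhs_mono[OF seminorm_tsirelson_limit tsirelson_iter_le_limit])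
    finally show "tsirelson_iter m x \<le> tsirelson_rhs tsirelson_limit x" .
  qed simp
  show "tsirelson_rhs tsirelson_limit x \<le> tsirelson_limit x"
  proof (rule tsirelson_rhs_le)
    show "sup_c00 x \<le> tsirelson_limit x" using tsirelson_iter_le_limit[of 0 x] by (simp add: tsirelson_iter_0)
    fix k E assume E: "tsirelson_admissible k E"
    have "(\<lambda>m. \<Sum>j=1..k. tsirelson_iter m (proj_c00 (E j) x)) \<longlonglongrightarrow>
        (\<Sum>j=1..k. tsirelson_limit (proj_c00 (E j) x))"
      by (intro tendsto_sum tsirelson_iter_tendsto)
    moreover have "(\<Sum>j=1..k. tsirelson_iter m (proj_c00 (E j) x)) \<le> 2 * tsirelson_limit x" for m
      using sum_le_tsirelson_rhs[OF seminorm_tsirelson_iter E, of m x]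
        tsirelson_iter_le_limit[of "Suc m" x] by (simp add: tsirelson_iter_Suc)
    ultimately show "(\<Sum>j=1..k. tsirelson_limit (proj_c00 (E j) x)) \<le> 2 * tsirelson_limit x"
      by (intro LIMSEQ_le_const2) auto
  qed
qed

lemma is_norm_tsirelson_limit:
  "is_norm_c00 (tsirelson_limit :: 'k::real_normed_field c00 \<Rightarrow> real)"
proof -
  have "x = 0" if "tsirelson_limit x = 0" for x :: "'k c00"
  proof (rule c00_eqI)
    fix i
    have "norm (coord x i) \<le> tsirelson_limit x"
      using coord_le_sup_c00[of x i] tsirelson_iter_le_limit[of 0 x] by (simp add: tsirelson_iter_0)
    with that show "coord x i = coord 0 i" by simp
  qed
  then show ?thesis
    using seminorm_tsirelson_limit seminorm_zero[OF seminorm_tsirelson_limit]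
    unfolding is_norm_c00_def is_seminorm_c00_def by blast
qed

lemma tsirelson_norm_le_unique:
  fixes N M :: "'k::real_normed_field c00 \<Rightarrow> real"
  assumes N: "is_norm_c00 N" "\<forall>x. N x = tsirelson_rhs N x"
    and M: "is_norm_c00 M" "\<forall>x. M x = tsirelson_rhs M x"
  shows "N x \<le> M x"
proof (induction "card {i. coord x i \<noteq> 0}" arbitrary: x rule: less_induct)
  case less
  note sN = is_norm_imp_seminorm[OF N(1)] and sM = is_norm_imp_seminorm[OF M(1)]
  have "tsirelson_rhs N x \<le> max (M x) (1/2 * N x)"
  proof (rule tsirelson_rhs_le)
    show "sup_c00 x \<le> max (M x) (1/2 * N x)"
      using sup_le_tsirelson_rhs[of x M] M(2) by (simp add: le_max_iff_disj)
    fix k E assume E: "tsirelson_admissible k E"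
    show "(\<Sum>j=1..k. N (proj_c00 (E j) x)) \<le> 2 * max (M x) (1/2 * N x)"
    proof (cases "\<exists>j\<in>{1..k}. {i. coord x i \<noteq> 0} \<subseteq> {i. Suc i \<in> E j}")
      case True
      then obtain j where j: "j \<in> {1..k}" "{i. coord x i \<noteq> 0} \<subseteq> {i. Suc i \<in> E j}" by blast
      have "proj_c00 (E l) x = 0" if "l \<in> {1..k} - {j}" for l
      proof (rule c00_eqI)
        fix i
        show "coord (proj_c00 (E l) x) i = coord 0 i"
          using that j admissible_disjoint[OF E, of l j "Suc i"] by auto
      qed
      then have "(\<Sum>j=1..k. N (proj_c00 (E j) x)) = (\<Sum>j\<in>{j}. N (proj_c00 (E j) x))"
        using j(1) by (intro sum.mono_neutral_right) (auto simp: seminorm_zero[OF sN])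
      also have "\<dots> = N (proj_c00 (E j) x)" by simp
      also have "proj_c00 (E j) x = x" using j(2) by (auto intro!: c00_eqI)
      finally show ?thesis by simp
    next
      case False
      have "(\<Sum>j=1..k. N (proj_c00 (E j) x)) \<le> (\<Sum>j=1..k. M (proj_c00 (E j) x))"
      proof (rule sum_mono)
        fix j assume "j \<in> {1..k}"
        with False have "{i. coord (proj_c00 (E j) x) i \<noteq> 0} \<subset> {i. coord x i \<noteq> 0}" by auto
        then show "N (proj_c00 (E j) x) \<le> M (proj_c00 (E j) x)"
          by (intro less psubset_card_mono finite_support)
      qed
      also have "\<dots> \<le> 2 * M x" using sum_le_tsirelson_rhs[OF sM E, of x] M(2) by simp
      finally show ?thesis by simp
    qed
  qed
  then have "N x \<le> max (M x) (1/2 * N x)" using N(2) by simp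
  then show ?case using seminorm_nonneg[OF sM, of x] by (auto simp: le_max_iff_disj)
qed

lemma tsirelson_norm_ex1:
  "\<exists>!N :: 'k::real_normed_field c00 \<Rightarrow> real. is_norm_c00 N \<and> (\<forall>x. N x = tsirelson_rhs N x)"
proof (rule ex1I[of _ tsirelson_limit])
  show "is_norm_c00 tsirelson_limit \<and>
      (\<forall>x :: 'k c00. tsirelson_limit x = tsirelson_rhs tsirelson_limit x)"
    using is_norm_tsirelson_limit tsirelson_limit_eq by blast
  fix N :: "'k c00 \<Rightarrow> real"
  assume N: "is_norm_c00 N \<and> (\<forall>x. N x = tsirelson_rhs N x)"
  show "N = tsirelson_limit"
    using N is_norm_tsirelson_limit tsirelson_limit_eq
    by (intro ext antisym tsirelson_norm_le_unique) blast+
qed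

lemma tsirelson_norm_eq_limit: "tsirelson_norm = tsirelson_limit"
  unfolding tsirelson_norm_def
  by (rule the1_equality[OF tsirelson_norm_ex1])
    (use is_norm_tsirelson_limit tsirelson_limit_eq in blast)

lemma is_norm_tsirelson_norm: "is_norm_c00 (tsirelson_norm :: 'k::real_normed_field c00 \<Rightarrow> real)"
  and tsirelson_norm_eq: "tsirelson_norm x = tsirelson_rhs tsirelson_norm x"
  using is_norm_tsirelson_limit tsirelson_limit_eq by (simp_all add: tsirelson_norm_eq_limit)

lemma tsirelson_iter_unconditional:
  assumes "\<And>i. norm (coord x i) \<le> norm (coord y i)"
  shows "tsirelson_iter m x \<le> tsirelson_iter m y"
  using assms
proof (induction m arbitrary: x y)
  case 0
  then show ?case
    unfolding tsirelson_iter_0 by (intro sup_c00_le order_trans[OF 0 coord_le_sup_c00])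
next
  case (Suc m)
  show ?case
    unfolding tsirelson_iter_Suc
  proof (rule tsirelson_rhs_le)
    show "sup_c00 x \<le> tsirelson_rhs (tsirelson_iter m) y"
      by (intro order_trans[OF _ sup_le_tsirelson_rhs] sup_c00_le order_trans[OF Suc.prems coord_le_sup_c00])
    fix k E assume E: "tsirelson_admissible k E"
    have "(\<Sum>j=1..k. tsirelson_iter m (proj_c00 (E j) x)) \<le> (\<Sum>j=1..k. tsirelson_iter m (proj_c00 (E j) y))"
      using Suc.prems by (intro sum_mono Suc.IH) simp
    also have "\<dots> \<le> 2 * tsirelson_rhs (tsirelson_iter m) y"
      by (rule sum_le_tsirelson_rhs[OF seminorm_tsirelson_iter E])
    finally show "(\<Sum>j=1..k. tsirelson_iter m (proj_c00 (E j) x)) \<le> 2 * tsirelson_rhs (tsirelson_iter m) y" .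
  qed
qed

instantiation c00 :: (real_normed_field) real_normed_vector
begin

definition norm_c00 :: "'a c00 \<Rightarrow> real" where "norm_c00 = tsirelson_norm"
definition dist_c00 :: "'a c00 \<Rightarrow> 'a c00 \<Rightarrow> real" where "dist_c00 x y = norm (x - y)"
definition sgn_c00 :: "'a c00 \<Rightarrow> 'a c00" where "sgn_c00 x = x /\<^sub>R norm x"
definition uniformity_c00 :: "('a c00 \<times> 'a c00) filter"
  where "uniformity_c00 = (INF e\<in>{0<..}. principal {(x, y). dist x y < e})"
definition open_c00 :: "'a c00 set \<Rightarrow> bool"
  where "open_c00 U \<longleftrightarrow> (\<forall>x\<in>U. eventually (\<lambda>(x', y). x' = x \<longrightarrow> y \<in> U) uniformity)"

instance
proof
  fix x y :: "'a c00" and r :: real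
  show "norm x = 0 \<longleftrightarrow> x = 0" "norm (x + y) \<le> norm x + norm y"
    using is_norm_tsirelson_norm unfolding norm_c00_def is_norm_c00_def by blast+
  have "r *\<^sub>R x = scale_c00 (of_real r) x" by (rule c00_eqI) (simp add: scaleR_conv_of_real)
  then show "norm (r *\<^sub>R x) = \<bar>r\<bar> * norm x"
    using is_norm_tsirelson_norm[where 'k = 'a] unfolding norm_c00_def is_norm_c00_def by simp
qed (simp_all add: dist_c00_def sgn_c00_def uniformity_c00_def open_c00_def)

end

lemma norm_scale_c00: "norm (scale_c00 c x) = norm c * norm x"
  using is_norm_tsirelson_norm unfolding norm_c00_def is_norm_c00_def by blast

lemma norm_coord_le: "norm (coord x i) \<le> norm x"
  using coord_le_sup_c00[of x i] tsirelson_iter_le_limit[of 0 x]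
  by (simp add: tsirelson_iter_0 norm_c00_def tsirelson_norm_eq_limit)

lemma norm_c00_unconditional:
  assumes "\<And>i. norm (coord x i) \<le> norm (coord y i)"
  shows "norm x \<le> norm y"
  unfolding norm_c00_def tsirelson_norm_eq_limit
  by (rule LIMSEQ_le[OF tsirelson_iter_tendsto tsirelson_iter_tendsto])
    (intro exI[of _ 0] allI impI tsirelson_iter_unconditional[OF assms])


subsection \<open>Completion of a normed space\<close>

definition completion_rel :: "(nat \<Rightarrow> 'a::real_normed_vector) \<Rightarrow> (nat \<Rightarrow> 'a) \<Rightarrow> bool" where
  "completion_rel x y \<longleftrightarrow> Cauchy x \<and> Cauchy y \<and> (\<lambda>n. x n - y n) \<longlonglongrightarrow> 0"

lemma completion_rel_refl: "completion_rel x x \<longleftrightarrow> Cauchy x"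
  by (simp add: completion_rel_def)

lemma part_equivp_completion_rel: "part_equivp completion_rel"
proof (rule part_equivpI)
  show "\<exists>x :: nat \<Rightarrow> 'a. completion_rel x x"
    unfolding completion_rel_refl by (intro exI[of _ "\<lambda>_. 0"] convergent_Cauchy convergent_const)
  show "symp (completion_rel :: (nat \<Rightarrow> 'a) \<Rightarrow> _)"
  proof (rule sympI)
    fix x y :: "nat \<Rightarrow> 'a" assume "completion_rel x y"
    then show "completion_rel y x"
      using tendsto_minus[of "\<lambda>n. x n - y n" 0] by (auto simp: completion_rel_def)
  qed
  show "transp (completion_rel :: (nat \<Rightarrow> 'a) \<Rightarrow> _)"
  proof (rule transpI)
    fix x y z :: "nat \<Rightarrow> 'a" assume "completion_rel x y" "completion_rel y z"
    then show "completion_rel x z"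
      using tendsto_add[of "\<lambda>n. x n - y n" 0 sequentially "\<lambda>n. y n - z n" 0]
      by (auto simp: completion_rel_def)
  qed
qed

quotient_type (overloaded) 'a completion = "nat \<Rightarrow> 'a::real_normed_vector" / partial: completion_rel
  by (rule part_equivp_completion_rel)

lemma Cauchy_norm: "Cauchy x \<Longrightarrow> convergent (\<lambda>n. norm (x n))"
  for x :: "nat \<Rightarrow> 'a::real_normed_vector"
proof (rule Cauchy_convergent, rule metric_CauchyI)
  fix e :: real assume "Cauchy x" "0 < e"
  then obtain M where "\<forall>m\<ge>M. \<forall>n\<ge>M. dist (x m) (x n) < e" by (auto simp: Cauchy_def)
  moreover have "dist (norm (x m)) (norm (x n)) \<le> dist (x m) (x n)" for m n
    by (simp add: dist_norm norm_triangle_ineq3)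
  ultimately show "\<exists>M. \<forall>m\<ge>M. \<forall>n\<ge>M. dist (norm (x m)) (norm (x n)) < e"
    by (meson le_less_trans)
qed

lemma Cauchy_add:
  fixes x y :: "nat \<Rightarrow> 'a::real_normed_vector"
  assumes "Cauchy x" "Cauchy y" shows "Cauchy (\<lambda>n. x n + y n)"
proof (rule CauchyI)
  fix e :: real assume "0 < e"
  then have "0 < e/2" by simp
  obtain M where M: "\<And>m n. m \<ge> M \<Longrightarrow> n \<ge> M \<Longrightarrow> norm (x m - x n) < e/2"
    using CauchyD[OF assms(1) \<open>0 < e/2\<close>] by blast
  obtain N where N: "\<And>m n. m \<ge> N \<Longrightarrow> n \<ge> N \<Longrightarrow> norm (y m - y n) < e/2"
    using CauchyD[OF assms(2) \<open>0 < e/2\<close>] by blast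
  have "norm (x m + y m - (x n + y n)) < e" if "m \<ge> max M N" "n \<ge> max M N" for m n
    using norm_triangle_ineq[of "x m - x n" "y m - y n"] M[of m n] N[of m n] that
    by (simp add: add_diff_add)
  then show "\<exists>M. \<forall>m\<ge>M. \<forall>n\<ge>M. norm (x m + y m - (x n + y n)) < e" by blast
qed

lemma Cauchy_diff:
  fixes x y :: "nat \<Rightarrow> 'a::real_normed_vector"
  assumes "Cauchy x" "Cauchy y" shows "Cauchy (\<lambda>n. x n - y n)"
  using Cauchy_add[OF assms(1) bounded_linear.Cauchy[OF bounded_linear_minus[OF bounded_linear_ident] assms(2)]]
  by simp

instantiation completion :: (real_normed_vector) real_vector
begin

lift_definition zero_completion :: "'a completion" is "\<lambda>_. 0"
  by (simp add: completion_rel_def convergent_Cauchy convergent_const)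

lift_definition plus_completion :: "'a completion \<Rightarrow> 'a completion \<Rightarrow> 'a completion"
  is "\<lambda>x y n. x n + y n"
  subgoal for x x' y y'
    using tendsto_add[of "\<lambda>n. x n - x' n" 0 sequentially "\<lambda>n. y n - y' n" 0]
    by (auto simp: completion_rel_def algebra_simps intro: Cauchy_add)
  done

lift_definition uminus_completion :: "'a completion \<Rightarrow> 'a completion" is "\<lambda>x n. - x n"
  subgoal for x x'
    using tendsto_minus[of "\<lambda>n. x n - x' n" 0] bounded_linear.Cauchy[OF bounded_linear_minus[OF bounded_linear_ident]]
    by (auto simp: completion_rel_def algebra_simps)
  done

lift_definition minus_completion :: "'a completion \<Rightarrow> 'a completion \<Rightarrow> 'a completion"
  is "\<lambda>x y n. x n - y n"
  subgoal for x x' y y'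
    using tendsto_diff[of "\<lambda>n. x n - x' n" 0 sequentially "\<lambda>n. y n - y' n" 0]
      bounded_linear.Cauchy[OF bounded_linear_minus[OF bounded_linear_ident]]
    by (auto simp: completion_rel_def algebra_simps intro: Cauchy_diff)
  done

lift_definition scaleR_completion :: "real \<Rightarrow> 'a completion \<Rightarrow> 'a completion" is "\<lambda>r x n. r *\<^sub>R x n"
  subgoal for r x x'
    using tendsto_scaleR[OF tendsto_const, of "\<lambda>n. x n - x' n" 0 sequentially r]
      bounded_linear.Cauchy[OF bounded_linear_scaleR_right]
    by (auto simp: completion_rel_def algebra_simps)
  done

lemma completion_rel_eqI: "completion_rel x x \<Longrightarrow> x = y \<Longrightarrow> completion_rel x y"
  by simp

instance
proof
  fix a b c :: "'a completion" and r s :: real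
  show "a + b + c = a + (b + c)"
    by transfer (rule completion_rel_eqI, auto simp: completion_rel_refl algebra_simps intro: Cauchy_add)
  show "a + b = b + a"
    by transfer (rule completion_rel_eqI, auto simp: completion_rel_refl algebra_simps intro: Cauchy_add)
  show "0 + a = a"
    by transfer (simp add: completion_rel_refl)
  show "- a + a = 0"
    by transfer (simp add: completion_rel_refl convergent_Cauchy convergent_const)
  show "a - b = a + - b"
    by transfer (rule completion_rel_eqI, auto simp: completion_rel_refl algebra_simps intro: Cauchy_diff)
  show "r *\<^sub>R (a + b) = r *\<^sub>R a + r *\<^sub>R b"
    by transfer (rule completion_rel_eqI, auto simp: completion_rel_refl algebra_simps
      intro!: Cauchy_add bounded_linear.Cauchy[OF bounded_linear_scaleR_right])
  show "(r + s) *\<^sub>R a = r *\<^sub>R a + s *\<^sub>R a"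
    by transfer (rule completion_rel_eqI, auto simp: completion_rel_refl algebra_simps
      intro!: Cauchy_add bounded_linear.Cauchy[OF bounded_linear_scaleR_right])
  show "r *\<^sub>R s *\<^sub>R a = (r * s) *\<^sub>R a"
    by transfer (rule completion_rel_eqI, auto simp: completion_rel_refl
      intro!: bounded_linear.Cauchy[OF bounded_linear_scaleR_right])
  show "1 *\<^sub>R a = a"
    by transfer (simp add: completion_rel_refl)
qed

end

instantiation completion :: (real_normed_vector) real_normed_vector
begin

lift_definition norm_completion :: "'a completion \<Rightarrow> real" is "\<lambda>x. lim (\<lambda>n. norm (x n))"
proof -
  fix x y :: "nat \<Rightarrow> 'a" assume *: "completion_rel x y"
  have "(\<lambda>n. norm (x n) - norm (y n)) \<longlonglongrightarrow> 0"
    by (rule Lim_null_comparison[of _ "\<lambda>n. norm (x n - y n)"])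
      (use * in \<open>auto simp: completion_rel_def norm_triangle_ineq3 tendsto_norm_zero_iff\<close>)
  moreover have "(\<lambda>n. norm (y n)) \<longlonglongrightarrow> lim (\<lambda>n. norm (y n))"
    using * Cauchy_norm by (auto simp: completion_rel_def convergent_LIMSEQ_iff)
  ultimately have "(\<lambda>n. norm (x n)) \<longlonglongrightarrow> lim (\<lambda>n. norm (y n))"
    using tendsto_add by fastforce
  then show "lim (\<lambda>n. norm (x n)) = lim (\<lambda>n. norm (y n))" by (rule limI)
qed

definition dist_completion :: "'a completion \<Rightarrow> 'a completion \<Rightarrow> real"
  where "dist_completion x y = norm (x - y)"
definition sgn_completion :: "'a completion \<Rightarrow> 'a completion"
  where "sgn_completion x = x /\<^sub>R norm x"
definition uniformity_completion :: "('a completion \<times> 'a completion) filter"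
  where "uniformity_completion = (INF e\<in>{0<..}. principal {(x, y). dist x y < e})"
definition open_completion :: "'a completion set \<Rightarrow> bool"
  where "open_completion U \<longleftrightarrow> (\<forall>x\<in>U. eventually (\<lambda>(x', y). x' = x \<longrightarrow> y \<in> U) uniformity)"

instance
proof
  fix a b :: "'a completion" and r :: real
  have lim: "(\<lambda>n. norm (x n)) \<longlonglongrightarrow> lim (\<lambda>n. norm (x n))" if "Cauchy x" for x :: "nat \<Rightarrow> 'a"
    using Cauchy_norm[OF that] by (simp add: convergent_LIMSEQ_iff)
  show "norm a = 0 \<longleftrightarrow> a = 0"
  proof (transfer, unfold completion_rel_refl)
    fix x :: "nat \<Rightarrow> 'a" assume x: "Cauchy x"
    have "lim (\<lambda>n. norm (x n)) = 0 \<longleftrightarrow> (\<lambda>n. norm (x n)) \<longlonglongrightarrow> 0"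
      using lim[OF x] limI[of "\<lambda>n. norm (x n)" 0] by auto
    also have "\<dots> \<longleftrightarrow> completion_rel x (\<lambda>_. 0)"
      using x by (simp add: completion_rel_def tendsto_norm_zero_iff convergent_Cauchy convergent_const)
    finally show "lim (\<lambda>n. norm (x n)) = 0 \<longleftrightarrow> completion_rel x (\<lambda>_. 0)" .
  qed
  show "norm (a + b) \<le> norm a + norm b"
  proof (transfer, unfold completion_rel_refl)
    fix x y :: "nat \<Rightarrow> 'a" assume x: "Cauchy x" and y: "Cauchy y"
    show "lim (\<lambda>n. norm (x n + y n)) \<le> lim (\<lambda>n. norm (x n)) + lim (\<lambda>n. norm (y n))"
      by (rule LIMSEQ_le[OF lim[OF Cauchy_add[OF x y]] tendsto_add[OF lim[OF x] lim[OF y]]])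
        (simp add: norm_triangle_ineq)
  qed
  show "norm (r *\<^sub>R a) = \<bar>r\<bar> * norm a"
  proof (transfer, unfold completion_rel_refl)
    fix r and x :: "nat \<Rightarrow> 'a" assume x: "Cauchy x"
    show "lim (\<lambda>n. norm (r *\<^sub>R x n)) = \<bar>r\<bar> * lim (\<lambda>n. norm (x n))"
      by (rule limI) (simp add: tendsto_mult_left lim[OF x])
  qed
qed (simp_all add: dist_completion_def sgn_completion_def uniformity_completion_def open_completion_def)

end

lift_definition completion_of :: "'a::real_normed_vector \<Rightarrow> 'a completion" is "\<lambda>a _. a"
  by (simp add: completion_rel_def convergent_Cauchy convergent_const)

lemma norm_completion_of [simp]: "norm (completion_of a) = norm a"
  by transfer simp

lemma completion_of_add: "completion_of (a + b) = completion_of a + completion_of b"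
  by transfer (simp add: completion_rel_refl convergent_Cauchy convergent_const)

lemma completion_of_diff: "completion_of (a - b) = completion_of a - completion_of b"
  by transfer (simp add: completion_rel_refl convergent_Cauchy convergent_const)

lemma completion_of_scaleR: "completion_of (r *\<^sub>R a) = r *\<^sub>R completion_of a"
  by transfer (simp add: completion_rel_refl convergent_Cauchy convergent_const)

lemma linear_completion_of: "linear completion_of"
  by (rule linearI) (simp_all add: completion_of_add completion_of_scaleR)

lemma completion_of_tendsto_abs:
  assumes x: "Cauchy x" shows "(\<lambda>n. completion_of (x n)) \<longlonglongrightarrow> abs_completion x"
proof (rule metric_LIMSEQ_I)
  fix e :: real assume "0 < e"
  then obtain M where M: "\<And>m n. m \<ge> M \<Longrightarrow> n \<ge> M \<Longrightarrow> norm (x m - x n) < e/2"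
    using CauchyD[OF x, of "e/2"] by auto
  have "dist (completion_of (x n)) (abs_completion x) < e" if n: "n \<ge> M" for n
  proof -
    have "dist (completion_of (x n)) (abs_completion x) = norm (completion_of (x n) - abs_completion x)"
      by (simp add: dist_completion_def)
    also have "completion_of (x n) - abs_completion x = abs_completion (\<lambda>k. x n - x k)"
      using x by (simp add: completion_of.abs_eq minus_completion.abs_eq completion_rel_refl
        convergent_Cauchy convergent_const)
    also have "norm \<dots> = lim (\<lambda>k. norm (x n - x k))"
      using x by (intro norm_completion.abs_eq)
        (simp add: completion_rel_refl Cauchy_diff convergent_Cauchy convergent_const)
    also have "\<dots> \<le> e/2"
    proof (rule LIMSEQ_le_const2)
      show "(\<lambda>k. norm (x n - x k)) \<longlonglongrightarrow> lim (\<lambda>k. norm (x n - x k))"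
        using Cauchy_norm[OF Cauchy_diff[OF convergent_Cauchy[OF convergent_const] x]]
        by (simp add: convergent_LIMSEQ_iff)
      show "\<exists>N. \<forall>k\<ge>N. norm (x n - x k) \<le> e/2"
        using M[OF n] by (meson less_imp_le)
    qed
    finally show ?thesis using \<open>0 < e\<close> by simp
  qed
  then show "\<exists>M. \<forall>n\<ge>M. dist (completion_of (x n)) (abs_completion x) < e" by blast
qed

lemma completion_approx:
  fixes z :: "'a::real_normed_vector completion"
  obtains x where "Cauchy x" "(\<lambda>n. completion_of (x n)) \<longlonglongrightarrow> z"
proof -
  obtain x where "completion_rel x x" "z = abs_completion x"
    by (induction z rule: completion.abs_induct) auto
  then show ?thesis using that completion_of_tendsto_abs by (auto simp: completion_rel_refl)
qed

lemma completion_dense: assumes "0 < e" obtains a where "dist (completion_of a) z < e"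
  using completion_approx[of z] assms by (meson metric_LIMSEQ_D order_refl)

instance completion :: (real_normed_vector) banach
proof
  fix X :: "nat \<Rightarrow> 'a completion" assume X: "Cauchy X"
  have "\<forall>n. \<exists>a. dist (completion_of a) (X n) < inverse (Suc n)"
    by (meson completion_dense inverse_positive_iff_positive of_nat_0_less_iff zero_less_Suc)
  then obtain a where a: "\<And>n. dist (completion_of (a n)) (X n) < inverse (Suc n)" by metis
  have diff0: "(\<lambda>n. completion_of (a n) - X n) \<longlonglongrightarrow> 0"
    by (rule Lim_null_comparison[OF _ LIMSEQ_inverse_real_of_nat])
      (use a in \<open>auto simp: dist_norm less_imp_le\<close>)
  have "Cauchy (\<lambda>n. (completion_of (a n) - X n) + X n)"
    by (rule Cauchy_add[OF convergent_Cauchy[OF convergentI[OF diff0]] X])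
  then have "Cauchy (\<lambda>n. completion_of (a n))" by simp
  then have "Cauchy a"
    by (simp add: Cauchy_def dist_norm completion_of_diff[symmetric])
  from tendsto_diff[OF completion_of_tendsto_abs[OF this] diff0]
  have "X \<longlonglongrightarrow> abs_completion a" by simp
  then show "convergent X" by (auto simp: convergent_def)
qed


subsection \<open>Tsirelson's space, its dual and the biorthogonal functionals\<close>

type_synonym 'k tsirelson = "'k c00 completion"

lift_definition scale_tsirelson :: "'k::real_normed_field \<Rightarrow> 'k tsirelson \<Rightarrow> 'k tsirelson"
  is "\<lambda>c x n. scale_c00 c (x n)"
proof -
  fix c :: 'k and x y :: "nat \<Rightarrow> 'k c00"
  assume *: "completion_rel x y"
  have bl: "bounded_linear (scale_c00 c)"
    by (rule bounded_linear_intro[of _ "norm c"])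
      (auto intro!: c00_eqI simp: algebra_simps norm_scale_c00)
  have "(\<lambda>n. scale_c00 c (x n - y n)) \<longlonglongrightarrow> 0"
    using bounded_linear.tendsto_zero[OF bl, of "\<lambda>n. x n - y n" sequentially] * by (simp add: completion_rel_def)
  moreover have "scale_c00 c (x n - y n) = scale_c00 c (x n) - scale_c00 c (y n)" for n
    using bl by (simp add: linear_diff bounded_linear.linear)
  ultimately show "completion_rel (\<lambda>n. scale_c00 c (x n)) (\<lambda>n. scale_c00 c (y n))"
    using * by (simp add: completion_rel_def bounded_linear.Cauchy[OF bl])
qed

text \<open>
  A normed space over \<open>'k\<close> is a type of class \<^class>\<open>real_normed_vector\<close> with its scalar
  multiplication as an explicit argument. Its dual space consists of those bounded real-linear maps
  into \<open>'k\<close> which are \<open>'k\<close>-linear; the norm of \<open>'a \<Rightarrow>\<^sub>L 'k\<close> is the dual norm.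
\<close>

definition dual_space ::
    "('k \<Rightarrow> 'a \<Rightarrow> 'a) \<Rightarrow> ('a::real_normed_vector \<Rightarrow>\<^sub>L 'k::real_normed_field) set" where
  "dual_space sc = {f. \<forall>c x. blinfun_apply f (sc c x) = c * blinfun_apply f x}"

lemma dual_space_real: "dual_space (scaleR :: real \<Rightarrow> 'a \<Rightarrow> 'a::real_normed_vector) = UNIV"
  by (auto simp: dual_space_def blinfun.scaleR_right)

text \<open>
  The original Tsirelson space is \<open>dual_space scale_tsirelson\<close>; the following are its basis vectors.
\<close>

definition tsirelson_basis :: "nat \<Rightarrow> ('k::real_normed_field tsirelson \<Rightarrow>\<^sub>L 'k)" where
  "tsirelson_basis n = (THE f. f \<in> dual_space scale_tsirelson \<and>
     (\<forall>m. blinfun_apply f (completion_of (unit_c00 m)) = (if m = n then 1 else 0)))"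

lemma coord_diff_le: "norm (coord x i - coord y i) \<le> norm (x - y)"
  using norm_coord_le[of "x - y" i] by simp

lemma bounded_linear_coord: "bounded_linear (\<lambda>x. coord x i)"
  by (rule bounded_linear_intro[of _ 1]) (auto simp: norm_coord_le)

lift_definition coord_tsirelson :: "nat \<Rightarrow> 'k::{real_normed_field,banach} tsirelson \<Rightarrow> 'k"
  is "\<lambda>i x. lim (\<lambda>n. coord (x n) i)"
proof -
  fix i and x y :: "nat \<Rightarrow> 'k c00" assume *: "completion_rel x y"
  have "(\<lambda>n. coord (x n) i - coord (y n) i) \<longlonglongrightarrow> 0"
    using bounded_linear.tendsto_zero[OF bounded_linear_coord, of "\<lambda>n. x n - y n" sequentially i] *
    by (simp add: completion_rel_def)
  moreover have "(\<lambda>n. coord (y n) i) \<longlonglongrightarrow> lim (\<lambda>n. coord (y n) i)"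
    using * Cauchy_convergent[OF bounded_linear.Cauchy[OF bounded_linear_coord]]
    by (auto simp: completion_rel_def convergent_LIMSEQ_iff)
  ultimately have "(\<lambda>n. coord (x n) i) \<longlonglongrightarrow> lim (\<lambda>n. coord (y n) i)"
    using tendsto_add by fastforce
  then show "lim (\<lambda>n. coord (x n) i) = lim (\<lambda>n. coord (y n) i)" by (rule limI)
qed

lemma coord_lim:
  fixes x :: "nat \<Rightarrow> 'k::{real_normed_field,banach} c00"
  assumes "Cauchy x" shows "(\<lambda>n. coord (x n) i) \<longlonglongrightarrow> lim (\<lambda>n. coord (x n) i)"
  using Cauchy_convergent[OF bounded_linear.Cauchy[OF bounded_linear_coord assms]]
  by (auto simp: convergent_LIMSEQ_iff)

lemma coord_tsirelson_of [simp]: "coord_tsirelson i (completion_of x) = coord x i"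
  by transfer simp

lemma coord_tsirelson_scale: "coord_tsirelson i (scale_tsirelson c z) = c * coord_tsirelson i z"
  by (transfer, unfold completion_rel_refl) (auto intro!: limI tendsto_mult_left coord_lim)

lemma bounded_linear_coord_tsirelson: "bounded_linear (coord_tsirelson i)"
proof (rule bounded_linear_intro[of _ 1])
  fix y z :: "'a tsirelson" and r :: real
  show "coord_tsirelson i (y + z) = coord_tsirelson i y + coord_tsirelson i z"
    by (transfer, unfold completion_rel_refl) (auto intro!: limI tendsto_add coord_lim)
  show "coord_tsirelson i (r *\<^sub>R z) = r *\<^sub>R coord_tsirelson i z"
    by (transfer, unfold completion_rel_refl) (auto intro!: limI tendsto_scaleR coord_lim)
  show "norm (coord_tsirelson i z) \<le> norm z * 1"
  proof (transfer, unfold completion_rel_refl)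
    fix i and x :: "nat \<Rightarrow> 'a c00" assume x: "Cauchy x"
    show "norm (lim (\<lambda>n. coord (x n) i)) \<le> lim (\<lambda>n. norm (x n)) * 1"
      using LIMSEQ_le[OF tendsto_norm[OF coord_lim[OF x]] Cauchy_norm[OF x, unfolded convergent_LIMSEQ_iff]]
      by (simp add: norm_coord_le)
  qed
qed

lemma scale_tsirelson_of: "scale_tsirelson c (completion_of x) = completion_of (scale_c00 c x)"
  by transfer (simp add: completion_rel_refl convergent_Cauchy convergent_const)

lemma dual_eval_c00:
  assumes "f \<in> dual_space scale_tsirelson" "finite S" "{i. coord x i \<noteq> 0} \<subseteq> S"
  shows "blinfun_apply f (completion_of x) =
    (\<Sum>i\<in>S. coord x i * blinfun_apply f (completion_of (unit_c00 i)))"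
proof -
  have "completion_of x = completion_of (\<Sum>i\<in>S. scale_c00 (coord x i) (unit_c00 i))"
    using c00_expand[OF assms(2,3)] by simp
  also have "\<dots> = (\<Sum>i\<in>S. scale_tsirelson (coord x i) (completion_of (unit_c00 i)))"
    by (simp add: linear_sum[OF linear_completion_of] scale_tsirelson_of)
  finally show ?thesis using assms(1) by (simp add: blinfun.sum_right dual_space_def)
qed

lemma blinfun_eq_on_dense:
  fixes f g :: "'a::real_normed_vector completion \<Rightarrow>\<^sub>L 'b::real_normed_vector"
  assumes "\<And>x. blinfun_apply f (completion_of x) = blinfun_apply g (completion_of x)"
  shows "f = g"
proof (rule blinfun_eqI)
  fix z :: "'a completion"
  obtain x where x: "(\<lambda>n. completion_of (x n)) \<longlonglongrightarrow> z" using completion_approx by blast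
  show "blinfun_apply f z = blinfun_apply g z"
    using blinfun.tendsto[OF tendsto_const x, of f] blinfun.tendsto[OF tendsto_const x, of g]
    unfolding assms by (rule LIMSEQ_unique)
qed

lemma tsirelson_basis_eq:
  "blinfun_apply (tsirelson_basis n :: 'k::{real_normed_field,banach} tsirelson \<Rightarrow>\<^sub>L 'k) = coord_tsirelson n"
proof -
  have "tsirelson_basis n = (Blinfun (coord_tsirelson n) :: 'k tsirelson \<Rightarrow>\<^sub>L 'k)"
    unfolding tsirelson_basis_def
  proof (rule the_equality)
    show *: "Blinfun (coord_tsirelson n) \<in> dual_space scale_tsirelson \<and>
      (\<forall>m. blinfun_apply (Blinfun (coord_tsirelson n) :: 'k tsirelson \<Rightarrow>\<^sub>L 'k) (completion_of (unit_c00 m)) =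
        (if m = n then 1 else 0))"
      by (simp add: dual_space_def bounded_linear_Blinfun_apply[OF bounded_linear_coord_tsirelson]
          coord_tsirelson_scale)
    fix f :: "'k tsirelson \<Rightarrow>\<^sub>L 'k"
    assume f: "f \<in> dual_space scale_tsirelson \<and>
      (\<forall>m. blinfun_apply f (completion_of (unit_c00 m)) = (if m = n then 1 else 0))"
    show "f = Blinfun (coord_tsirelson n)"
    proof (rule blinfun_eq_on_dense)
      fix x :: "'k c00"
      show "blinfun_apply f (completion_of x) = blinfun_apply (Blinfun (coord_tsirelson n)) (completion_of x)"
        unfolding dual_eval_c00[OF conjunct1[OF f] finite_support[of x] order_refl]
          dual_eval_c00[OF conjunct1[OF *] finite_support[of x] order_refl]
          conjunct2[OF f, rule_format] conjunct2[OF *, rule_format] by (rule refl)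
    qed
  qed
  then show ?thesis by (simp add: bounded_linear_Blinfun_apply[OF bounded_linear_coord_tsirelson])
qed

lemma tsirelson_basis_in_dual:
  "(tsirelson_basis n :: 'k::{real_normed_field,banach} tsirelson \<Rightarrow>\<^sub>L 'k) \<in> dual_space scale_tsirelson"
  by (simp add: dual_space_def tsirelson_basis_eq coord_tsirelson_scale)

lemma norm_coord_tsirelson_le: "norm (coord_tsirelson i z) \<le> norm z"
proof (transfer, unfold completion_rel_refl)
  fix i and x :: "nat \<Rightarrow> 'a c00" assume x: "Cauchy x"
  show "norm (lim (\<lambda>n. coord (x n) i)) \<le> lim (\<lambda>n. norm (x n))"
    using LIMSEQ_le[OF tendsto_norm[OF coord_lim[OF x]] Cauchy_norm[OF x, unfolded convergent_LIMSEQ_iff]]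
    by (simp add: norm_coord_le)
qed

lemma norm_completion_blinfun_le:
  fixes f :: "'a::real_normed_vector completion \<Rightarrow>\<^sub>L 'b::real_normed_vector"
  assumes "0 \<le> c" "\<And>x. norm (blinfun_apply f (completion_of x)) \<le> c * norm x"
  shows "norm f \<le> c"
proof (rule norm_blinfun_bound[OF assms(1)])
  fix z :: "'a completion"
  obtain x where x: "(\<lambda>n. completion_of (x n)) \<longlonglongrightarrow> z" using completion_approx by blast
  show "norm (blinfun_apply f z) \<le> c * norm z"
    by (rule LIMSEQ_le[OF tendsto_norm[OF blinfun.tendsto[OF tendsto_const x]]
          tendsto_mult_left[OF tendsto_norm[OF x]]])
      (use assms(2) in simp)
qed

lemma coord_sum: "coord (\<Sum>i\<in>S. f i) n = (\<Sum>i\<in>S. coord (f i) n)"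
  for f :: "'i \<Rightarrow> 'k::real_normed_field c00"
  by (induction S rule: infinite_finite_induct) auto

lemma norm_tsirelson_basis_sum_mono:
  assumes "finite F" "\<And>n. n \<in> F \<Longrightarrow> 0 \<le> a n" "\<And>n. n \<in> F \<Longrightarrow> a n \<le> b n"
  shows "norm (\<Sum>n\<in>F. a n *\<^sub>R (tsirelson_basis n :: 'k::{real_normed_field,banach} tsirelson \<Rightarrow>\<^sub>L 'k)) \<le>
    norm (\<Sum>n\<in>F. b n *\<^sub>R (tsirelson_basis n :: 'k tsirelson \<Rightarrow>\<^sub>L 'k))"
    (is "norm ?f \<le> norm ?g")
proof (rule norm_completion_blinfun_le)
  fix x :: "'k c00"
  let ?y = "\<Sum>n\<in>F. scale_c00 (of_real (a n / b n) * coord x n) (unit_c00 n)"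
  have y: "coord ?y i = (if i \<in> F then of_real (a i / b i) * coord x i else 0)" for i
    using assms(1) by (simp add: coord_sum if_distrib cong: if_cong)
  have "norm (coord ?y i) \<le> norm (coord x i)" for i
  proof (cases "i \<in> F")
    case True
    then have "\<bar>a i / b i\<bar> \<le> 1"
      using assms(2,3)[OF True] by (auto simp: abs_of_nonneg divide_le_eq_1)
    then have "\<bar>a i / b i\<bar> * norm (coord x i) \<le> 1 * norm (coord x i)"
      by (rule mult_right_mono) simp
    then show ?thesis using True by (simp add: y norm_mult norm_divide del: of_real_divide)
  qed (simp only: y if_False norm_zero norm_ge_zero)
  then have ny: "norm ?y \<le> norm x" by (rule norm_c00_unconditional)
  have "blinfun_apply ?f (completion_of x) = (\<Sum>n\<in>F. a n *\<^sub>R coord x n)"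
    by (simp add: blinfun.sum_left blinfun.scaleR_left tsirelson_basis_eq)
  also have "\<dots> = (\<Sum>n\<in>F. b n *\<^sub>R coord ?y n)"
  proof (rule sum.cong)
    fix n assume n: "n \<in> F"
    have "a n = b n * (a n / b n)" using assms(2,3)[OF n] by (cases "b n = 0") auto
    then have "of_real (a n) * coord x n = of_real (b n) * (of_real (a n / b n) * coord x n)"
      by (metis mult.assoc of_real_mult)
    then show "a n *\<^sub>R coord x n = b n *\<^sub>R coord ?y n" using n by (simp only: y scaleR_conv_of_real if_True)
  qed simp
  also have "\<dots> = blinfun_apply ?g (completion_of ?y)"
    by (simp add: blinfun.sum_left blinfun.scaleR_left tsirelson_basis_eq del: coord_simps)
  finally have "norm (blinfun_apply ?f (completion_of x)) \<le> norm ?g * norm ?y"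
    using norm_blinfun[of ?g "completion_of ?y"] by simp
  also have "\<dots> \<le> norm ?g * norm x" by (rule mult_left_mono[OF ny]) simp
  finally show "norm (blinfun_apply ?f (completion_of x)) \<le> norm ?g * norm x" .
qed simp

lemma le_norm_tsirelson_basis_sum:
  assumes "finite F" "n \<in> F" "0 \<le> a n"
  shows "a n \<le> norm (\<Sum>n\<in>F. a n *\<^sub>R (tsirelson_basis n :: 'k::{real_normed_field,banach} tsirelson \<Rightarrow>\<^sub>L 'k))"
    (is "_ \<le> norm ?f")
proof -
  have "tsirelson_limit (unit_c00 n :: 'k c00) \<le> 1"
    unfolding tsirelson_limit_def
  proof (rule cSUP_least)
    fix m
    have "tsirelson_iter m (unit_c00 n :: 'k c00) \<le>
        (\<Sum>i | coord (unit_c00 n :: 'k c00) i \<noteq> 0. norm (coord (unit_c00 n :: 'k c00) i))"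
      by (rule tsirelson_iter_le)
    also have "{i. coord (unit_c00 n :: 'k c00) i \<noteq> 0} = {n}" by auto
    finally show "tsirelson_iter m (unit_c00 n :: 'k c00) \<le> 1" by simp
  qed simp
  then have 1: "norm (unit_c00 n :: 'k c00) \<le> 1" by (simp add: norm_c00_def tsirelson_norm_eq_limit)
  have "blinfun_apply ?f (completion_of (unit_c00 n)) = (\<Sum>m\<in>F. if m = n then of_real (a n) else 0)"
    by (simp add: blinfun.sum_left blinfun.scaleR_left tsirelson_basis_eq scaleR_conv_of_real
        if_distrib cong: if_cong)
  also have "\<dots> = of_real (a n)" using assms by simp
  finally have "a n = norm (blinfun_apply ?f (completion_of (unit_c00 n)))" using assms by simp
  also have "\<dots> \<le> norm ?f * norm (unit_c00 n :: 'k c00)"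
    using norm_blinfun[of ?f "completion_of (unit_c00 n)"] by simp
  also have "\<dots> \<le> norm ?f * 1" by (rule mult_left_mono[OF 1]) simp
  finally show ?thesis by simp
qed


section \<open>The direct sum\<close>

subsection \<open>The space of null sequences\<close>

text \<open>
  The topology of \<^typ>\<open>nat\<close> is discrete, so \<open>nat \<Rightarrow>\<^sub>C 'k\<close> consists of all bounded sequences,
  with the supremum norm.
\<close>

typedef (overloaded) 'k c0 = "{f :: nat \<Rightarrow>\<^sub>C 'k::real_normed_vector. apply_bcontfun f \<longlonglongrightarrow> 0}"
  by (rule exI[of _ 0]) simp

setup_lifting type_definition_c0

instantiation c0 :: (real_normed_vector) real_vector
begin

lift_definition zero_c0 :: "'a c0" is 0 by simp
lift_definition plus_c0 :: "'a c0 \<Rightarrow> 'a c0 \<Rightarrow> 'a c0" is "(+)" using tendsto_add by force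
lift_definition uminus_c0 :: "'a c0 \<Rightarrow> 'a c0" is uminus using tendsto_minus by force
lift_definition minus_c0 :: "'a c0 \<Rightarrow> 'a c0 \<Rightarrow> 'a c0" is "(-)" using tendsto_diff by force
lift_definition scaleR_c0 :: "real \<Rightarrow> 'a c0 \<Rightarrow> 'a c0" is scaleR
  using tendsto_scaleR[OF tendsto_const] by force

instance
  by standard (transfer; simp add: algebra_simps)+

end

instantiation c0 :: (real_normed_vector) real_normed_vector
begin

lift_definition norm_c0 :: "'a c0 \<Rightarrow> real" is norm .
definition dist_c0 :: "'a c0 \<Rightarrow> 'a c0 \<Rightarrow> real" where "dist_c0 x y = norm (x - y)"
definition sgn_c0 :: "'a c0 \<Rightarrow> 'a c0" where "sgn_c0 x = x /\<^sub>R norm x"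
definition uniformity_c0 :: "('a c0 \<times> 'a c0) filter"
  where "uniformity_c0 = (INF e\<in>{0<..}. principal {(x, y). dist x y < e})"
definition open_c0 :: "'a c0 set \<Rightarrow> bool"
  where "open_c0 U \<longleftrightarrow> (\<forall>x\<in>U. eventually (\<lambda>(x', y). x' = x \<longrightarrow> y \<in> U) uniformity)"

instance
proof
  fix x y :: "'a c0" and r :: real
  show "norm x = 0 \<longleftrightarrow> x = 0" by transfer simp
  show "norm (x + y) \<le> norm x + norm y" by transfer (rule norm_triangle_ineq)
  show "norm (r *\<^sub>R x) = \<bar>r\<bar> * norm x" by transfer simp
qed (simp_all add: dist_c0_def sgn_c0_def uniformity_c0_def open_c0_def)

end

lemma dist_Rep_c0: "dist (Rep_c0 x) (Rep_c0 y) = dist x y"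
  by (simp add: dist_c0_def norm_c0.rep_eq minus_c0.rep_eq dist_norm)

instance c0 :: (banach) banach
proof
  fix X :: "nat \<Rightarrow> 'a c0" assume "Cauchy X"
  then have "\<exists>l. uniform_limit UNIV (\<lambda>n. apply_bcontfun (Rep_c0 (X n))) l sequentially"
    using uniformly_convergent_eq_cauchy[of "\<lambda>_. True" "\<lambda>n. apply_bcontfun (Rep_c0 (X n))"]
    unfolding Cauchy_def uniform_limit_sequentially_iff dist_Rep_c0[symmetric]
    by (metis dist_fun_lt_imp_dist_val_lt)
  then obtain f where f: "(\<lambda>n. Rep_c0 (X n)) \<longlonglongrightarrow> f"
    using uniform_limit_bcontfunE[OF _ sequentially_bot] by metis
  have "apply_bcontfun f \<longlonglongrightarrow> 0"
  proof (rule swap_uniform_limit'[where f = "\<lambda>n. apply_bcontfun (Rep_c0 (X n))" and g = "\<lambda>_. 0" and F = sequentially])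
    show "\<forall>\<^sub>F n in sequentially. (apply_bcontfun (Rep_c0 (X n)) \<longlongrightarrow> 0) sequentially"
      using Rep_c0 by (intro always_eventually allI) blast
    show "uniform_limit UNIV (\<lambda>n. apply_bcontfun (Rep_c0 (X n))) (apply_bcontfun f) sequentially"
      using tendsto_bcontfun_uniform_limit[OF f] .
  qed auto
  then have "Rep_c0 (Abs_c0 f) = f" by (simp add: Abs_c0_inverse)
  then have "X \<longlonglongrightarrow> Abs_c0 f"
    using f by (simp add: lim_sequentially dist_Rep_c0[symmetric])
  then show "convergent X" by (auto simp: convergent_def)
qed

lift_definition scale_c0 :: "'k::real_normed_field \<Rightarrow> 'k c0 \<Rightarrow> 'k c0"
  is "\<lambda>c f. Bcontfun (\<lambda>i. c * apply_bcontfun f i)"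
proof -
  fix c :: 'k and f :: "nat \<Rightarrow>\<^sub>C 'k" assume f: "f \<longlonglongrightarrow> 0"
  have "(\<lambda>i. c * apply_bcontfun f i) \<in> bcontfun"
    by (rule bcontfun_normI[where b = "norm c * norm f"])
      (auto simp: norm_mult norm_bounded mult_left_mono)
  then show "apply_bcontfun (Bcontfun (\<lambda>i. c * apply_bcontfun f i)) \<longlonglongrightarrow> 0"
    using tendsto_mult_left[OF f, of c] by (simp add: Bcontfun_inverse)
qed

lemma Rep_scale_c0: "apply_bcontfun (Rep_c0 (scale_c0 c x)) i = c * apply_bcontfun (Rep_c0 x) i"
proof -
  have "(\<lambda>i. c * apply_bcontfun (Rep_c0 x) i) \<in> bcontfun"
    by (rule bcontfun_normI[where b = "norm c * norm (Rep_c0 x)"])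
      (auto simp: norm_mult norm_bounded mult_left_mono)
  then show ?thesis by (simp add: scale_c0.rep_eq Bcontfun_inverse)
qed

lemma norm_scale_c0: "norm (scale_c0 c x) = norm c * norm x"
proof -
  have le: "norm (scale_c0 c x) \<le> norm c * norm x" for c x
    unfolding norm_c0.rep_eq
    by (rule norm_bound) (auto simp: Rep_scale_c0 norm_mult norm_bounded mult_left_mono)
  show ?thesis
  proof (cases "c = 0")
    case True
    then show ?thesis using le[of c x] by simp
  next
    case False
    have "scale_c0 (inverse c) (scale_c0 c x) = x"
      using False by (intro Rep_c0_inject[THEN iffD1] bcontfun_eqI) (simp add: Rep_scale_c0)
    then have "norm x \<le> norm (inverse c) * norm (scale_c0 c x)" using le by metis
    then have "norm c * norm x \<le> norm (scale_c0 c x)"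
      using False by (simp add: norm_inverse norm_divide divide_simps mult.commute)
    with le[of c x] show ?thesis by simp
  qed
qed


subsection \<open>The Tsirelson direct sum of copies of the space of null sequences\<close>

definition tsirelson_series :: "(nat \<Rightarrow> real) \<Rightarrow> nat \<Rightarrow> ('k::{real_normed_field,banach} tsirelson \<Rightarrow>\<^sub>L 'k)" where
  "tsirelson_series a n = a n *\<^sub>R tsirelson_basis n"

lemma summable_tsirelson_mono:
  assumes b: "summable (tsirelson_series b :: nat \<Rightarrow> ('k::{real_normed_field,banach} tsirelson \<Rightarrow>\<^sub>L 'k))"
    and ab: "\<And>n. 0 \<le> a n" "\<And>n. a n \<le> b n"
  shows "summable (tsirelson_series a :: nat \<Rightarrow> ('k tsirelson \<Rightarrow>\<^sub>L 'k))"
    and "norm (suminf (tsirelson_series a :: nat \<Rightarrow> ('k tsirelson \<Rightarrow>\<^sub>L 'k))) \<le>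
      norm (suminf (tsirelson_series b :: nat \<Rightarrow> ('k tsirelson \<Rightarrow>\<^sub>L 'k)))"
proof -
  have le: "norm (sum (tsirelson_series a :: nat \<Rightarrow> ('k tsirelson \<Rightarrow>\<^sub>L 'k)) F) \<le>
    norm (sum (tsirelson_series b :: nat \<Rightarrow> ('k tsirelson \<Rightarrow>\<^sub>L 'k)) F)" if "finite F" for F
    unfolding tsirelson_series_def using norm_tsirelson_basis_sum_mono[OF that, of a b] ab by blast
  show a: "summable (tsirelson_series a :: nat \<Rightarrow> ('k tsirelson \<Rightarrow>\<^sub>L 'k))"
    unfolding summable_Cauchy
  proof (intro allI impI)
    fix e :: real assume "0 < e"
    then obtain N where "\<forall>m\<ge>N. \<forall>n. norm (sum (tsirelson_series b :: nat \<Rightarrow> ('k tsirelson \<Rightarrow>\<^sub>L 'k)) {m..<n}) < e"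
      using b unfolding summable_Cauchy by blast
    then show "\<exists>N. \<forall>m\<ge>N. \<forall>n. norm (sum (tsirelson_series a :: nat \<Rightarrow> ('k tsirelson \<Rightarrow>\<^sub>L 'k)) {m..<n}) < e"
      using le[OF finite_atLeastLessThan] by (meson le_less_trans)
  qed
  show "norm (suminf (tsirelson_series a :: nat \<Rightarrow> ('k tsirelson \<Rightarrow>\<^sub>L 'k))) \<le>
      norm (suminf (tsirelson_series b :: nat \<Rightarrow> ('k tsirelson \<Rightarrow>\<^sub>L 'k)))"
    by (rule LIMSEQ_le[OF tendsto_norm[OF summable_LIMSEQ[OF a]] tendsto_norm[OF summable_LIMSEQ[OF b]]])
      (use le in blast)
qed

lemma tsirelson_series_add: "tsirelson_series (\<lambda>n. a n + b n) = (\<lambda>n. tsirelson_series a n + tsirelson_series b n)"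
  and tsirelson_series_mult: "tsirelson_series (\<lambda>n. r * a n) = (\<lambda>n. r *\<^sub>R tsirelson_series a n)"
  by (auto simp: tsirelson_series_def scaleR_left_distrib)

text \<open>
  The dual space of \<open>'k tsirelson\<close> is norm closed in \<open>'k tsirelson \<Rightarrow>\<^sub>L 'k\<close> and contains the basis
  vectors, so convergence in the original Tsirelson space is convergence in that type.
\<close>

typedef (overloaded) 'k tsirelson_sum_c0 =
  "{x :: nat \<Rightarrow> 'k::{real_normed_field,banach} c0.
      summable (\<lambda>n. norm (x n) *\<^sub>R (tsirelson_basis n :: 'k tsirelson \<Rightarrow>\<^sub>L 'k))}"
  by (rule exI[of _ "\<lambda>_. 0"]) simp

setup_lifting type_definition_tsirelson_sum_c0

lemma summable_tsirelson_series_norm: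
  fixes x :: "nat \<Rightarrow> 'k::{real_normed_field,banach} c0"
  shows "summable (\<lambda>n. norm (x n) *\<^sub>R (tsirelson_basis n :: 'k tsirelson \<Rightarrow>\<^sub>L 'k)) \<longleftrightarrow>
    summable (tsirelson_series (\<lambda>n. norm (x n)) :: nat \<Rightarrow> ('k tsirelson \<Rightarrow>\<^sub>L 'k))"
  by (simp add: tsirelson_series_def[abs_def])

lemma summable_tsirelson_plus:
  fixes x y :: "nat \<Rightarrow> 'k::{real_normed_field,banach} c0"
  assumes "summable (\<lambda>n. norm (x n) *\<^sub>R (tsirelson_basis n :: 'k tsirelson \<Rightarrow>\<^sub>L 'k))"
    and "summable (\<lambda>n. norm (y n) *\<^sub>R (tsirelson_basis n :: 'k tsirelson \<Rightarrow>\<^sub>L 'k))"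
    and le: "\<And>n. norm (z n) \<le> norm (x n) + norm (y n)"
  shows "summable (\<lambda>n. norm (z n) *\<^sub>R (tsirelson_basis n :: 'k tsirelson \<Rightarrow>\<^sub>L 'k))"
    and "norm (\<Sum>n. norm (z n) *\<^sub>R (tsirelson_basis n :: 'k tsirelson \<Rightarrow>\<^sub>L 'k)) \<le>
      norm (\<Sum>n. norm (x n) *\<^sub>R (tsirelson_basis n :: 'k tsirelson \<Rightarrow>\<^sub>L 'k)) +
      norm (\<Sum>n. norm (y n) *\<^sub>R (tsirelson_basis n :: 'k tsirelson \<Rightarrow>\<^sub>L 'k))"
proof -
  note S = assms(1,2)[unfolded summable_tsirelson_series_norm]
  have *: "summable (tsirelson_series (\<lambda>n. norm (x n) + norm (y n)) :: nat \<Rightarrow> ('k tsirelson \<Rightarrow>\<^sub>L 'k))"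
    unfolding tsirelson_series_add by (rule summable_add[OF S])
  show "summable (\<lambda>n. norm (z n) *\<^sub>R (tsirelson_basis n :: 'k tsirelson \<Rightarrow>\<^sub>L 'k))"
    using summable_tsirelson_mono(1)[OF *, of "\<lambda>n. norm (z n)"] le
    by (simp add: tsirelson_series_def[abs_def])
  have "norm (suminf (tsirelson_series (\<lambda>n. norm (z n)) :: nat \<Rightarrow> ('k tsirelson \<Rightarrow>\<^sub>L 'k))) \<le>
      norm (suminf (tsirelson_series (\<lambda>n. norm (x n) + norm (y n)) :: nat \<Rightarrow> ('k tsirelson \<Rightarrow>\<^sub>L 'k)))"
    by (rule summable_tsirelson_mono(2)[OF *]) (use le in auto)
  also have "\<dots> = norm (suminf (tsirelson_series (\<lambda>n. norm (x n)) :: nat \<Rightarrow> ('k tsirelson \<Rightarrow>\<^sub>L 'k)) +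
      suminf (tsirelson_series (\<lambda>n. norm (y n)) :: nat \<Rightarrow> ('k tsirelson \<Rightarrow>\<^sub>L 'k)))"
    unfolding tsirelson_series_add by (simp add: suminf_add[OF S])
  also have "\<dots> \<le> norm (suminf (tsirelson_series (\<lambda>n. norm (x n)) :: nat \<Rightarrow> ('k tsirelson \<Rightarrow>\<^sub>L 'k))) +
      norm (suminf (tsirelson_series (\<lambda>n. norm (y n)) :: nat \<Rightarrow> ('k tsirelson \<Rightarrow>\<^sub>L 'k)))"
    by (rule norm_triangle_ineq)
  finally show "norm (\<Sum>n. norm (z n) *\<^sub>R (tsirelson_basis n :: 'k tsirelson \<Rightarrow>\<^sub>L 'k)) \<le>
      norm (\<Sum>n. norm (x n) *\<^sub>R (tsirelson_basis n :: 'k tsirelson \<Rightarrow>\<^sub>L 'k)) +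
      norm (\<Sum>n. norm (y n) *\<^sub>R (tsirelson_basis n :: 'k tsirelson \<Rightarrow>\<^sub>L 'k))"
    by (simp add: tsirelson_series_def[abs_def])
qed

lemma tsirelson_norm_ge_coordinate:
  fixes x :: "nat \<Rightarrow> 'k::{real_normed_field,banach} c0"
  assumes "summable (\<lambda>n. norm (x n) *\<^sub>R (tsirelson_basis n :: 'k tsirelson \<Rightarrow>\<^sub>L 'k))"
  shows "norm (x i) \<le> norm (\<Sum>n. norm (x n) *\<^sub>R (tsirelson_basis n :: 'k tsirelson \<Rightarrow>\<^sub>L 'k))"
proof (rule LIMSEQ_le_const[OF tendsto_norm[OF summable_LIMSEQ[OF assms]]])
  show "\<exists>N. \<forall>m\<ge>N. norm (x i) \<le>
      norm (\<Sum>n<m. norm (x n) *\<^sub>R (tsirelson_basis n :: 'k tsirelson \<Rightarrow>\<^sub>L 'k))"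
    by (intro exI[of _ "Suc i"] allI impI le_norm_tsirelson_basis_sum) auto
qed

instantiation tsirelson_sum_c0 :: ("{real_normed_field,banach}") real_vector
begin

lift_definition zero_tsirelson_sum_c0 :: "'a tsirelson_sum_c0" is "\<lambda>_. 0" by simp

lift_definition plus_tsirelson_sum_c0 ::
    "'a tsirelson_sum_c0 \<Rightarrow> 'a tsirelson_sum_c0 \<Rightarrow> 'a tsirelson_sum_c0"
  is "\<lambda>x y n. x n + y n"
  by (erule (1) summable_tsirelson_plus(1)) (rule norm_triangle_ineq)

lift_definition uminus_tsirelson_sum_c0 :: "'a tsirelson_sum_c0 \<Rightarrow> 'a tsirelson_sum_c0"
  is "\<lambda>x n. - x n" by simp

lift_definition minus_tsirelson_sum_c0 ::
    "'a tsirelson_sum_c0 \<Rightarrow> 'a tsirelson_sum_c0 \<Rightarrow> 'a tsirelson_sum_c0"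
  is "\<lambda>x y n. x n - y n"
  by (erule (1) summable_tsirelson_plus(1)) (rule norm_triangle_ineq4)

lift_definition scaleR_tsirelson_sum_c0 :: "real \<Rightarrow> 'a tsirelson_sum_c0 \<Rightarrow> 'a tsirelson_sum_c0"
  is "\<lambda>r x n. r *\<^sub>R x n"
  by (simp add: scaleR_scaleR[symmetric] summable_scaleR_right del: scaleR_scaleR)

instance
  by standard (transfer; simp add: algebra_simps)+

end

instantiation tsirelson_sum_c0 :: ("{real_normed_field,banach}") real_normed_vector
begin

lift_definition norm_tsirelson_sum_c0 :: "'a tsirelson_sum_c0 \<Rightarrow> real"
  is "\<lambda>x. norm (\<Sum>n. norm (x n) *\<^sub>R (tsirelson_basis n :: 'a tsirelson \<Rightarrow>\<^sub>L 'a))" .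

definition dist_tsirelson_sum_c0 :: "'a tsirelson_sum_c0 \<Rightarrow> 'a tsirelson_sum_c0 \<Rightarrow> real"
  where "dist_tsirelson_sum_c0 x y = norm (x - y)"
definition sgn_tsirelson_sum_c0 :: "'a tsirelson_sum_c0 \<Rightarrow> 'a tsirelson_sum_c0"
  where "sgn_tsirelson_sum_c0 x = x /\<^sub>R norm x"
definition uniformity_tsirelson_sum_c0 :: "('a tsirelson_sum_c0 \<times> 'a tsirelson_sum_c0) filter"
  where "uniformity_tsirelson_sum_c0 = (INF e\<in>{0<..}. principal {(x, y). dist x y < e})"
definition open_tsirelson_sum_c0 :: "'a tsirelson_sum_c0 set \<Rightarrow> bool"
  where "open_tsirelson_sum_c0 U \<longleftrightarrow>
    (\<forall>x\<in>U. eventually (\<lambda>(x', y). x' = x \<longrightarrow> y \<in> U) uniformity)"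

instance
proof
  fix x y :: "'a tsirelson_sum_c0" and r :: real
  show "norm x = 0 \<longleftrightarrow> x = 0"
    by transfer (use tsirelson_norm_ge_coordinate in fastforce)
  show "norm (x + y) \<le> norm x + norm y"
    by transfer (erule (1) summable_tsirelson_plus(2), rule norm_triangle_ineq)
  show "norm (r *\<^sub>R x) = \<bar>r\<bar> * norm x"
    by transfer (simp add: scaleR_scaleR[symmetric] suminf_scaleR_right[symmetric] del: scaleR_scaleR)
qed (simp_all add: dist_tsirelson_sum_c0_def sgn_tsirelson_sum_c0_def
    uniformity_tsirelson_sum_c0_def open_tsirelson_sum_c0_def)

end

lemma norm_sum_le_suminf_tsirelson:
  fixes x :: "nat \<Rightarrow> 'k::{real_normed_field,banach} c0"
  assumes "summable (\<lambda>n. norm (x n) *\<^sub>R (tsirelson_basis n :: 'k tsirelson \<Rightarrow>\<^sub>L 'k))" "finite F"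
  shows "norm (\<Sum>n\<in>F. norm (x n) *\<^sub>R (tsirelson_basis n :: 'k tsirelson \<Rightarrow>\<^sub>L 'k)) \<le>
    norm (\<Sum>n. norm (x n) *\<^sub>R (tsirelson_basis n :: 'k tsirelson \<Rightarrow>\<^sub>L 'k))"
proof (rule LIMSEQ_le_const[OF tendsto_norm[OF summable_LIMSEQ[OF assms(1)]]], intro exI allI impI)
  fix m assume m: "Suc (Max (insert 0 F)) \<le> m"
  have F: "F \<subseteq> {..<m}"
  proof
    fix n assume "n \<in> F"
    then have "n \<le> Max (insert 0 F)" using assms(2) by (intro Max_ge) auto
    with m show "n \<in> {..<m}" by simp
  qed
  have "(\<Sum>n\<in>F. norm (x n) *\<^sub>R (tsirelson_basis n :: 'k tsirelson \<Rightarrow>\<^sub>L 'k)) =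
      (\<Sum>n<m. (if n \<in> F then norm (x n) else 0) *\<^sub>R tsirelson_basis n)"
    using F by (intro sum.mono_neutral_cong_left) auto
  also have "norm \<dots> \<le> norm (\<Sum>n<m. norm (x n) *\<^sub>R (tsirelson_basis n :: 'k tsirelson \<Rightarrow>\<^sub>L 'k))"
    by (rule norm_tsirelson_basis_sum_mono) auto
  finally show "norm (\<Sum>n\<in>F. norm (x n) *\<^sub>R (tsirelson_basis n :: 'k tsirelson \<Rightarrow>\<^sub>L 'k)) \<le>
      norm (\<Sum>n<m. norm (x n) *\<^sub>R (tsirelson_basis n :: 'k tsirelson \<Rightarrow>\<^sub>L 'k))" .
qed

instance tsirelson_sum_c0 :: ("{real_normed_field,banach}") banach
proof
  fix X :: "nat \<Rightarrow> 'a tsirelson_sum_c0" assume X: "Cauchy X"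
  let ?e = "tsirelson_basis :: nat \<Rightarrow> 'a tsirelson \<Rightarrow>\<^sub>L 'a"
  define x where "x m = Rep_tsirelson_sum_c0 (X m)" for m
  have sx: "summable (\<lambda>n. norm (x m n) *\<^sub>R ?e n)" for m
    using Rep_tsirelson_sum_c0[of "X m"] by (simp add: x_def)
  have sxx: "summable (\<lambda>n. norm (x l n - x m n) *\<^sub>R ?e n)" for l m
    by (rule summable_tsirelson_plus(1)[OF sx sx]) (rule norm_triangle_ineq4)
  have nX: "norm (X l - X m) = norm (\<Sum>n. norm (x l n - x m n) *\<^sub>R ?e n)" for l m
    by (simp add: norm_tsirelson_sum_c0.rep_eq minus_tsirelson_sum_c0.rep_eq x_def)
  have "convergent (\<lambda>m. x m n)" for n
  proof (rule Cauchy_convergent, rule CauchyI)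
    fix e :: real assume "0 < e"
    then obtain M where "\<forall>l\<ge>M. \<forall>m\<ge>M. norm (X l - X m) < e" using CauchyD[OF X] by blast
    moreover have "norm (x l n - x m n) \<le> norm (X l - X m)" for l m
      unfolding nX by (rule tsirelson_norm_ge_coordinate[OF sxx])
    ultimately show "\<exists>M. \<forall>l\<ge>M. \<forall>m\<ge>M. norm (x l n - x m n) < e" by (meson le_less_trans)
  qed
  then obtain y where y: "\<And>n. (\<lambda>m. x m n) \<longlonglongrightarrow> y n" unfolding convergent_def by metis
  have close: "\<exists>M. \<forall>m\<ge>M. \<forall>F. finite F \<longrightarrow> norm (\<Sum>n\<in>F. norm (y n - x m n) *\<^sub>R ?e n) \<le> e"
    if "0 < e" for e
  proof -
    obtain M where M: "\<forall>l\<ge>M. \<forall>m\<ge>M. norm (X l - X m) < e" using CauchyD[OF X \<open>0 < e\<close>] by blast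
    have "norm (\<Sum>n\<in>F. norm (y n - x m n) *\<^sub>R ?e n) \<le> e" if "m \<ge> M" "finite F" for m F
    proof (rule LIMSEQ_le_const2)
      show "(\<lambda>l. norm (\<Sum>n\<in>F. norm (x l n - x m n) *\<^sub>R ?e n)) \<longlonglongrightarrow>
          norm (\<Sum>n\<in>F. norm (y n - x m n) *\<^sub>R ?e n)"
        by (intro tendsto_norm tendsto_sum tendsto_scaleR tendsto_const tendsto_diff y)
      show "\<exists>N. \<forall>l\<ge>N. norm (\<Sum>n\<in>F. norm (x l n - x m n) *\<^sub>R ?e n) \<le> e"
        using M that(1) norm_sum_le_suminf_tsirelson[OF sxx that(2), of _ m, folded nX]
        by (meson less_imp_le order_trans)
    qed
    then show ?thesis by blast
  qed
  have sd: "summable (\<lambda>n. norm (y n - x m n) *\<^sub>R ?e n)" for m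
    unfolding summable_Cauchy
  proof (intro allI impI)
    fix e :: real assume "0 < e"
    obtain l where l: "\<And>F. finite F \<Longrightarrow> norm (\<Sum>n\<in>F. norm (y n - x l n) *\<^sub>R ?e n) \<le> e/2"
      using close[of "e/2"] \<open>0 < e\<close> by auto
    obtain N where N: "\<And>p q. p \<ge> N \<Longrightarrow> norm (\<Sum>n=p..<q. norm (x l n - x m n) *\<^sub>R ?e n) < e/2"
      using sxx[of l m] \<open>0 < e\<close> unfolding summable_Cauchy by (meson half_gt_zero)
    have "norm (\<Sum>n=p..<q. norm (y n - x m n) *\<^sub>R ?e n) < e" if "p \<ge> N" for p q
    proof -
      have "norm (\<Sum>n=p..<q. norm (y n - x m n) *\<^sub>R ?e n) \<le>
          norm (\<Sum>n=p..<q. (norm (y n - x l n) + norm (x l n - x m n)) *\<^sub>R ?e n)"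
        by (rule norm_tsirelson_basis_sum_mono)
          (auto intro: norm_triangle_le[of "y n - x l n" "x l n - x m n" for n, simplified])
      also have "\<dots> \<le> norm (\<Sum>n=p..<q. norm (y n - x l n) *\<^sub>R ?e n) +
          norm (\<Sum>n=p..<q. norm (x l n - x m n) *\<^sub>R ?e n)"
        unfolding scaleR_left_distrib sum.distrib by (rule norm_triangle_ineq)
      also have "\<dots> < e" using l[of "{p..<q}"] N[OF that, of q] by simp
      finally show ?thesis .
    qed
    then show "\<exists>N. \<forall>p\<ge>N. \<forall>q. norm (\<Sum>n=p..<q. norm (y n - x m n) *\<^sub>R ?e n) < e" by blast
  qed
  have "summable (\<lambda>n. norm (y n) *\<^sub>R ?e n)"
    by (rule summable_tsirelson_plus(1)[OF sd[of 0] sx[of 0]])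
      (rule order_trans[OF _ norm_triangle_ineq], simp)
  then have Y: "Rep_tsirelson_sum_c0 (Abs_tsirelson_sum_c0 y) = y"
    by (simp add: Abs_tsirelson_sum_c0_inverse)
  have "X \<longlonglongrightarrow> Abs_tsirelson_sum_c0 y"
  proof (rule metric_LIMSEQ_I)
    fix e :: real assume "0 < e"
    then obtain M where M: "\<And>m F. m \<ge> M \<Longrightarrow> finite F \<Longrightarrow> norm (\<Sum>n\<in>F. norm (y n - x m n) *\<^sub>R ?e n) \<le> e/2"
      using close[of "e/2"] by auto
    have "dist (X m) (Abs_tsirelson_sum_c0 y) < e" if "m \<ge> M" for m
    proof -
      have "dist (X m) (Abs_tsirelson_sum_c0 y) = norm (Abs_tsirelson_sum_c0 y - X m)"
        by (simp add: dist_norm norm_minus_commute)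
      also have "\<dots> = norm (\<Sum>n. norm (y n - x m n) *\<^sub>R ?e n)"
        by (simp add: norm_tsirelson_sum_c0.rep_eq minus_tsirelson_sum_c0.rep_eq x_def Y)
      also have "\<dots> \<le> e/2"
        by (rule LIMSEQ_le_const2[OF tendsto_norm[OF summable_LIMSEQ[OF sd]]])
          (use M[OF that] in auto)
      finally show ?thesis using \<open>0 < e\<close> by simp
    qed
    then show "\<exists>M. \<forall>m\<ge>M. dist (X m) (Abs_tsirelson_sum_c0 y) < e" by blast
  qed
  then show "convergent X" by (auto simp: convergent_def)
qed

lift_definition scale_tsirelson_sum_c0 ::
    "'k::{real_normed_field,banach} \<Rightarrow> 'k tsirelson_sum_c0 \<Rightarrow> 'k tsirelson_sum_c0"
  is "\<lambda>c x n. scale_c0 c (x n)"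
  by (simp add: norm_scale_c0 scaleR_scaleR[symmetric] summable_scaleR_right del: scaleR_scaleR)

lemma scale_tsirelson_sum_c0_of_real: "scale_tsirelson_sum_c0 (of_real r) x = r *\<^sub>R x"
proof -
  have "scale_c0 (of_real r) y = r *\<^sub>R y" for y :: "'a c0"
    by (intro Rep_c0_inject[THEN iffD1] bcontfun_eqI)
      (simp add: Rep_scale_c0 scaleR_c0.rep_eq scaleR_conv_of_real)
  then show ?thesis by transfer simp
qed

lemma norm_scale_tsirelson_sum_c0: "norm (scale_tsirelson_sum_c0 c x) = norm c * norm x"
  by transfer (simp add: norm_scale_c0 scaleR_scaleR[symmetric] suminf_scaleR_right[symmetric]
    del: scaleR_scaleR)


section \<open>The Szlenk index\<close>

text \<open>
  \<^const>\<open>strong_operator_topology\<close> is the topology of pointwise convergence, which on the dual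
  space is the weak* topology. The sets \<open>K\<close> below are subsets of the dual ball; the library's
  \<^const>\<open>diameter\<close> is the norm diameter for bounded sets.
\<close>

definition weak_star_topology ::
    "('k \<Rightarrow> 'a \<Rightarrow> 'a) \<Rightarrow> ('a::banach \<Rightarrow>\<^sub>L 'k::real_normed_field) topology" where
  "weak_star_topology sc = subtopology strong_operator_topology (dual_space sc)"

definition dual_ball :: "('k \<Rightarrow> 'a \<Rightarrow> 'a) \<Rightarrow> ('a::banach \<Rightarrow>\<^sub>L 'k::real_normed_field) set" where
  "dual_ball sc = {f \<in> dual_space sc. norm f \<le> 1}"

definition szlenk_derivation ::
    "('k \<Rightarrow> 'a \<Rightarrow> 'a) \<Rightarrow> real \<Rightarrow> ('a::banach \<Rightarrow>\<^sub>L 'k::real_normed_field) set \<Rightarrow> ('a \<Rightarrow>\<^sub>L 'k) set" where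
  "szlenk_derivation sc \<epsilon> K =
     {f \<in> K. \<forall>U. openin (weak_star_topology sc) U \<and> f \<in> U \<longrightarrow> diameter (K \<inter> U) > \<epsilon>}"

text \<open>
  The ordinals up to \<open>\<omega>\<close> are represented by \<^typ>\<open>enat\<close>, with \<open>\<infinity>\<close> for \<open>\<omega>\<close>. The power type only
  concerns spaces whose Szlenk index is at most \<open>\<omega>\<close>, so no longer iterates are needed.
\<close>

definition szlenk_iterate ::
    "('k \<Rightarrow> 'a \<Rightarrow> 'a) \<Rightarrow> real \<Rightarrow> enat \<Rightarrow> ('a::banach \<Rightarrow>\<^sub>L 'k::real_normed_field) set \<Rightarrow> ('a \<Rightarrow>\<^sub>L 'k) set" where
  "szlenk_iterate sc \<epsilon> \<alpha> K =
     (case \<alpha> of enat n \<Rightarrow> (szlenk_derivation sc \<epsilon> ^^ n) K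
      | \<infinity> \<Rightarrow> (\<Inter>n. (szlenk_derivation sc \<epsilon> ^^ n) K))"

definition szlenk_le_omega :: "('k::real_normed_field \<Rightarrow> 'a \<Rightarrow> 'a::banach) \<Rightarrow> bool" where
  "szlenk_le_omega sc \<longleftrightarrow> (\<forall>\<epsilon>>0. \<exists>\<alpha>. szlenk_iterate sc \<epsilon> \<alpha> (dual_ball sc) = {})"

text \<open>The following is \<open>Sz(X,\<epsilon>)\<close> provided this is at most \<open>\<omega>\<close>.\<close>

definition szlenk_index_at :: "('k::real_normed_field \<Rightarrow> 'a \<Rightarrow> 'a::banach) \<Rightarrow> real \<Rightarrow> enat" where
  "szlenk_index_at sc \<epsilon> = (LEAST \<alpha>. szlenk_iterate sc \<epsilon> \<alpha> (dual_ball sc) = {})"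

definition szlenk_power_type :: "('k::real_normed_field \<Rightarrow> 'a \<Rightarrow> 'a::banach) \<Rightarrow> ereal" where
  "szlenk_power_type sc = Inf {ereal q | q. q \<ge> 1 \<and>
     (SUP \<epsilon>\<in>{0<..<1}. ereal (\<epsilon> powr q) * ereal_of_enat (szlenk_index_at sc \<epsilon>)) < \<infinity>}"

definition has_szlenk_power_type :: "('k::real_normed_field \<Rightarrow> 'a \<Rightarrow> 'a::banach) \<Rightarrow> real \<Rightarrow> bool" where
  "has_szlenk_power_type sc p \<longleftrightarrow> szlenk_le_omega sc \<and> szlenk_power_type sc = ereal p"

definition summable_szlenk_index :: "('k::real_normed_field \<Rightarrow> 'a \<Rightarrow> 'a::banach) \<Rightarrow> bool" where
  "summable_szlenk_index sc \<longleftrightarrow> (\<exists>M. \<forall>\<epsilon>s. (\<forall>\<epsilon>\<in>set \<epsilon>s. 0 < \<epsilon>) \<longrightarrow>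
     foldr (szlenk_derivation sc) \<epsilon>s (dual_ball sc) \<noteq> {} \<longrightarrow> sum_list \<epsilon>s \<le> M)"

end

theory Submission
  imports Defs
begin

text \<open>
  The dual of the direct sum of copies of \<open>c\<^sub>0\<close> is the \<open>T\<close>-direct sum of copies of \<open>\<ell>\<^sub>1\<close>. Weak* null
  perturbations of a functional are asymptotically disjoint from it in each copy of \<open>\<ell>\<^sub>1\<close>, where norms
  of disjoint vectors add up. Hence a functional in the \<open>n\<close>-th derived set yields nonnegative vectors
  \<open>a\<^sub>1, \<dots>, a\<^sub>n\<close> of \<open>T\<close> with \<open>\<parallel>a\<^sub>i\<parallel> \<ge> \<epsilon> / 4\<close> whose sum has norm at most \<open>2\<close>. For arbitrary nonnegative
  vectors \<open>\<Sum>\<parallel>a\<^sub>i\<parallel> \<le> (2 log\<^sub>2 n + O(1)) \<parallel>\<Sum>a\<^sub>i\<parallel>\<close>: the coordinates up to \<open>n\<close> split into \<open>log\<^sub>2 n\<close> blocks on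
  which \<open>T\<close> is \<open>\<ell>\<^sub>1\<close> up to the factor \<open>2\<close>, and beyond \<open>n\<close> any \<open>n\<close> nonnegative vectors can be replaced by \<open>2n\<close>
  successive pieces of their sum. So \<open>n\<epsilon> = O(log n)\<close>, which gives power type \<open>1\<close>.

  Conversely, if \<open>a\<close> is nonnegative and finitely supported with \<open>\<parallel>a\<parallel> \<le> 1\<close>, then removing one coordinate of
  \<open>a\<close> after the other shows that \<open>0\<close> survives the derivations with parameters \<open>a\<^sub>j / 2\<close>, and \<open>\<Sum>a\<^sub>j\<close> is
  unbounded because the norm of \<open>T\<close> is not equivalent to the \<open>\<ell>\<^sub>1\<close> norm.
\<close>

section \<open>The Tsirelson norm\<close>

text \<open>The obstacle is that the vectors obtained from the derived sets may overlap in T: far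
  points can escape to infinity inside the same copies of l_1, whereas the norm of T speaks about
  successive pieces only. So the lower estimate treats the norming trees of all vectors at once, by
  induction on their depth. The trees are replaced by a single family of successive pieces of the
  sum. At each level the factor 1/2 in the norm pays for merging an admissible group of pieces into
  one, so the constant stays 1 at every depth. What must be controlled is the number of pieces, two
  for each vector, and how far to the left they start. The same estimate shows that every functional
  on the direct sum has small tails, which makes it negligible on the set where the next vector is
  found. The dual norm enters as the supremum of the T norms of finite profiles. These profiles are
  built from absolute values, so T is needed over the reals only and one argument serves real and
  complex scalars.\<close>

lemma norm_c00_eq_rhs: "norm x = tsirelson_rhs norm x"
  using tsirelson_norm_eq[of x] by (simp add: norm_c00_def)

lemma seminorm_norm_c00: "is_seminorm_c00 norm"
  using is_norm_imp_seminorm[OF is_norm_tsirelson_norm] by (simp add: norm_c00_def)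

lemma tsirelson_iter_tendsto_norm: "(\<lambda>m. tsirelson_iter m x) \<longlonglongrightarrow> norm x"
  by (simp add: norm_c00_def tsirelson_norm_eq_limit tsirelson_iter_tendsto)

lemma norm_c00_le_of_iter: "(\<And>m. tsirelson_iter m x \<le> c) \<Longrightarrow> norm x \<le> c"
  by (rule LIMSEQ_le_const2[OF tsirelson_iter_tendsto_norm]) auto

lemma norm_c00_le_l1: 
  assumes "finite S" "{i. coord x i \<noteq> 0} \<subseteq> S"
  shows "norm x \<le> (\<Sum>i\<in>S. norm (coord x i))"
proof -
  have "norm x \<le> (\<Sum>i | coord x i \<noteq> 0. norm (coord x i))"
    by (rule norm_c00_le_of_iter) (rule tsirelson_iter_le)
  also have "\<dots> \<le> (\<Sum>i\<in>S. norm (coord x i))"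
    by (rule sum_mono2) (use assms in auto)
  finally show ?thesis .
qed

lemma admissible_norm_sum_le:
  "tsirelson_admissible k E \<Longrightarrow> (\<Sum>j=1..k. norm (proj_c00 (E j) x)) \<le> 2 * norm x"
  using sum_le_tsirelson_rhs[OF seminorm_norm_c00, of k E x] norm_c00_eq_rhs[of x] by simp

lemma norm_proj_c00_le: "norm (proj_c00 E x) \<le> norm x"
  by (rule norm_c00_unconditional) simp

lemma c00_bounded_support: obtains M where "\<And>i. coord x i \<noteq> 0 \<Longrightarrow> Suc i \<le> M"
proof -
  have "finite (Suc ` {i. coord x i \<noteq> 0})" by simp
  then obtain M where "\<forall>n \<in> Suc ` {i. coord x i \<noteq> 0}. n \<le> M"
    using finite_nat_set_iff_bounded_le by blast
  then show ?thesis using that by auto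
qed

lemma set_beforeI: "finite E \<Longrightarrow> finite F \<Longrightarrow> (\<And>m n. m \<in> E \<Longrightarrow> n \<in> F \<Longrightarrow> m < n) \<Longrightarrow> E \<lless> F"
  unfolding set_before_def by (metis Max_in Min_in)

text \<open>Admissibility in a flexible form: the pieces may be infinite and indexed by any finite
  set of numbers. Cutting them at a bound \<open>M\<close> of the support of \<open>x\<close> makes
  them finite without changing the projections, and the increasing enumeration of \<open>R\<close>
  numbers them from 1.\<close>

lemma norm_successive_sum_le:
  fixes R :: "nat set"
  assumes R: "finite R" and far: "\<And>r n. r \<in> R \<Longrightarrow> n \<in> G r \<Longrightarrow> card R < n"
    and succ: "\<And>r r' n n'. r \<in> R \<Longrightarrow> r' \<in> R \<Longrightarrow> r < r' \<Longrightarrow> n \<in> G r \<Longrightarrow> n' \<in> G r' \<Longrightarrow> n < n'"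
  shows "(\<Sum>r\<in>R. norm (proj_c00 (G r) x)) \<le> 2 * norm x"
proof (cases "R = {}")
  case False
  obtain M where M: "\<And>i. coord x i \<noteq> 0 \<Longrightarrow> Suc i \<le> M" using c00_bounded_support by blast
  define k where "k = card R"
  obtain h :: "nat \<Rightarrow> nat" where h: "bij_betw h {..<k} R" "strict_mono_on {..<k} h"
    using ex_bij_betw_strict_mono_card[OF R] unfolding k_def by blast
  define E where "E j = G (h (j - 1)) \<inter> {..M}" for j
  have hR: "h (j - 1) \<in> R" if "j \<in> {1..k}" for j
    using that h(1) by (auto simp: bij_betw_def)
  have "tsirelson_admissible k E"
    unfolding tsirelson_admissible_def
  proof (intro conjI ballI impI)
    show "k \<ge> 1" using False R by (simp add: k_def Suc_leI card_gt_0_iff)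
    fix j assume j: "j \<in> {1..k}"
    show "finite (E j)" by (simp add: E_def)
    show "{k} \<lless> E j"
      using far[OF hR[OF j]] by (intro set_beforeI) (auto simp: E_def k_def)
    fix i assume i: "i \<in> {1..k}" "j < i"
    then have "h (j - 1) < h (i - 1)"
      using j by (intro strict_mono_onD[OF h(2)]) auto
    then show "E j \<lless> E i"
      using succ[OF hR[OF j] hR[OF i(1)]] by (intro set_beforeI) (auto simp: E_def)
  qed
  from admissible_norm_sum_le[OF this, of x]
  have "(\<Sum>j=1..k. norm (proj_c00 (E j) x)) \<le> 2 * norm x" .
  moreover have "proj_c00 (E j) x = proj_c00 (G (h (j - 1))) x" for j
    using M by (intro c00_eqI) (auto simp: E_def)
  moreover have "(\<Sum>j=1..k. norm (proj_c00 (G (h (j - 1))) x)) = (\<Sum>j<k. norm (proj_c00 (G (h j)) x))"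
    by (rule sum.reindex_bij_witness[of _ Suc "\<lambda>j. j - 1"]) auto
  moreover have "\<dots> = (\<Sum>r\<in>R. norm (proj_c00 (G r) x))"
    by (rule sum.reindex_bij_betw[OF h(1)])
  ultimately show ?thesis by simp
qed simp

text \<open>The coordinate numbers from 2^K + 1 to 2^(K+1) are 2^K many and all exceed 2^K, so their
  singletons form an admissible family. Each doubling therefore costs \<open>2 * norm x\<close>; the
  1 pays for the first coordinate.\<close>

lemma sum_coord_lessThan_power2_le:
  fixes x :: "real c00"
  shows "(\<Sum>i<2 ^ K. \<bar>coord x i\<bar>) \<le> (1 + 2 * real K) * norm x"
proof (induction K)
  case 0
  show ?case using norm_coord_le[of x 0] by simp
next
  case (Suc K)
  let ?D = "{Suc (2 ^ K)..2 ^ Suc K}"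
  have "(\<Sum>r\<in>?D. norm (proj_c00 {r} x)) \<le> 2 * norm x"
    by (rule norm_successive_sum_le) auto
  moreover have "(\<Sum>i\<in>{2 ^ K..<2 ^ Suc K}. \<bar>coord x i\<bar>) \<le> (\<Sum>r\<in>?D. norm (proj_c00 {r} x))"
  proof -
    have "(\<Sum>i\<in>{2 ^ K..<2 ^ Suc K}. \<bar>coord x i\<bar>) \<le> (\<Sum>i\<in>{2 ^ K..<2 ^ Suc K}. norm (proj_c00 {Suc i} x))"
    proof (rule sum_mono)
      fix i show "\<bar>coord x i\<bar> \<le> norm (proj_c00 {Suc i} x)"
        using norm_coord_le[of "proj_c00 {Suc i} x" i] by simp
    qed
    also have "\<dots> = (\<Sum>r\<in>?D. norm (proj_c00 {r} x))"
      by (rule sum.reindex_bij_witness[of _ "\<lambda>j. j - 1" Suc]) auto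
    finally show ?thesis .
  qed
  moreover have "(\<Sum>i<2 ^ Suc K. \<bar>coord x i\<bar>) =
      (\<Sum>i<2 ^ K. \<bar>coord x i\<bar>) + (\<Sum>i\<in>{2 ^ K..<2 ^ Suc K}. \<bar>coord x i\<bar>)"
    by (subst sum.union_disjoint[symmetric]) (auto intro!: sum.cong)
  ultimately show ?case using Suc by (simp add: algebra_simps)
qed

text \<open>Only finitely many sums occur: the sets matter only up to a bound \<open>M\<close> of
  the support, and a family with \<open>k > M\<close> misses the support altogether, which accounts
  for the extra value 0.\<close>

lemma tsirelson_sums_attained:
  fixes x :: "'k::real_normed_field c00"
  assumes N: "is_seminorm_c00 N"
  obtains k E where "tsirelson_admissible k E" "Sup (tsirelson_sums N x) = (\<Sum>j=1..k. N (proj_c00 (E j) x))"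
proof -
  obtain M where M: "\<And>i. coord x i \<noteq> 0 \<Longrightarrow> Suc i \<le> M" using c00_bounded_support by blast
  let ?v = "\<lambda>k F. \<Sum>j=1..k. N (proj_c00 (F j) x)"
  have "tsirelson_sums N x \<subseteq> insert 0 (\<Union>k\<in>{..M}. ?v k ` ({1..k} \<rightarrow>\<^sub>E Pow {..M}))"
  proof
    fix v assume "v \<in> tsirelson_sums N x"
    then obtain k E where kE: "tsirelson_admissible k E" "v = ?v k E"
      by (auto simp: tsirelson_sums_def)
    show "v \<in> insert 0 (\<Union>k\<in>{..M}. ?v k ` ({1..k} \<rightarrow>\<^sub>E Pow {..M}))"
    proof (cases "k \<le> M")
      case True
      let ?F = "restrict (\<lambda>j. E j \<inter> {..M}) {1..k}"
      have "v = ?v k ?F"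
        unfolding kE(2) using M by (intro sum.cong refl arg_cong[where f = N] c00_eqI) auto
      moreover have "?F \<in> {1..k} \<rightarrow>\<^sub>E Pow {..M}" by auto
      ultimately show ?thesis using True by blast
    next
      case False
      have "proj_c00 (E j) x = 0" if j: "j \<in> {1..k}" for j
      proof (rule c00_eqI)
        fix i
        have "coord x i = 0" if "Suc i \<in> E j"
        proof -
          have "k < Suc i"
            using kE(1) j set_before_less[of "{k}" "E j" k "Suc i"] that
            unfolding tsirelson_admissible_def by simp
          then show ?thesis using False M[of i] by linarith
        qed
        then show "coord (proj_c00 (E j) x) i = coord 0 i" by simp
      qed
      then have "v = 0" unfolding kE(2) by (simp add: seminorm_zero[OF N])
      then show ?thesis by simp
    qed
  qed
  moreover have "finite (insert 0 (\<Union>k\<in>{..M}. ?v k ` ({1..k} \<rightarrow>\<^sub>E Pow {..M})))"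
    by (auto intro!: finite_PiE)
  ultimately have fin: "finite (tsirelson_sums N x)" by (rule finite_subset)
  have "Sup (tsirelson_sums N x) \<in> tsirelson_sums N x"
    using cSup_eq_Max[OF fin tsirelson_sums_nonempty] Max_in[OF fin tsirelson_sums_nonempty] by simp
  then show ?thesis using that by (auto simp: tsirelson_sums_def)
qed

lemma sup_c00_attained: obtains i where "sup_c00 x = norm (coord x i)"
proof -
  have "range (\<lambda>i. norm (coord x i)) \<subseteq> insert 0 ((\<lambda>i. norm (coord x i)) ` {i. coord x i \<noteq> 0})" by auto
  then have fin: "finite (range (\<lambda>i. norm (coord x i)))" by (rule finite_subset) simp
  have "sup_c00 x \<in> range (\<lambda>i. norm (coord x i))"
    unfolding sup_c00_def using cSup_eq_Max[OF fin] Max_in[OF fin] by simp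
  then show ?thesis using that by auto
qed

text \<open>One node of a norming tree: a leaf picks a coordinate, an inner node an admissible
  family with weight 1/2.\<close>

lemma tsirelson_rhs_cases:
  fixes x :: "'k::real_normed_field c00"
  assumes "is_seminorm_c00 N"
  obtains (coordinate) i where "tsirelson_rhs N x = norm (coord x i)"
  | (admissible) k E where "tsirelson_admissible k E"
      "tsirelson_rhs N x = 1/2 * (\<Sum>j=1..k. N (proj_c00 (E j) x))"
  using sup_c00_attained[of x] tsirelson_sums_attained[OF assms, of x]
  by (metis tsirelson_rhs_def max_def)

section \<open>The lower estimate\<close>

text \<open>
  A finite set of cut points partitions the coordinates into segments; the last one is infinite and
  the coordinates before the first cut point are discarded.
\<close>

definition segment :: "nat set \<Rightarrow> nat \<Rightarrow> nat set" where
  "segment P p = {n. p \<le> n \<and> (\<forall>p'\<in>P. p' \<le> n \<longrightarrow> p' \<le> p)}"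

definition segment_sum :: "nat set \<Rightarrow> 'k::real_normed_field c00 \<Rightarrow> real" where
  "segment_sum P x = (\<Sum>p\<in>P. norm (proj_c00 (segment P p) x))"

section \<open>Segments and their refinement\<close>

lemma segment_less: "p' \<in> P \<Longrightarrow> p < p' \<Longrightarrow> n \<in> segment P p \<Longrightarrow> n < p'"
  unfolding segment_def mem_Collect_eq by (meson leD not_le_imp_less)

lemma segment_ge: "n \<in> segment P p \<Longrightarrow> p \<le> n"
  by (simp add: segment_def)

lemma segment_convex: "n \<in> segment P p \<Longrightarrow> p \<le> r \<Longrightarrow> r \<le> n \<Longrightarrow> r \<in> segment P p"
  unfolding segment_def mem_Collect_eq by (meson order_trans)

lemma self_in_segment: "p \<in> segment P p"
  by (simp add: segment_def)

lemma ex_segment: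
  assumes "finite P" "p \<in> P" "p \<le> n" obtains r where "r \<in> P" "p \<le> r" "n \<in> segment P r"
proof -
  have fin: "finite {r \<in> P. r \<le> n}" and ne: "{r \<in> P. r \<le> n} \<noteq> {}" using assms by auto
  show ?thesis
    using that[of "Max {r \<in> P. r \<le> n}"] Max_in[OF fin ne] Max_ge[OF fin] assms
    by (auto simp: segment_def)
qed

lemma segment_unique: "p \<in> P \<Longrightarrow> p' \<in> P \<Longrightarrow> n \<in> segment P p \<Longrightarrow> n \<in> segment P p' \<Longrightarrow> p = p'"
  unfolding segment_def mem_Collect_eq by (meson antisym)

lemma segment_subset_segment: "P \<subseteq> Q \<Longrightarrow> r \<in> segment P p \<Longrightarrow> segment Q r \<subseteq> segment P p"
  unfolding segment_def subset_iff mem_Collect_eq by (meson order_trans)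

lemma sum_over_segments:
  assumes "finite P" "P \<subseteq> Q" "finite Q"
  shows "(\<Sum>p\<in>P. \<Sum>r\<in>Q \<inter> segment P p. g r) = sum g (Q \<inter> (\<Union>p\<in>P. segment P p))"
proof -
  have "sum g (\<Union>p\<in>P. Q \<inter> segment P p) = (\<Sum>p\<in>P. \<Sum>r\<in>Q \<inter> segment P p. g r)"
  proof (rule sum.UNION_disjoint)
    show "\<forall>p\<in>P. \<forall>p'\<in>P. p \<noteq> p' \<longrightarrow> Q \<inter> segment P p \<inter> (Q \<inter> segment P p') = {}"
      using segment_unique[of _ P] by fastforce
  qed (use assms in auto)
  then show ?thesis unfolding Int_UN_distrib by (rule sym)
qed

text \<open>Every old segment is the disjoint union of the new segments that start in it, so the
  triangle inequality applies. New segments before the first point of \<open>P\<close> only add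
  nonnegative terms.\<close>

lemma segment_sum_refine:
  fixes x :: "'k::real_normed_field c00"
  assumes "finite Q" "P \<subseteq> Q"
  shows "segment_sum P x \<le> segment_sum Q x"
proof -
  have P: "finite P" using assms finite_subset by blast
  have "norm (proj_c00 (segment P p) x) \<le> (\<Sum>r\<in>Q \<inter> segment P p. norm (proj_c00 (segment Q r) x))"
    if p: "p \<in> P" for p
  proof -
    have "proj_c00 (segment P p) x = (\<Sum>r\<in>Q \<inter> segment P p. proj_c00 (segment Q r) x)"
    proof (rule c00_eqI)
      fix i
      let ?R = "Q \<inter> segment P p"
      show "coord (proj_c00 (segment P p) x) i = coord (\<Sum>r\<in>?R. proj_c00 (segment Q r) x) i"
      proof (cases "Suc i \<in> segment P p")
        case True
        obtain r where r: "r \<in> Q" "p \<le> r" "Suc i \<in> segment Q r"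
          using ex_segment[OF assms(1), of p "Suc i"] p assms(2) segment_ge[OF True] by blast
        have "r \<in> segment P p"
          by (rule segment_convex[OF True r(2) segment_ge[OF r(3)]])
        then have rR: "r \<in> ?R" using r(1) by simp
        have "(\<Sum>r'\<in>?R. coord (proj_c00 (segment Q r') x) i) = (\<Sum>r'\<in>?R. if r' = r then coord x i else 0)"
        proof (rule sum.cong)
          fix r' assume "r' \<in> ?R"
          then have "Suc i \<in> segment Q r' \<longleftrightarrow> r' = r" using r segment_unique[of r' Q r "Suc i"] by blast
          then show "coord (proj_c00 (segment Q r') x) i = (if r' = r then coord x i else 0)" by simp
        qed simp
        also have "\<dots> = coord x i" using rR assms(1) by simp
        finally show ?thesis using True by (simp only: coord_sum proj_c00.rep_eq if_True)
      next
        case False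
        then have "Suc i \<notin> segment Q r" if "r \<in> ?R" for r
          using that segment_subset_segment[OF assms(2)] by blast
        then have "(\<Sum>r'\<in>?R. coord (proj_c00 (segment Q r') x) i) = 0" by (intro sum.neutral) auto
        then show ?thesis using False by (simp only: coord_sum proj_c00.rep_eq if_False)
      qed
    qed
    then show ?thesis by (simp add: norm_sum)
  qed
  then have "segment_sum P x \<le> (\<Sum>p\<in>P. \<Sum>r\<in>Q \<inter> segment P p. norm (proj_c00 (segment Q r) x))"
    unfolding segment_sum_def by (rule sum_mono)
  also have "\<dots> \<le> segment_sum Q x"
    unfolding segment_sum_def sum_over_segments[OF P assms(2,1)]
    by (rule sum_mono2) (use assms in auto)
  finally show ?thesis .
qed

section \<open>Grouping pieces into admissible families\<close>

lemma ex_initial_part: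
  fixes P :: "nat set"
  assumes "finite P" obtains t where "card {p \<in> P. p < t} = min k (card P)"
proof -
  have "\<exists>t. card {p \<in> P. p < t} = min k (card P)"
  proof (induction k)
    case 0
    show ?case by (rule exI[of _ 0]) simp
  next
    case (Suc k)
    then obtain t where t: "card {p \<in> P. p < t} = min k (card P)" by blast
    show ?case
    proof (cases "card P \<le> k")
      case True then show ?thesis using t by (intro exI[of _ t]) simp
    next
      case False
      let ?R = "{p \<in> P. t \<le> p}"
      have "card {p \<in> P. p < t} \<noteq> card P" using t False by linarith
      then have "{p \<in> P. p < t} \<noteq> P" by (rule contrapos_nn) (rule arg_cong)
      then have "\<not> P \<subseteq> {p. p < t}" by blast
      then have ne: "?R \<noteq> {}" and fin: "finite ?R" using assms by (auto simp: not_less)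
      have "{p \<in> P. p < Suc (Min ?R)} = insert (Min ?R) {p \<in> P. p < t}"
        using Min_in[OF fin ne] Min_le[OF fin] by (force simp: less_Suc_eq_le)
      moreover have "Min ?R \<notin> {p \<in> P. p < t}" using Min_in[OF fin ne] by auto
      ultimately have "card {p \<in> P. p < Suc (Min ?R)} = Suc (card {p \<in> P. p < t})"
        using assms by simp
      then show ?thesis using t False by (intro exI[of _ "Suc (Min ?R)"]) simp
    qed
  qed
  then show ?thesis using that by blast
qed

text \<open>
  The greedy grouping which makes a nonadmissible family of pieces admissible again. A pair \<open>(k, s)\<close>
  stands for a node of a norming tree with \<open>k\<close> successors and first coordinate \<open>s\<close>, and \<open>P\<close> contains the
  starting points of the pieces below these nodes. Groups are filled from the left, two groups of
  \<open>k\<close> pieces for each node in the order of the nodes.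
\<close>

lemma group_cut_points_sorted:
  assumes "sorted (map snd ss)" "\<forall>(k, s) \<in> set ss. k < s" "finite P"
    and "\<And>q. card {p \<in> P. p \<le> q} \<le> 2 * (\<Sum>(k, s)\<leftarrow>ss. if s \<le> q then k else 0)"
  shows "\<exists>Z \<subseteq> P. (\<forall>q. card {z \<in> Z. z \<le> q} \<le> 2 * length (filter (\<lambda>(k, s). s \<le> q) ss)) \<and>
    (\<forall>p\<in>P. \<exists>z\<in>Z. z \<le> p) \<and> (\<forall>z\<in>Z. card (P \<inter> segment Z z) < z)"
  using assms
proof (induction ss arbitrary: P)
  case Nil
  have "p \<notin> P" for p
    using Nil(4)[of p] Nil(3) by auto
  then show ?case by auto
next
  case (Cons ks ss)
  obtain k s where ks: "ks = (k, s)" by force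
  \<comment> \<open>\<open>A\<close> takes the first \<open>k\<close> points of \<open>P\<close>,
    \<open>A'\<close> the next \<open>k\<close> and \<open>P'\<close> the rest, as far as there are
    points. If \<open>P\<close> runs out, \<open>u\<close> may be smaller than \<open>t\<close>; the
    condition \<open>t \<le> p\<close> in \<open>A'\<close> and \<open>P'\<close> keeps the three
    sets disjoint also then.\<close>
  obtain t where t: "card {p \<in> P. p < t} = min k (card P)" using ex_initial_part[OF Cons.prems(3)] by blast
  obtain u where u: "card {p \<in> P. p < u} = min (2 * k) (card P)" using ex_initial_part[OF Cons.prems(3)] by blast
  define A where "A = {p \<in> P. p < t}"
  define A' where "A' = {p \<in> P. t \<le> p \<and> p < u}"
  define P' where "P' = {p \<in> P. u \<le> p \<and> t \<le> p}"
  have fin: "finite A" "finite A'" "finite P'" using Cons.prems(3) by (auto simp: A_def A'_def P'_def)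
  have Pun: "P = A \<union> A' \<union> P'" by (auto simp: A_def A'_def P'_def)
  have ord: "a < b" if "a \<in> A" "b \<in> A' \<union> P'" for a b using that by (auto simp: A_def A'_def P'_def)
  have ord': "a < b" if "a \<in> A'" "b \<in> P'" for a b using that by (auto simp: A_def A'_def P'_def)
  have cA: "card A \<le> k" using t by (simp add: A_def)
  have cAA': "card (A \<union> A') = min (2 * k) (card P)"
  proof (cases "t \<le> u")
    case True
    then have "A \<union> A' = {p \<in> P. p < u}" by (auto simp: A_def A'_def)
    then show ?thesis using u by simp
  next
    case False
    then have "{p \<in> P. p < u} \<subseteq> A" "A \<union> A' = A" by (auto simp: A_def A'_def)
    then have "card {p \<in> P. p < u} \<le> card A" using fin card_mono by blast
    then show ?thesis using u t \<open>A \<union> A' = A\<close> by (simp add: A_def)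
  qed
  have cA': "card A' \<le> k"
  proof -
    have "card (A \<union> A') = card A + card A'"
      by (rule card_Un_disjoint) (use fin in \<open>auto simp: A_def A'_def\<close>)
    then show ?thesis using cAA' t by (simp add: A_def)
  qed
  \<comment> \<open>The list is sorted by first coordinates, so before \<open>s\<close> the
    hypothesis bounds the number of points by 0.\<close>
  have sP: "s \<le> p" if p: "p \<in> P" for p
  proof (rule ccontr)
    assume "\<not> s \<le> p"
    then have 0: "(\<Sum>(k, s)\<leftarrow>ks # ss. if s \<le> p then k else 0) = 0"
      using Cons.prems(1) by (auto simp: ks split_def sum_list_eq_0_iff)
    have "card {p' \<in> P. p' \<le> p} = 0" using Cons.prems(4)[of p] unfolding 0 by simp
    moreover have "finite {p' \<in> P. p' \<le> p}" "p \<in> {p' \<in> P. p' \<le> p}" using p Cons.prems(3) by simp_all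
    ultimately show False by (metis card_eq_0_iff empty_iff)
  qed
  have "\<exists>Z \<subseteq> P'. (\<forall>q. card {z \<in> Z. z \<le> q} \<le> 2 * length (filter (\<lambda>(k, s). s \<le> q) ss)) \<and>
    (\<forall>p\<in>P'. \<exists>z\<in>Z. z \<le> p) \<and> (\<forall>z\<in>Z. card (P' \<inter> segment Z z) < z)"
  proof (rule Cons.IH)
    show "sorted (map snd ss)" "\<forall>(k, s)\<in>set ss. k < s" using Cons.prems by auto
    show "finite P'" by fact
    fix q
    \<comment> \<open>A point of \<open>P'\<close> up to \<open>q\<close> forces both groups to be
      full. Their 2k points also lie up to \<open>q\<close> and use up the whole share of the node
      \<open>(k, s)\<close>.\<close>
    show "card {p \<in> P'. p \<le> q} \<le> 2 * (\<Sum>(k, s)\<leftarrow>ss. if s \<le> q then k else 0)"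
    proof (cases "{p \<in> P'. p \<le> q} = {}")
      case False
      then obtain p where p: "p \<in> P'" "p \<le> q" by blast
      have "a < p" if "a \<in> A \<union> A'" for a using that ord ord' p(1) by blast
      then have "a \<le> q" if "a \<in> A \<union> A'" for a using that p(2) by fastforce
      then have "{p \<in> P. p \<le> q} = (A \<union> A') \<union> {p \<in> P'. p \<le> q}" unfolding Pun by blast
      moreover have "card (A \<union> A' \<union> {p \<in> P'. p \<le> q}) = card (A \<union> A') + card {p \<in> P'. p \<le> q}"
        by (rule card_Un_disjoint) (use fin in \<open>auto simp: A_def A'_def P'_def\<close>)
      moreover have "card (A \<union> A') = 2 * k"
      proof -
        have "p \<notin> A \<union> A'" using p(1) ord ord' by blast
        then have "A \<union> A' \<subset> P" using p(1) unfolding Pun by blast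
        then have "card (A \<union> A') < card P" using Cons.prems(3) psubset_card_mono by blast
        then show ?thesis using cAA' by simp
      qed
      moreover have "card {p \<in> P. p \<le> q} \<le> 2 * (k + (\<Sum>(k, s)\<leftarrow>ss. if s \<le> q then k else 0))"
        using Cons.prems(4)[of q] by (auto simp: ks split: if_splits)
      ultimately show ?thesis by simp
    qed (simp only: card.empty)
  qed
  then obtain Z where Z: "Z \<subseteq> P'" "\<And>q. card {z \<in> Z. z \<le> q} \<le> 2 * length (filter (\<lambda>(k, s). s \<le> q) ss)"
    "\<And>p. p \<in> P' \<Longrightarrow> \<exists>z\<in>Z. z \<le> p" "\<And>z. z \<in> Z \<Longrightarrow> card (P' \<inter> segment Z z) < z" by blast
  have finZ: "finite Z" using Z(1) fin(3) finite_subset by blast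
  \<comment> \<open>The first points of the two groups become cut points. As every later point of
    \<open>P\<close> has a cut point of its own part at or before it, a segment starting in one
    group cannot contain points of the next part.\<close>
  define Y where "Y = (if A = {} then {} else {Min A})"
  define Y' where "Y' = (if A' = {} then {} else {Min A'})"
  have YA: "Y \<subseteq> A" "Y' \<subseteq> A'" using fin by (auto simp: Y_def Y'_def)
  have YP: "\<exists>z\<in>Y. z \<le> p" if "p \<in> A" for p using that Min_le[OF fin(1)] by (auto simp: Y_def)
  have Y'P: "\<exists>z\<in>Y'. z \<le> p" if "p \<in> A'" for p using that Min_le[OF fin(2)] by (auto simp: Y'_def)
  let ?Z = "Y \<union> Y' \<union> Z"
  show ?case
  proof (intro exI[of _ ?Z] conjI allI ballI)
    show "?Z \<subseteq> P" using Z(1) YA unfolding Pun by blast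
    show "\<exists>z\<in>?Z. z \<le> p" if "p \<in> P" for p
    proof -
      have "p \<in> A \<or> p \<in> A' \<or> p \<in> P'" using that unfolding Pun by blast
      then show ?thesis using Z(3) YP Y'P by blast
    qed
    fix q
    have "card {z \<in> ?Z. z \<le> q} \<le> (if s \<le> q then 2 else 0) + card {z \<in> Z. z \<le> q}"
    proof -
      have "{z \<in> ?Z. z \<le> q} = {z \<in> Y \<union> Y'. z \<le> q} \<union> {z \<in> Z. z \<le> q}" by blast
      then have "card {z \<in> ?Z. z \<le> q} \<le> card {z \<in> Y \<union> Y'. z \<le> q} + card {z \<in> Z. z \<le> q}"
        by (simp add: card_Un_le)
      moreover have "card {z \<in> Y \<union> Y'. z \<le> q} \<le> (if s \<le> q then 2 else 0)"
      proof (cases "s \<le> q")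
        case True
        have "card {z \<in> Y \<union> Y'. z \<le> q} \<le> card (Y \<union> Y')" by (rule card_mono) (auto simp: Y_def Y'_def)
        also have "\<dots> \<le> card Y + card Y'" by (rule card_Un_le)
        also have "\<dots> \<le> 2" by (simp add: Y_def Y'_def)
        finally show ?thesis using True by simp
      next
        case False
        have "s \<le> z" if "z \<in> Y \<union> Y'" for z using that YA sP[of z] unfolding Pun by blast
        then have "{z \<in> Y \<union> Y'. z \<le> q} = {}" using False by force
        then show ?thesis by (simp only: card.empty)
      qed
      ultimately show ?thesis by linarith
    qed
    then show "card {z \<in> ?Z. z \<le> q} \<le> 2 * length (filter (\<lambda>(k, s). s \<le> q) (ks # ss))"
      using Z(2)[of q] by (auto simp: ks)
  next
    fix z assume "z \<in> ?Z"
    then consider "z \<in> Y" | "z \<in> Y'" | "z \<in> Z" by blast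
    then show "card (P \<inter> segment ?Z z) < z"
    proof cases
      case 1
      have "P \<inter> segment ?Z z \<subseteq> A"
      proof
        fix p assume p: "p \<in> P \<inter> segment ?Z z"
        show "p \<in> A"
        proof (rule ccontr)
          assume "p \<notin> A"
          then have "p \<in> A' \<or> p \<in> P'" using p unfolding Pun by blast
          then obtain z' where "z' \<in> Y' \<union> Z" "z' \<le> p" using Z(3) Y'P by blast
          moreover from this have "z < z'" using 1 YA Z(1) ord by blast
          ultimately show False using p segment_less[of z' ?Z z p] by force
        qed
      qed
      then have "card (P \<inter> segment ?Z z) \<le> k" using card_mono[OF fin(1)] cA order_trans by blast
      also have "k < s" using Cons.prems(2) ks by auto
      also have "s \<le> z" by (rule sP) (use 1 YA in \<open>auto simp: Pun\<close>)
      finally show ?thesis .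
    next
      case 2
      have "P \<inter> segment ?Z z \<subseteq> A'"
      proof
        fix p assume p: "p \<in> P \<inter> segment ?Z z"
        have "z \<le> p" using p by (intro segment_ge[of p ?Z z]) blast
        then have "p \<notin> A" using 2 YA ord[of p z] by force
        show "p \<in> A'"
        proof (rule ccontr)
          assume "p \<notin> A'"
          then have "p \<in> P'" using p \<open>p \<notin> A\<close> unfolding Pun by blast
          then obtain z' where "z' \<in> Z" "z' \<le> p" using Z(3) by blast
          moreover from this have "z < z'" using 2 YA Z(1) ord' by blast
          ultimately show False using p segment_less[of z' ?Z z p] by force
        qed
      qed
      then have "card (P \<inter> segment ?Z z) \<le> k" using card_mono[OF fin(2)] cA' order_trans by blast
      also have "k < s" using Cons.prems(2) ks by auto
      also have "s \<le> z" by (rule sP) (use 2 YA in \<open>auto simp: Pun\<close>)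
      finally show ?thesis .
    next
      case 3
      have "P \<inter> segment ?Z z \<subseteq> P' \<inter> segment Z z"
      proof
        fix p assume p: "p \<in> P \<inter> segment ?Z z"
        have "z \<le> p" using p by (intro segment_ge[of p ?Z z]) blast
        then have "p \<notin> A \<union> A'" using 3 Z(1) ord[of p z] ord'[of p z] by force
        then have "p \<in> P'" using p unfolding Pun by blast
        then show "p \<in> P' \<inter> segment Z z" using p by (simp add: segment_def)
      qed
      then have "card (P \<inter> segment ?Z z) \<le> card (P' \<inter> segment Z z)"
        using fin by (intro card_mono) auto
      also have "\<dots> < z" by (rule Z(4)[OF 3])
      finally show ?thesis .
    qed
  qed
qed

lemma group_cut_points:
  assumes "\<forall>(k, s) \<in> set ss. k < s" "finite P"
    and "\<And>q. card {p \<in> P. p \<le> q} \<le> 2 * (\<Sum>(k, s)\<leftarrow>ss. if s \<le> q then k else 0)"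
  obtains Z where "Z \<subseteq> P" "\<And>q. card {z \<in> Z. z \<le> q} \<le> 2 * length (filter (\<lambda>(k, s). s \<le> q) ss)"
    "\<And>p. p \<in> P \<Longrightarrow> \<exists>z\<in>Z. z \<le> p" "\<And>z. z \<in> Z \<Longrightarrow> card (P \<inter> segment Z z) < z"
proof -
  have *: "(\<Sum>a\<leftarrow>sort_key snd ss. f a) = (\<Sum>a\<leftarrow>ss. f a)" for f :: "nat \<times> nat \<Rightarrow> nat"
    unfolding sum_mset_sum_list[symmetric] by simp
  have **: "length (filter Q (sort_key snd ss)) = length (filter Q ss)" for Q
    unfolding size_mset[symmetric] mset_filter by simp
  have "\<exists>Z \<subseteq> P. (\<forall>q. card {z \<in> Z. z \<le> q} \<le> 2 * length (filter (\<lambda>(k, s). s \<le> q) (sort_key snd ss))) \<and>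
    (\<forall>p\<in>P. \<exists>z\<in>Z. z \<le> p) \<and> (\<forall>z\<in>Z. card (P \<inter> segment Z z) < z)"
    by (rule group_cut_points_sorted) (use assms in \<open>simp_all add: *\<close>)
  then show ?thesis using that unfolding ** by blast
qed

lemma sum_list_sum_swap: "(\<Sum>a\<leftarrow>as. \<Sum>p\<in>L. f a p) = (\<Sum>p\<in>L. \<Sum>a\<leftarrow>as. f a p)"
  for f :: "'a \<Rightarrow> 'b \<Rightarrow> 'c::comm_monoid_add"
  by (induction as) (simp_all add: sum.distrib)

lemma segment_antimono: "P \<subseteq> Q \<Longrightarrow> segment Q p \<subseteq> segment P p"
  unfolding segment_def by blast

lemma proj_c00_proj: "proj_c00 A (proj_c00 B x) = proj_c00 (A \<inter> B) x"
  by (rule c00_eqI) simp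

text \<open>
  A node whose norm is attained at a single coordinate becomes a segment of its own. Cutting it out
  starts a new group right after it, but that group can hold at least as many pieces as the interrupted
  one, and its first piece is the remainder of a piece of the latter.
\<close>

lemma segment_sum_with_leaves:
  fixes x y :: "real c00"
  assumes nonneg: "\<And>a i. a \<in> set as \<Longrightarrow> 0 \<le> coord a i" "\<And>i. 0 \<le> coord y i"
    and le: "\<And>i. (\<Sum>a\<leftarrow>as. coord a i) + coord y i \<le> coord x i"
    and P: "finite P" "Z \<subseteq> P" "\<And>p. p \<in> P \<Longrightarrow> \<exists>z\<in>Z. z \<le> p"
      "\<And>z. z \<in> Z \<Longrightarrow> card (P \<inter> segment Z z) < z"
    and L: "L = {Suc (n a) | a. a \<in> set as \<and> coord a (n a) \<noteq> 0}"
  shows "(\<Sum>a\<leftarrow>as. coord a (n a)) + 1/2 * segment_sum P y \<le> segment_sum (Z \<union> L \<union> Suc ` L) x"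
proof -
  define S where "S = Z \<union> L \<union> Suc ` L"
  define Q where "Q = P \<union> S"
  \<comment> \<open>Several vectors may attain their norm at the same coordinate, so one leaf point
    carries a sum.\<close>
  define leaves where "leaves p = (\<Sum>a\<leftarrow>as. if Suc (n a) = p then coord a (n a) else 0)" for p
  define inner where "inner p = (\<Sum>r\<in>Q \<inter> segment S p. norm (proj_c00 (segment Q r) y))" for p
  have "L \<subseteq> (\<lambda>a. Suc (n a)) ` set as" unfolding L by blast
  then have fL: "finite L" by (rule finite_subset) simp
  have fZ: "finite Z" using P(1,2) finite_subset by blast
  have fP: "finite S" and fQ: "finite Q" using fL fZ P(1) by (simp_all add: S_def Q_def)
  have ZP: "Z \<subseteq> S" and LP: "L \<subseteq> S" and SL: "\<And>l. l \<in> L \<Longrightarrow> Suc l \<in> S"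
    and SQ: "S \<subseteq> Q" and PQ: "P \<subseteq> Q" and Q_cases: "\<And>r. r \<in> Q \<Longrightarrow> r \<in> P \<or> r \<in> S"
    by (auto simp: S_def Q_def)
  have L1: "1 \<le> l" if "l \<in> L" for l using that L by auto
  have leaves: "(\<Sum>a\<leftarrow>as. coord a (n a)) = (\<Sum>p\<in>L. leaves p)"
  proof -
    have "(\<Sum>a\<leftarrow>as. coord a (n a)) = (\<Sum>a\<leftarrow>as. \<Sum>p\<in>L. if Suc (n a) = p then coord a (n a) else 0)"
    proof (intro arg_cong[where f = sum_list] map_cong refl)
      fix a assume "a \<in> set as"
      then have "Suc (n a) \<in> L \<or> coord a (n a) = 0" unfolding L by blast
      then show "coord a (n a) = (\<Sum>p\<in>L. if Suc (n a) = p then coord a (n a) else 0)"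
        using fL by auto
    qed
    then show ?thesis unfolding leaves_def sum_list_sum_swap .
  qed
  have leaf: "leaves (Suc i) + coord y i \<le> coord x i" for i
  proof -
    have "leaves (Suc i) \<le> (\<Sum>a\<leftarrow>as. coord a i)"
      unfolding leaves_def by (rule sum_list_mono) (use nonneg in auto)
    then show ?thesis using le[of i] by linarith
  qed
  have yx: "coord y i \<le> coord x i" for i
  proof -
    have "0 \<le> (\<Sum>a\<leftarrow>as. coord a i)" by (rule sum_list_nonneg) (use nonneg in auto)
    then show ?thesis using le[of i] by linarith
  qed
  have "r \<in> (\<Union>p\<in>S. segment S p)" if r: "r \<in> Q" for r
  proof -
    obtain p where "p \<in> S" "p \<le> r" using Q_cases[OF r] P(3)[of r] ZP by blast
    then show ?thesis using ex_segment[OF fP, of p r] by blast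
  qed
  then have "Q \<inter> (\<Union>p\<in>S. segment S p) = Q" by blast
  then have "segment_sum Q y = (\<Sum>p\<in>S. inner p)"
    using sum_over_segments[OF fP SQ fQ, of "\<lambda>r. norm (proj_c00 (segment Q r) y)"]
    unfolding segment_sum_def inner_def by simp
  then have 1: "segment_sum P y \<le> (\<Sum>p\<in>S. inner p)"
    using segment_sum_refine[OF fQ PQ, of y] by simp
  \<comment> \<open>Fewer than \<open>p\<close> pieces of the finer partition \<open>Q\<close> start
    in the segment of \<open>p\<close>, and none starts before \<open>p\<close>. They are
    admissible, and the factor 2 of the norm inequality cancels the 1/2.\<close>
  have 2: "1/2 * inner p \<le> norm (proj_c00 (segment S p) x)" if p: "p \<in> S - L" for p
  proof -
    let ?R = "Q \<inter> segment S p"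
    have Rp: "?R \<subseteq> insert p (P \<inter> segment S p)"
    proof
      fix r assume r: "r \<in> ?R"
      have "r = p" if "r \<in> S"
        using segment_unique[of p S r r] that r p self_in_segment[of r S] by blast
      then show "r \<in> insert p (P \<inter> segment S p)" using r Q_cases[of r] by blast
    qed
    have card: "card ?R < p"
    proof (cases "p \<in> Z")
      case True
      then have "?R \<subseteq> P \<inter> segment Z p"
        using Rp segment_antimono[OF ZP, of p] self_in_segment[of p Z] P(2) by blast
      then have "card ?R \<le> card (P \<inter> segment Z p)" using P(1) by (intro card_mono) auto
      also have "\<dots> < p" by (rule P(4)[OF True])
      finally show ?thesis .
    next
      case False
      \<comment> \<open>Here \<open>p\<close> is the successor of a leaf point. That it is at least
        2 matters when no group starts at or before \<open>p\<close>: then the piece at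
        \<open>p\<close> is the only one, and 1 < p is required.\<close>
      then have p2: "2 \<le> p" using p L1 unfolding S_def by auto
      show ?thesis
      proof (cases "\<exists>z\<in>Z. z \<le> p")
        case True
        then obtain z where z: "z \<in> Z" "p \<in> segment Z z" using ex_segment[OF fZ] by blast
        then have zp: "z < p" using False segment_ge[of p Z z] by (cases "z = p") auto
        \<comment> \<open>The interrupted group loses its starting point \<open>z\<close> and gains
          \<open>p\<close>, so the count stays below \<open>z\<close>, which is smaller than
          \<open>p\<close>.\<close>
        have "P \<inter> segment S p \<subseteq> P \<inter> segment Z z - {z}"
        proof
          fix r assume r: "r \<in> P \<inter> segment S p"
          then have pr: "p \<le> r" and rp: "\<And>z'. z' \<in> Z \<Longrightarrow> z' \<le> r \<Longrightarrow> z' \<le> p"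
            using ZP unfolding segment_def by blast+
          have "z' \<le> z" if "z' \<in> Z" "z' \<le> r" for z'
            using rp[OF that] that(1) z(2) unfolding segment_def by blast
          then show "r \<in> P \<inter> segment Z z - {z}" using r pr zp unfolding segment_def by auto
        qed
        then have "?R \<subseteq> insert p (P \<inter> segment Z z - {z})" using Rp by blast
        then have "card ?R \<le> card (insert p (P \<inter> segment Z z - {z}))" using P(1) by (intro card_mono) auto
        also have "\<dots> \<le> Suc (card (P \<inter> segment Z z - {z}))" by (rule card_insert_le_m1) auto
        also have "\<dots> = card (P \<inter> segment Z z)"
          by (rule card_Suc_Diff1) (use P(1,2) z self_in_segment in auto)
        also have "\<dots> < z" by (rule P(4)[OF z(1)])
        finally show ?thesis using zp by simp
      next
        case nex: False
        have "P \<inter> segment S p = {}"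
        proof (rule ccontr)
          assume "P \<inter> segment S p \<noteq> {}"
          then obtain r where r: "r \<in> P" "r \<in> segment S p" by blast
          obtain z where "z \<in> Z" "z \<le> r" using P(3)[OF r(1)] by blast
          then have "z \<le> p" using r(2) ZP unfolding segment_def by blast
          then show False using nex \<open>z \<in> Z\<close> by blast
        qed
        then have "?R \<subseteq> {p}" using Rp by blast
        then have "card ?R \<le> card {p}" by (intro card_mono) auto
        then show ?thesis using p2 by simp
      qed
    qed
    have "inner p = (\<Sum>r\<in>?R. norm (proj_c00 (segment Q r) (proj_c00 (segment S p) y)))"
      unfolding inner_def proj_c00_proj
    proof (intro sum.cong refl arg_cong[where f = norm] arg_cong2[where f = proj_c00])
      fix r assume "r \<in> ?R"
      then have "segment Q r \<subseteq> segment S p" by (intro segment_subset_segment[OF SQ]) blast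
      then show "segment Q r = segment Q r \<inter> segment S p" by blast
    qed
    also have "\<dots> \<le> 2 * norm (proj_c00 (segment S p) y)"
    proof (rule norm_successive_sum_le)
      show "finite ?R" using fQ by simp
      fix r n assume r: "r \<in> ?R" and n: "n \<in> segment Q r"
      have "p \<le> r" using r by (intro segment_ge[of r S p]) blast
      then show "card ?R < n" using card segment_ge[OF n] by linarith
      fix r' n' assume r': "r' \<in> ?R" "r < r'" "n' \<in> segment Q r'"
      then show "n < n'" using segment_less[of r' Q r n] n segment_ge[OF r'(3)] by auto
    qed
    also have "norm (proj_c00 (segment S p) y) \<le> norm (proj_c00 (segment S p) x)"
    proof (rule norm_c00_unconditional)
      fix i show "norm (coord (proj_c00 (segment S p) y) i) \<le> norm (coord (proj_c00 (segment S p) x) i)"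
        using nonneg(2)[of i] yx[of i] by simp
    qed
    finally show ?thesis by simp
  qed
  have 3: "leaves p + 1/2 * inner p \<le> norm (proj_c00 (segment S p) x)" if p: "p \<in> L" for p
  proof -
    obtain i where i: "p = Suc i" using L1[OF p] by (cases p) auto
    \<comment> \<open>The cut point \<open>Suc p\<close> closes the segment after one coordinate.
      There \<open>leaves p\<close> and the value of \<open>y\<close> together are bounded by the
      coordinate of \<open>x\<close>.\<close>
    have seg: "segment S p \<subseteq> {p}"
    proof
      fix m assume m: "m \<in> segment S p"
      have "m < Suc p" by (rule segment_less[OF SL[OF p] lessI m])
      then show "m \<in> {p}" using segment_ge[OF m] by simp
    qed
    then have "Q \<inter> segment S p = {p}" using p LP SQ self_in_segment[of p S] by blast
    then have "inner p = norm (proj_c00 (segment Q p) y)" unfolding inner_def by simp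
    also have "\<dots> \<le> (\<Sum>j\<in>{i}. norm (coord (proj_c00 (segment Q p) y) j))"
    proof (rule norm_c00_le_l1)
      have "segment Q p \<subseteq> {p}" using segment_antimono[OF SQ, of p] seg by blast
      then show "{j. coord (proj_c00 (segment Q p) y) j \<noteq> 0} \<subseteq> {i}" by (auto simp: i)
    qed simp
    also have "\<dots> \<le> coord y i" using nonneg(2)[of i] by simp
    finally have "leaves p + 1/2 * inner p \<le> coord x i" using leaf[of i, folded i] nonneg(2)[of i] by linarith
    also have "\<dots> \<le> norm (coord (proj_c00 (segment S p) x) i)"
      using self_in_segment[of p S] by (simp add: i)
    also have "\<dots> \<le> norm (proj_c00 (segment S p) x)" by (rule norm_coord_le)
    finally show ?thesis .
  qed
  have split: "(\<Sum>p\<in>S. f p) = (\<Sum>p\<in>L. f p) + (\<Sum>p\<in>S - L. f p)" for f :: "nat \<Rightarrow> real"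
    by (subst sum.subset_diff[of L S f]) (use fP LP in auto)
  have "(\<Sum>a\<leftarrow>as. coord a (n a)) + 1/2 * segment_sum P y \<le>
      (\<Sum>p\<in>L. leaves p + 1/2 * inner p) + (\<Sum>p\<in>S - L. 1/2 * inner p)"
    using 1 unfolding leaves split by (simp add: sum.distrib sum_divide_distrib[symmetric])
  also have "\<dots> \<le> (\<Sum>p\<in>L. norm (proj_c00 (segment S p) x)) + (\<Sum>p\<in>S - L. norm (proj_c00 (segment S p) x))"
    by (intro add_mono sum_mono 2 3)
  also have "\<dots> = segment_sum S x" unfolding segment_sum_def split ..
  finally show ?thesis unfolding S_def .
qed

text \<open>A vector with a leaf pays for two points, \<open>Suc (n a)\<close> and its successor.
  Neither is at most \<open>q\<close> unless the vector has a nonzero coordinate with index below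
  \<open>q\<close>.\<close>

lemma card_leaf_cut_points_le:
  assumes Z: "finite Z" and L: "L = {Suc (n a) | a. a \<in> set as \<and> coord a (n a) \<noteq> 0}"
  shows "card {p \<in> Z \<union> L \<union> Suc ` L. p \<le> q} \<le>
    card {p \<in> Z. p \<le> q} + 2 * length (filter (\<lambda>a. \<exists>i<q. coord a i \<noteq> 0) as)"
proof -
  let ?f = "filter (\<lambda>a. \<exists>i<q. coord a i \<noteq> 0) as"
  have L': "{p \<in> L. p \<le> q} \<subseteq> (\<lambda>a. Suc (n a)) ` set ?f"
  proof
    fix p assume "p \<in> {p \<in> L. p \<le> q}"
    then obtain a where "a \<in> set as" "coord a (n a) \<noteq> 0" "p = Suc (n a)" "p \<le> q" unfolding L by blast
    then show "p \<in> (\<lambda>a. Suc (n a)) ` set ?f" by (intro image_eqI[of _ _ a]) (auto simp: Suc_le_eq)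
  qed
  have fL: "finite {p \<in> L. p \<le> q}" by (rule finite_subset[OF L']) simp
  have "card {p \<in> L. p \<le> q} \<le> card ((\<lambda>a. Suc (n a)) ` set ?f)" by (rule card_mono[OF _ L']) simp
  also have "\<dots> \<le> length ?f" by (meson card_image_le card_length List.finite_set order_trans)
  finally have 1: "card {p \<in> L. p \<le> q} \<le> length ?f" .
  have "card {p \<in> Z \<union> L \<union> Suc ` L. p \<le> q} \<le> card ({p \<in> Z. p \<le> q} \<union> {p \<in> L. p \<le> q} \<union> Suc ` {p \<in> L. p \<le> q})"
    by (rule card_mono) (use Z fL in auto)
  also have "\<dots> \<le> card {p \<in> Z. p \<le> q} + card {p \<in> L. p \<le> q} + card (Suc ` {p \<in> L. p \<le> q})"
    by (meson card_Un_le add_le_mono1 order_trans)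
  also have "card (Suc ` {p \<in> L. p \<le> q}) \<le> card {p \<in> L. p \<le> q}" by (rule card_image_le[OF fL])
  finally show ?thesis using 1 by linarith
qed

section \<open>Induction on the depth of the norming trees\<close>

lemma length_filter_mono: "(\<And>x. x \<in> set xs \<Longrightarrow> P x \<Longrightarrow> Q x) \<Longrightarrow> length (filter P xs) \<le> length (filter Q xs)"
  by (induction xs) (auto simp: le_SucI)

lemma sum_list_filter_split:
  "(\<Sum>a\<leftarrow>as. f a) = (\<Sum>a\<leftarrow>filter P as. f a) + (\<Sum>a\<leftarrow>filter (\<lambda>a. \<not> P a) as. f a)"
  for f :: "'a \<Rightarrow> 'b::comm_monoid_add"
  by (induction as) (simp_all add: ac_simps)

lemma length_filter_split:
  "length (filter Q as) = length (filter Q (filter P as)) + length (filter Q (filter (\<lambda>a. \<not> P a) as))"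
  by (induction as) auto

lemma coord_sum_list: "coord (sum_list as) i = (\<Sum>a\<leftarrow>as. coord a i)"
  by (induction as) auto

lemma admissible_coord_sum_le:
  fixes a :: "real c00"
  assumes "tsirelson_admissible k E" "\<And>i. 0 \<le> coord a i"
  shows "(\<Sum>j\<leftarrow>[1..<Suc k]. coord (proj_c00 (E j) a) i) \<le> coord a i"
proof -
  let ?J = "{j \<in> {1..k}. Suc i \<in> E j}"
  have "(\<Sum>j\<leftarrow>[1..<Suc k]. coord (proj_c00 (E j) a) i) = (\<Sum>j\<in>{1..k}. if Suc i \<in> E j then coord a i else 0)"
    by (simp add: interv_sum_list_conv_sum_set_nat atLeastLessThanSuc_atLeastAtMost del: upt_Suc)
  also have "\<dots> = (\<Sum>j\<in>?J. coord a i)"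
    by (rule sum.mono_neutral_cong_right) auto
  also have "\<dots> = real (card ?J) * coord a i" by simp
  also have "\<dots> \<le> 1 * coord a i"
  proof (rule mult_right_mono)
    have "card ?J \<le> Suc 0"
      by (subst card_le_Suc0_iff_eq) (use admissible_disjoint[OF assms(1)] in auto)
    then show "real (card ?J) \<le> 1" by simp
  qed (rule assms(2))
  finally show ?thesis by simp
qed

text \<open>
  The bound on the number of cut points up to every \<open>q\<close> keeps the pieces far enough to the right
  to be grouped at the next level of the norming trees.
\<close>

lemma tsirelson_iter_segment_bound:
  fixes as :: "real c00 list"
  assumes "\<And>a i. a \<in> set as \<Longrightarrow> 0 \<le> coord a i" "\<And>i. (\<Sum>a\<leftarrow>as. coord a i) \<le> coord x i"
  shows "\<exists>P. finite P \<and> (\<Sum>a\<leftarrow>as. tsirelson_iter m a) \<le> segment_sum P x \<and>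
    (\<forall>q. card {p \<in> P. p \<le> q} \<le> 2 * length (filter (\<lambda>a. \<exists>i<q. coord a i \<noteq> 0) as))"
  using assms
proof (induction m arbitrary: as x)
  case 0
  have "\<exists>i. sup_c00 a = norm (coord a i)" for a :: "real c00" using sup_c00_attained[of a] by blast
  then obtain n where n: "\<And>a :: real c00. sup_c00 a = norm (coord a (n a))" by metis
  define L where "L = {Suc (n a) | a. a \<in> set as \<and> coord a (n a) \<noteq> 0}"
  have "(\<Sum>a\<leftarrow>as. tsirelson_iter 0 a) = (\<Sum>a\<leftarrow>as. coord a (n a))"
    using 0(1) n by (intro arg_cong[where f = sum_list] map_cong) (auto simp: tsirelson_iter_0)
  \<comment> \<open>At depth 0 every node is a leaf, so the sum \<open>y\<close> of the inner
    vectors is 0 and there are no earlier cut points.\<close>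
  also have "\<dots> \<le> segment_sum ({} \<union> L \<union> Suc ` L) x"
    using segment_sum_with_leaves[of as 0 x "{}" "{}" L n] 0 L_def by (simp add: segment_sum_def)
  finally have "(\<Sum>a\<leftarrow>as. tsirelson_iter 0 a) \<le> segment_sum ({} \<union> L \<union> Suc ` L) x" .
  moreover have "L \<subseteq> (\<lambda>a. Suc (n a)) ` set as" unfolding L_def by blast
  then have "finite L" by (rule finite_subset) simp
  ultimately show ?case
    using card_leaf_cut_points_le[OF finite.emptyI L_def] by (intro exI[of _ "{} \<union> L \<union> Suc ` L"]) auto
next
  case (Suc m)
  let ?begun = "\<lambda>q a. \<exists>i<q. coord a i \<noteq> 0"
  define leafy where "leafy a \<longleftrightarrow> (\<exists>i. tsirelson_iter (Suc m) a = norm (coord a i))" for a :: "real c00"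
  define as1 where "as1 = filter leafy as"
  define as2 where "as2 = filter (\<lambda>a. \<not> leafy a) as"
  define n where "n a = (SOME i. tsirelson_iter (Suc m) a = norm (coord a i))" for a :: "real c00"
  have n: "tsirelson_iter (Suc m) a = norm (coord a (n a))" if "leafy a" for a
    using someI_ex[OF that[unfolded leafy_def]] unfolding n_def .
  have "\<exists>k E. \<not> leafy a \<longrightarrow> tsirelson_admissible k E \<and>
      tsirelson_iter (Suc m) a = 1/2 * (\<Sum>j=1..k. tsirelson_iter m (proj_c00 (E j) a))" for a
    by (cases rule: tsirelson_rhs_cases[OF seminorm_tsirelson_iter, of m a])
      (auto simp: leafy_def tsirelson_iter_Suc)
  then obtain k E where kE: "\<And>a. \<not> leafy a \<Longrightarrow> tsirelson_admissible (k a) (E a)"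
    "\<And>a. \<not> leafy a \<Longrightarrow> tsirelson_iter (Suc m) a = 1/2 * (\<Sum>j=1..k a. tsirelson_iter m (proj_c00 (E a j) a))"
    by metis
  define children where "children a = map (\<lambda>j. proj_c00 (E a j) a) [1..<Suc (k a)]" for a
  define cs where "cs = concat (map children as2)"
  define y where "y = sum_list as2"
  have nonneg1: "0 \<le> coord a i" if "a \<in> set as1" for a i using Suc.prems(1)[of a i] that by (simp add: as1_def)
  have nonneg2: "0 \<le> coord a i" if "a \<in> set as2" for a i using Suc.prems(1)[of a i] that by (simp add: as2_def)
  have y: "coord y i = (\<Sum>a\<leftarrow>as2. coord a i)" for i by (simp add: y_def coord_sum_list)
  have y0: "0 \<le> coord y i" for i unfolding y by (rule sum_list_nonneg) (use nonneg2 in auto)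
  have adm: "tsirelson_admissible (k a) (E a)" if "a \<in> set as2" for a
    using kE(1)[of a] that by (simp add: as2_def)
  have "\<exists>P. finite P \<and> (\<Sum>c\<leftarrow>cs. tsirelson_iter m c) \<le> segment_sum P y \<and>
    (\<forall>q. card {p \<in> P. p \<le> q} \<le> 2 * length (filter (?begun q) cs))"
  proof (rule Suc.IH)
    fix c i assume "c \<in> set cs"
    then show "0 \<le> coord c i" using nonneg2 by (auto simp: cs_def children_def simp del: upt_Suc)
  next
    fix i
    have "(\<Sum>c\<leftarrow>cs. coord c i) = (\<Sum>a\<leftarrow>as2. \<Sum>c\<leftarrow>children a. coord c i)"
      unfolding cs_def by (induction as2) simp_all
    also have "\<dots> \<le> (\<Sum>a\<leftarrow>as2. coord a i)"
    proof (rule sum_list_mono)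
      fix a assume a: "a \<in> set as2"
      show "(\<Sum>c\<leftarrow>children a. coord c i) \<le> coord a i"
        using admissible_coord_sum_le[OF adm[OF a] nonneg2[OF a], of i]
        by (simp add: children_def o_def del: upt_Suc coord_simps)
    qed
    finally show "(\<Sum>c\<leftarrow>cs. coord c i) \<le> coord y i" unfolding y .
  qed
  then obtain P where P: "finite P" "(\<Sum>c\<leftarrow>cs. tsirelson_iter m c) \<le> segment_sum P y"
    "\<And>q. card {p \<in> P. p \<le> q} \<le> 2 * length (filter (?begun q) cs)" by blast
  \<comment> \<open>All nonzero children of \<open>a\<close> live on coordinate numbers greater than
    \<open>k a\<close>, and \<open>s a\<close> is the first such number in the support of
    \<open>a\<close>; the \<open>Suc\<close> turns an index into a coordinate number. If
    \<open>far a\<close> fails, the children vanish and the \<open>LEAST\<close> has no meaning, so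
    such vectors are left out of \<open>ss\<close>.\<close>
  define far where "far a \<longleftrightarrow> (\<exists>i. k a \<le> i \<and> coord a i \<noteq> 0)" for a
  define s where "s a = Suc (LEAST i. k a \<le> i \<and> coord a i \<noteq> 0)" for a
  define ss where "ss = map (\<lambda>a. (k a, s a)) (filter far as2)"
  have s: "k a < s a" "\<And>q. s a \<le> q \<Longrightarrow> ?begun q a" if "far a" for a
    using LeastI_ex[OF that[unfolded far_def]] unfolding s_def by (auto simp: Suc_le_eq)
  \<comment> \<open>No child of \<open>a\<close> begins before \<open>s a\<close>, and there are
    \<open>k a\<close> of them. This is the counting hypothesis of the grouping.\<close>
  have count: "length (filter (?begun q) cs) \<le> (\<Sum>(k, s)\<leftarrow>ss. if s \<le> q then k else 0)" for q
  proof -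
    have "length (filter (?begun q) cs) = (\<Sum>a\<leftarrow>as2. length (filter (?begun q) (children a)))"
      unfolding cs_def by (induction as2) simp_all
    also have "\<dots> \<le> (\<Sum>a\<leftarrow>as2. if far a then if s a \<le> q then k a else 0 else 0)"
    proof (rule sum_list_mono)
      fix a assume a: "a \<in> set as2"
      show "length (filter (?begun q) (children a)) \<le> (if far a then if s a \<le> q then k a else 0 else 0)"
      proof (cases "\<exists>c\<in>set (children a). ?begun q c")
        case True
        then obtain j i where j: "j \<in> {1..k a}" "i < q" "Suc i \<in> E a j" "coord a i \<noteq> 0"
          by (auto simp: children_def less_Suc_eq_le split: if_splits simp del: upt_Suc)
        have "k a < Suc i"
          using adm[OF a] j set_before_less[of "{k a}" "E a j" "k a" "Suc i"]
          unfolding tsirelson_admissible_def by simp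
        then have i: "k a \<le> i \<and> coord a i \<noteq> 0" using j by simp
        then have "far a" by (auto simp: far_def)
        moreover have "s a \<le> q" using Least_le[of "\<lambda>i. k a \<le> i \<and> coord a i \<noteq> 0", OF i] j(2) by (simp add: s_def)
        moreover have "length (filter (?begun q) (children a)) \<le> k a"
          using length_filter_le[of "?begun q" "children a"] by (simp add: children_def del: upt_Suc)
        ultimately show ?thesis by simp
      next
        case False
        then have "filter (?begun q) (children a) = []" by (simp only: filter_empty_conv) blast
        then show ?thesis by simp
      qed
    qed
    also have "\<dots> = (\<Sum>(k, s)\<leftarrow>ss. if s \<le> q then k else 0)"
      by (simp add: ss_def o_def sum_list_map_filter')
    finally show ?thesis .
  qed
  obtain Z where Z: "Z \<subseteq> P" "\<And>q. card {z \<in> Z. z \<le> q} \<le> 2 * length (filter (\<lambda>(k, s). s \<le> q) ss)"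
    "\<And>p. p \<in> P \<Longrightarrow> \<exists>z\<in>Z. z \<le> p" "\<And>z. z \<in> Z \<Longrightarrow> card (P \<inter> segment Z z) < z"
  proof (rule group_cut_points[OF _ P(1)])
    show "\<forall>(k, s)\<in>set ss. k < s" using s(1) by (auto simp: ss_def)
    show "card {p \<in> P. p \<le> q} \<le> 2 * (\<Sum>(k, s)\<leftarrow>ss. if s \<le> q then k else 0)" for q
      using P(3)[of q] count[of q] by linarith
  qed blast
  have fZ: "finite Z" using Z(1) P(1) finite_subset by blast
  define L where "L = {Suc (n a) | a. a \<in> set as1 \<and> coord a (n a) \<noteq> 0}"
  have "L \<subseteq> (\<lambda>a. Suc (n a)) ` set as1" unfolding L_def by blast
  then have fL: "finite L" by (rule finite_subset) simp
  have "(\<Sum>a\<leftarrow>as1. coord a (n a)) + 1/2 * segment_sum P y \<le> segment_sum (Z \<union> L \<union> Suc ` L) x"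
  proof (rule segment_sum_with_leaves[OF nonneg1 y0 _ P(1) Z(1,3,4) L_def])
    fix i
    show "(\<Sum>a\<leftarrow>as1. coord a i) + coord y i \<le> coord x i"
      using Suc.prems(2)[of i] sum_list_filter_split[of "\<lambda>a. coord a i" as leafy]
      by (simp add: y as1_def as2_def)
  qed
  moreover have "(\<Sum>a\<leftarrow>as1. tsirelson_iter (Suc m) a) = (\<Sum>a\<leftarrow>as1. coord a (n a))"
    using n nonneg1 by (intro arg_cong[where f = sum_list] map_cong refl) (auto simp: as1_def)
  moreover have "(\<Sum>a\<leftarrow>as2. tsirelson_iter (Suc m) a) = 1/2 * (\<Sum>c\<leftarrow>cs. tsirelson_iter m c)"
  proof -
    have "(\<Sum>a\<leftarrow>as2. tsirelson_iter (Suc m) a) = (\<Sum>a\<leftarrow>as2. 1/2 * (\<Sum>c\<leftarrow>children a. tsirelson_iter m c))"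
      by (intro arg_cong[where f = sum_list] map_cong refl)
        (simp add: kE(2) as2_def children_def o_def interv_sum_list_conv_sum_set_nat
          atLeastLessThanSuc_atLeastAtMost del: upt_Suc)
    also have "\<dots> = 1/2 * (\<Sum>c\<leftarrow>cs. tsirelson_iter m c)"
      unfolding cs_def by (induction as2) simp_all
    finally show ?thesis .
  qed
  moreover have "(\<Sum>a\<leftarrow>as. tsirelson_iter (Suc m) a) =
      (\<Sum>a\<leftarrow>as1. tsirelson_iter (Suc m) a) + (\<Sum>a\<leftarrow>as2. tsirelson_iter (Suc m) a)"
    unfolding as1_def as2_def by (rule sum_list_filter_split)
  ultimately have "(\<Sum>a\<leftarrow>as. tsirelson_iter (Suc m) a) \<le> segment_sum (Z \<union> L \<union> Suc ` L) x"
    using P(2) by linarith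
  moreover have "card {p \<in> Z \<union> L \<union> Suc ` L. p \<le> q} \<le> 2 * length (filter (?begun q) as)" for q
  proof -
    have "length (filter (\<lambda>(k, s). s \<le> q) ss) = length (filter (\<lambda>a. far a \<and> s a \<le> q) as2)"
      by (simp add: ss_def filter_map o_def conj_commute)
    also have "\<dots> \<le> length (filter (?begun q) as2)"
      by (rule length_filter_mono) (use s(2) in blast)
    finally have "card {z \<in> Z. z \<le> q} \<le> 2 * length (filter (?begun q) as2)" using Z(2)[of q] by linarith
    then show ?thesis
      using card_leaf_cut_points_le[OF fZ L_def, of q] length_filter_split[of "?begun q" as leafy]
      unfolding as1_def as2_def by linarith
  qed
  ultimately show ?case using fZ fL by (intro exI[of _ "Z \<union> L \<union> Suc ` L"]) simp
qed

text \<open>There are at most twice as many pieces as vectors, and taking \<open>q\<close> to be the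
  length shows that all of them start beyond it. Hence the pieces form two families of at most
  \<open>length as\<close> members, each of them admissible, which gives 2 + 2. The bound is
  independent of the depth \<open>m\<close> and passes to the limit.\<close>

lemma norm_sum_le_beyond_length:
  fixes as :: "real c00 list"
  assumes nonneg: "\<And>a i. a \<in> set as \<Longrightarrow> 0 \<le> coord a i" and le: "\<And>i. (\<Sum>a\<leftarrow>as. coord a i) \<le> coord x i"
    and far: "\<And>a i. a \<in> set as \<Longrightarrow> coord a i \<noteq> 0 \<Longrightarrow> length as \<le> i"
  shows "(\<Sum>a\<leftarrow>as. norm a) \<le> 4 * norm x"
proof -
  let ?n = "length as"
  have "(\<Sum>a\<leftarrow>as. tsirelson_iter m a) \<le> 4 * norm x" for m
  proof -
    obtain P where P: "finite P" "(\<Sum>a\<leftarrow>as. tsirelson_iter m a) \<le> segment_sum P x"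
      "\<And>q. card {p \<in> P. p \<le> q} \<le> 2 * length (filter (\<lambda>a. \<exists>i<q. coord a i \<noteq> 0) as)"
      using tsirelson_iter_segment_bound[OF nonneg le, of m] by blast
    have "filter (\<lambda>a. \<exists>i<?n. coord a i \<noteq> 0) as = []"
      unfolding filter_empty_conv using far leD by blast
    then have "card {p \<in> P. p \<le> ?n} = 0" using P(3)[of ?n] by simp
    then have big: "?n < p" if "p \<in> P" for p using that P(1) by (force simp: not_le)
    have "card P = card {p \<in> P. p \<le> Max (insert 0 P)}" using P(1) by (intro arg_cong[where f = card]) auto
    also have "\<dots> \<le> 2 * ?n"
      using P(3)[of "Max (insert 0 P)"] length_filter_le[of "\<lambda>a. \<exists>i<Max (insert 0 P). coord a i \<noteq> 0" as] by linarith
    finally have cP: "card P \<le> 2 * ?n" .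
    obtain t where t: "card {p \<in> P. p < t} = min ?n (card P)" using ex_initial_part[OF P(1)] by blast
    let ?A = "{p \<in> P. p < t}"
    have part: "(\<Sum>p\<in>R. norm (proj_c00 (segment P p) x)) \<le> 2 * norm x" if R: "R \<subseteq> P" "card R \<le> ?n" for R
    proof (rule norm_successive_sum_le)
      show "finite R" using R P(1) finite_subset by blast
      fix r n assume r: "r \<in> R" "n \<in> segment P r"
      show "card R < n" using big[of r] r R segment_ge[OF r(2)] by auto
      fix r' n' assume r': "r' \<in> R" "r < r'" "n' \<in> segment P r'"
      show "n < n'" using segment_less[of r' P r n] r r' R segment_ge[OF r'(3)] by auto
    qed
    have "card (P - ?A) = card P - card ?A" by (rule card_Diff_subset) (use P(1) in auto)
    then have "card (P - ?A) \<le> ?n" using t cP by linarith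
    then have "(\<Sum>p\<in>P - ?A. norm (proj_c00 (segment P p) x)) \<le> 2 * norm x" by (intro part) auto
    moreover have "(\<Sum>p\<in>?A. norm (proj_c00 (segment P p) x)) \<le> 2 * norm x" by (intro part) (use t in auto)
    moreover have "segment_sum P x = (\<Sum>p\<in>P - ?A. norm (proj_c00 (segment P p) x)) + (\<Sum>p\<in>?A. norm (proj_c00 (segment P p) x))"
      unfolding segment_sum_def by (rule sum.subset_diff) (use P(1) in auto)
    ultimately show ?thesis using P(2) by linarith
  qed
  moreover have "(\<lambda>m. \<Sum>a\<leftarrow>as. tsirelson_iter m a) \<longlonglongrightarrow> (\<Sum>a\<leftarrow>as. norm a)"
    by (induction as) (auto intro!: tendsto_intros tsirelson_iter_tendsto_norm)
  ultimately show ?thesis by (intro LIMSEQ_le_const2) auto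
qed

text \<open>The constant is 4 for the part beyond 2^K plus 1 + 2K for the coordinates before it. On
  the latter the norms are replaced by l_1 norms, which are additive on nonnegative vectors.\<close>

proposition tsirelson_lower_estimate:
  fixes as :: "real c00 list"
  assumes nonneg: "\<And>a i. a \<in> set as \<Longrightarrow> 0 \<le> coord a i" and le: "\<And>i. (\<Sum>a\<leftarrow>as. coord a i) \<le> coord x i"
    and K: "length as \<le> 2 ^ K"
  shows "(\<Sum>a\<leftarrow>as. norm a) \<le> (5 + 2 * real K) * norm x"
proof -
  let ?T = "{Suc (2 ^ K)..}"
  have "norm a \<le> (\<Sum>i<2 ^ K. coord a i) + norm (proj_c00 ?T a)" if a: "a \<in> set as" for a
  proof -
    have "a = proj_c00 (- ?T) a + proj_c00 ?T a" by (rule c00_eqI) simp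
    then have "norm a \<le> norm (proj_c00 (- ?T) a) + norm (proj_c00 ?T a)" by (metis norm_triangle_ineq)
    moreover have "norm (proj_c00 (- ?T) a) \<le> (\<Sum>i<2 ^ K. norm (coord (proj_c00 (- ?T) a) i))"
      by (rule norm_c00_le_l1) (auto split: if_splits)
    moreover have "\<dots> = (\<Sum>i<2 ^ K. coord a i)" using nonneg[OF a] by (intro sum.cong) auto
    ultimately show ?thesis by linarith
  qed
  then have "(\<Sum>a\<leftarrow>as. norm a) \<le> (\<Sum>a\<leftarrow>as. (\<Sum>i<2 ^ K. coord a i) + norm (proj_c00 ?T a))" by (rule sum_list_mono)
  also have "\<dots> = (\<Sum>i<2 ^ K. \<Sum>a\<leftarrow>as. coord a i) + (\<Sum>a\<leftarrow>map (proj_c00 ?T) as. norm a)"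
    by (simp add: sum_list_addf sum_list_sum_swap o_def)
  also have "(\<Sum>a\<leftarrow>map (proj_c00 ?T) as. norm a) \<le> 4 * norm (proj_c00 ?T x)"
  proof (rule norm_sum_le_beyond_length)
    fix i
    show "(\<Sum>a\<leftarrow>map (proj_c00 ?T) as. coord a i) \<le> coord (proj_c00 ?T x) i" using le[of i] by (simp add: o_def)
  qed (use nonneg K in \<open>auto split: if_splits\<close>)
  also have "norm (proj_c00 ?T x) \<le> norm x" by (rule norm_proj_c00_le)
  also have "(\<Sum>i<2 ^ K. \<Sum>a\<leftarrow>as. coord a i) \<le> (\<Sum>i<2 ^ K. \<bar>coord x i\<bar>)"
    by (rule sum_mono) (rule order_trans[OF le abs_ge_self])
  also have "\<dots> \<le> (1 + 2 * real K) * norm x" by (rule sum_coord_lessThan_power2_le)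
  finally show ?thesis by (simp add: algebra_simps)
qed

section \<open>Vectors of small norm and large mass\<close>

definition mass_c00 :: "real c00 \<Rightarrow> real" where
  "mass_c00 x = (\<Sum>i | coord x i \<noteq> 0. coord x i)"

lemma mass_c00_eq: "finite S \<Longrightarrow> {i. coord x i \<noteq> 0} \<subseteq> S \<Longrightarrow> mass_c00 x = (\<Sum>i\<in>S. coord x i)"
  unfolding mass_c00_def by (rule sum.mono_neutral_left) auto

lemma mass_c00_add: "mass_c00 (x + y) = mass_c00 x + mass_c00 y"
proof -
  let ?S = "{i. coord x i \<noteq> 0} \<union> {i. coord y i \<noteq> 0}"
  have "mass_c00 x = (\<Sum>i\<in>?S. coord x i)" "mass_c00 y = (\<Sum>i\<in>?S. coord y i)"
    "mass_c00 (x + y) = (\<Sum>i\<in>?S. coord (x + y) i)"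
    by (rule mass_c00_eq; auto)+
  then show ?thesis by (simp add: sum.distrib)
qed

lemma mass_c00_scaleR: "mass_c00 (c *\<^sub>R x) = c * mass_c00 x"
  using mass_c00_eq[of "{i. coord x i \<noteq> 0}" "c *\<^sub>R x"] by (auto simp: mass_c00_def sum_distrib_left)

lemma mass_c00_sum: "mass_c00 (\<Sum>i\<in>I. f i) = (\<Sum>i\<in>I. mass_c00 (f i))"
  by (induction I rule: infinite_finite_induct) (simp_all add: mass_c00_add mass_c00_def[of 0])

text \<open>The starting point \<open>p\<close> is arbitrary so that such vectors can be placed one
  behind another.\<close>

definition small_mass_vectors :: "real \<Rightarrow> bool" where
  "small_mass_vectors \<theta> \<longleftrightarrow> (\<forall>p. \<exists>a. (\<forall>i. 0 \<le> coord a i) \<and> (\<forall>i. coord a i \<noteq> 0 \<longrightarrow> p \<le> i) \<and>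
     mass_c00 a = 1 \<and> norm a \<le> \<theta>)"

text \<open>Both families are successive, so the meeting pairs form a staircase: when
  \<open>i\<close> increases, \<open>j\<close> does not decrease. Hence \<open>i + j\<close> is
  injective on them, and it takes values below \<open>r + k\<close>.\<close>

lemma card_meeting_pairs_le:
  assumes E: "tsirelson_admissible k E"
    and succ: "\<And>i i' l l'. i < i' \<Longrightarrow> coord (x i) l \<noteq> 0 \<Longrightarrow> coord (x i') l' \<noteq> 0 \<Longrightarrow> l < l'"
  shows "card {(i, j) \<in> {..<r} \<times> {1..k}. proj_c00 (E j) (x i) \<noteq> 0} \<le> r + k"
proof -
  let ?C = "{(i, j) \<in> {..<r} \<times> {1..k}. proj_c00 (E j) (x i) \<noteq> 0}"
  have meet: "\<exists>l. Suc l \<in> E j \<and> coord (x i) l \<noteq> 0" if "(i, j) \<in> ?C" for i j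
  proof (rule ccontr)
    assume "\<nexists>l. Suc l \<in> E j \<and> coord (x i) l \<noteq> 0"
    then have "proj_c00 (E j) (x i) = 0" by (intro c00_eqI) auto
    then show False using that by simp
  qed
  have mono: "j \<le> j'" if C: "(i, j) \<in> ?C" "(i', j') \<in> ?C" and i: "i < i'" for i j i' j'
  proof (rule ccontr)
    assume "\<not> j \<le> j'"
    then have "E j' \<lless> E j" "finite (E j)" "finite (E j')"
      using E C unfolding tsirelson_admissible_def by auto
    moreover obtain l where l: "Suc l \<in> E j" "coord (x i) l \<noteq> 0" using meet[OF C(1)] by blast
    moreover obtain l' where l': "Suc l' \<in> E j'" "coord (x i') l' \<noteq> 0" using meet[OF C(2)] by blast
    ultimately have "Suc l' < Suc l" by (intro set_before_less[of "E j'" "E j"])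
    moreover have "l < l'" by (rule succ[OF i l(2) l'(2)])
    ultimately show False by simp
  qed
  have "inj_on (\<lambda>(i, j). i + j) ?C"
  proof (rule inj_onI)
    fix c c' assume C: "c \<in> ?C" "c' \<in> ?C" and eq: "(case c of (i, j) \<Rightarrow> i + j) = (case c' of (i, j) \<Rightarrow> i + j)"
    obtain i j i' j' where c: "c = (i, j)" "c' = (i', j')" by fastforce
    show "c = c'"
      using mono[of i j i' j'] mono[of i' j' i j] C eq unfolding c
      by (cases i i' rule: linorder_cases) simp_all
  qed
  moreover have "(\<lambda>(i, j). i + j) ` ?C \<subseteq> {..<r + k}" by auto
  ultimately have "card ?C \<le> card {..<r + k}" by (intro card_inj_on_le) auto
  then show ?thesis by simp
qed

text \<open>
  As in the theorem of Figiel and Johnson: after a vector \<open>x\<^sub>0\<close> put the average of many vectors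
  \<open>x\<^sub>1, \<dots>, x\<^sub>r\<close>. A family that meets \<open>x\<^sub>0\<close> has few members, so it hardly splits the \<open>x\<^sub>i\<close>.
\<close>

lemma small_mass_vectors_step:
  assumes "small_mass_vectors \<theta>" shows "small_mass_vectors (7/8 * \<theta>)"
  unfolding small_mass_vectors_def
proof
  fix p
  obtain f where f: "\<And>p i. 0 \<le> coord (f p) i" "\<And>p i. coord (f p) i \<noteq> 0 \<Longrightarrow> p \<le> i"
    "\<And>p. mass_c00 (f p) = 1" "\<And>p. norm (f p) \<le> \<theta>"
    using assms unfolding small_mass_vectors_def by metis
  have \<theta>: "0 \<le> \<theta>" using f(4)[of 0] norm_ge_zero order_trans by blast
  have "\<exists>b. \<forall>i. coord (f p) i \<noteq> 0 \<longrightarrow> Suc i \<le> b" for p using c00_bounded_support[of "f p"] by metis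
  then obtain b where b: "\<And>p i. coord (f p) i \<noteq> 0 \<Longrightarrow> Suc i \<le> b p" by metis
  define M where "M = Suc (b p)"
  define s where "s i = ((\<lambda>q. max q (b q)) ^^ i) M" for i
  define x where "x i = f (s i)" for i
  \<comment> \<open>With this choice \<open>(r + k) / r\<close> is at most 3/2 whenever
    \<open>k < M\<close>. An admissible family then has sum at most 2 \<theta> + 3/2 \<theta>, so
    \<open>z\<close> has norm at most 7/4 \<theta>. Its mass is 2, and halving it produces the
    factor 7/8.\<close>
  define r where "r = 2 * M"
  have s_Suc: "s (Suc i) = max (s i) (b (s i))" for i by (simp add: s_def)
  have s_mono: "s i \<le> s i'" if "i \<le> i'" for i i'
    by (rule lift_Suc_mono_le[OF _ that]) (simp add: s_Suc)
  have x_ge: "s i \<le> l" if "coord (x i) l \<noteq> 0" for i l using f(2) that by (simp add: x_def)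
  have x_less: "l < s (Suc i)" if "coord (x i) l \<noteq> 0" for i l
    using b[of "s i" l] that by (simp add: x_def s_Suc)
  have succ: "l < l'" if "i < i'" "coord (x i) l \<noteq> 0" "coord (x i') l' \<noteq> 0" for i i' l l'
    using x_less[OF that(2)] x_ge[OF that(3)] s_mono[of "Suc i" i'] that(1) by simp
  have M_le: "M \<le> l" if "coord (x i) l \<noteq> 0" for i l
    using x_ge[OF that] s_mono[of 0 i] by (simp add: s_def)
  have less_M: "l < M" if "coord (f p) l \<noteq> 0" for l using b[OF that] by (simp add: M_def)
  have r: "0 < real r" by (simp add: r_def M_def)
  define z where "z = f p + (1 / real r) *\<^sub>R (\<Sum>i<r. x i)"
  have nx: "norm (x i) \<le> \<theta>" for i using f(4) by (simp add: x_def)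
  have z: "coord z l = coord (f p) l + (\<Sum>i<r. coord (x i) l) / real r" for l
    by (simp add: z_def coord_sum)
  have xnn: "0 \<le> coord (x i) l" for i l using f(1) by (simp add: x_def)
  have "norm z \<le> 7/4 * \<theta>"
    unfolding norm_c00_eq_rhs[of z]
  proof (rule tsirelson_rhs_le)
    show "sup_c00 z \<le> 7/4 * \<theta>"
    proof (rule sup_c00_le)
      fix l
      have "norm (coord z l) \<le> \<theta>"
      proof (cases "l < M")
        case True
        then have "coord (x i) l = 0" for i using M_le[of i l] by force
        then show ?thesis using norm_coord_le[of "f p" l] f(4)[of p] by (simp add: z)
      next
        case False
        then have "coord (f p) l = 0" using less_M by blast
        moreover have "(\<Sum>i<r. coord (x i) l) \<le> (\<Sum>i<r. \<theta>)"
        proof (rule sum_mono)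
          fix i show "coord (x i) l \<le> \<theta>"
            using norm_coord_le[of "x i" l] nx[of i] abs_ge_self[of "coord (x i) l"] by simp
        qed
        moreover have "0 \<le> (\<Sum>i<r. coord (x i) l)" by (rule sum_nonneg) (rule xnn)
        ultimately show ?thesis using r by (simp add: z divide_le_eq mult.commute)
      qed
      then show "norm (coord z l) \<le> 7/4 * \<theta>" using \<theta> by linarith
    qed
  next
    fix k E assume E: "tsirelson_admissible k E"
    let ?X = "\<Sum>j=1..k. \<Sum>i<r. norm (proj_c00 (E j) (x i))"
    have "norm (proj_c00 (E j) z) \<le>
        norm (proj_c00 (E j) (f p)) + (\<Sum>i<r. norm (proj_c00 (E j) (x i))) / real r" for j
    proof -
      have "proj_c00 (E j) z = proj_c00 (E j) (f p) + (1 / real r) *\<^sub>R (\<Sum>i<r. proj_c00 (E j) (x i))"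
        by (rule c00_eqI) (auto simp: z coord_sum)
      also have "norm \<dots> \<le> norm (proj_c00 (E j) (f p)) + norm ((1 / real r) *\<^sub>R (\<Sum>i<r. proj_c00 (E j) (x i)))"
        by (rule norm_triangle_ineq)
      also have "norm ((1 / real r) *\<^sub>R (\<Sum>i<r. proj_c00 (E j) (x i))) \<le>
          (\<Sum>i<r. norm (proj_c00 (E j) (x i))) / real r"
        using norm_sum[of "\<lambda>i. proj_c00 (E j) (x i)" "{..<r}"] r by (simp add: divide_right_mono)
      finally show ?thesis by simp
    qed
    then have "(\<Sum>j=1..k. norm (proj_c00 (E j) z)) \<le>
        (\<Sum>j=1..k. norm (proj_c00 (E j) (f p)) + (\<Sum>i<r. norm (proj_c00 (E j) (x i))) / real r)"
      by (intro sum_mono)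
    also have "\<dots> = (\<Sum>j=1..k. norm (proj_c00 (E j) (f p))) + ?X / real r"
      by (simp add: sum.distrib sum_divide_distrib)
    also have "\<dots> \<le> 7/2 * \<theta>"
    proof (cases "M \<le> k")
      case True
      \<comment> \<open>All sets of the family lie beyond \<open>k\<close>, hence beyond the support
        of \<open>f p\<close>, which ends before \<open>M\<close>.\<close>
      have "proj_c00 (E j) (f p) = 0" if j: "j \<in> {1..k}" for j
      proof (rule c00_eqI)
        fix l
        have "k < Suc l" if "Suc l \<in> E j"
          using E j that set_before_less[of "{k}" "E j" k "Suc l"]
          unfolding tsirelson_admissible_def by simp
        then have "coord (f p) l = 0" if "Suc l \<in> E j" using less_M[of l] True that by force
        then show "coord (proj_c00 (E j) (f p)) l = coord 0 l" by simp
      qed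
      then have "(\<Sum>j=1..k. norm (proj_c00 (E j) (f p))) = 0" by simp
      moreover have "?X \<le> real r * (2 * \<theta>)"
      proof -
        have "?X = (\<Sum>i<r. \<Sum>j=1..k. norm (proj_c00 (E j) (x i)))" by (rule sum.swap)
        also have "\<dots> \<le> (\<Sum>i<r. 2 * \<theta>)"
          by (rule sum_mono) (rule order_trans[OF admissible_norm_sum_le[OF E]], use nx in simp)
        finally show ?thesis by simp
      qed
      then have "?X / real r \<le> 2 * \<theta>" using r by (simp add: divide_le_eq mult.commute)
      ultimately show ?thesis using \<theta> by linarith
    next
      case False
      let ?C = "{(i, j) \<in> {..<r} \<times> {1..k}. proj_c00 (E j) (x i) \<noteq> 0}"
      have "?X = (\<Sum>i<r. \<Sum>j=1..k. norm (proj_c00 (E j) (x i)))" by (rule sum.swap)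
      also have "\<dots> = (\<Sum>(i, j)\<in>{..<r} \<times> {1..k}. norm (proj_c00 (E j) (x i)))"
        by (simp add: sum.cartesian_product)
      also have "\<dots> = (\<Sum>(i, j)\<in>?C. norm (proj_c00 (E j) (x i)))"
        by (rule sum.mono_neutral_right) auto
      also have "\<dots> \<le> (\<Sum>(i, j)\<in>?C. \<theta>)"
        by (rule sum_mono) (auto intro: order_trans[OF norm_proj_c00_le nx])
      also have "\<dots> = real (card ?C) * \<theta>" by (simp add: split_def)
      also have "\<dots> \<le> real (r + k) * \<theta>"
        by (intro mult_right_mono of_nat_mono card_meeting_pairs_le[OF E succ] \<theta>)
      also have "\<dots> \<le> (3/2 * real r) * \<theta>" using False \<theta> by (intro mult_right_mono) (simp_all add: r_def)
      finally have "?X / real r \<le> 3/2 * \<theta>" using r by (simp add: divide_le_eq mult_ac)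
      moreover have "(\<Sum>j=1..k. norm (proj_c00 (E j) (f p))) \<le> 2 * \<theta>"
        using admissible_norm_sum_le[OF E, of "f p"] f(4)[of p] by linarith
      ultimately show ?thesis by linarith
    qed
    finally show "(\<Sum>j=1..k. norm (proj_c00 (E j) z)) \<le> 2 * (7/4 * \<theta>)" by simp
  qed
  moreover have "mass_c00 z = 2"
    using r by (simp add: z_def mass_c00_add mass_c00_scaleR mass_c00_sum x_def f(3))
  moreover have "p \<le> l" if "coord z l \<noteq> 0" for l
  proof (cases "coord (f p) l = 0")
    case True
    have "\<exists>i. coord (x i) l \<noteq> 0"
    proof (rule ccontr)
      assume "\<nexists>i. coord (x i) l \<noteq> 0"
      then show False using that True by (simp add: z)
    qed
    then have "M \<le> l" using M_le by blast
    \<comment> \<open>Because \<open>f p\<close> has mass 1, some point of its support lies between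
      \<open>p\<close> and \<open>M\<close>; this yields \<open>p < M\<close>.\<close>
    moreover have "{i. coord (f p) i \<noteq> 0} \<noteq> {}"
      using f(3)[of p] unfolding mass_c00_def by (intro notI) simp
    then obtain l' where "coord (f p) l' \<noteq> 0" by blast
    then have "p \<le> l'" "l' < M" using f(2) less_M by blast+
    ultimately show ?thesis by linarith
  qed (rule f(2))
  moreover have "0 \<le> coord z l" for l
    unfolding z by (intro add_nonneg_nonneg divide_nonneg_nonneg sum_nonneg f(1) xnn) simp
  ultimately show "\<exists>a. (\<forall>i. 0 \<le> coord a i) \<and> (\<forall>i. coord a i \<noteq> 0 \<longrightarrow> p \<le> i) \<and>
     mass_c00 a = 1 \<and> norm a \<le> 7/8 * \<theta>"
    by (intro exI[of _ "(1/2) *\<^sub>R z"]) (auto simp: mass_c00_scaleR)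
qed

proposition tsirelson_not_l1:
  obtains a :: "real c00" where "\<And>i. 0 \<le> coord a i" "norm a \<le> 1" "M < mass_c00 a"
proof -
  have small: "small_mass_vectors ((7/8) ^ n)" for n
  proof (induction n)
    case 0
    show ?case unfolding small_mass_vectors_def
    proof
      fix p
      have supp: "{i. coord (unit_c00 p :: real c00) i \<noteq> 0} = {p}" by auto
      have "norm (unit_c00 p :: real c00) \<le> (\<Sum>i\<in>{p}. norm (coord (unit_c00 p :: real c00) i))"
        by (rule norm_c00_le_l1) (simp_all add: supp)
      then show "\<exists>a. (\<forall>i. 0 \<le> coord a i) \<and> (\<forall>i. coord a i \<noteq> 0 \<longrightarrow> p \<le> i) \<and>
         mass_c00 a = 1 \<and> norm a \<le> (7/8) ^ 0"
        by (intro exI[of _ "unit_c00 p"]) (auto simp: mass_c00_def supp)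
    qed
  next
    case (Suc n)
    then show ?case unfolding power_Suc by (rule small_mass_vectors_step)
  qed
  obtain n where n: "(7/8 :: real) ^ n < 1 / (\<bar>M\<bar> + 1)"
    using real_arch_pow_inv[of "1 / (\<bar>M\<bar> + 1)" "7/8 :: real"] by (auto simp: add_nonneg_pos)
  obtain a :: "real c00" where a: "\<forall>i. 0 \<le> coord a i" "mass_c00 a = 1" "norm a \<le> (7/8) ^ n"
    using small[of n, unfolded small_mass_vectors_def, THEN spec, of 0] by (elim exE conjE)
  have "norm ((\<bar>M\<bar> + 1) *\<^sub>R a) \<le> 1"
  proof -
    have "(\<bar>M\<bar> + 1) * norm a \<le> (\<bar>M\<bar> + 1) * (1 / (\<bar>M\<bar> + 1))"
      using a(3) n by (intro mult_left_mono) auto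
    then show ?thesis by (simp split: if_splits)
  qed
  moreover have "M < mass_c00 ((\<bar>M\<bar> + 1) *\<^sub>R a)" using a(2) by (simp add: mass_c00_scaleR)
  ultimately show ?thesis using that[of "(\<bar>M\<bar> + 1) *\<^sub>R a"] a(1) by simp
qed

section \<open>Moduli and norming functionals\<close>

lift_definition modulus_c00 :: "'k::real_normed_field c00 \<Rightarrow> real c00" is "\<lambda>x i. norm (x i)"
  by simp

declare modulus_c00.rep_eq [simp]

lemma modulus_c00_proj: "modulus_c00 (proj_c00 E x) = proj_c00 E (modulus_c00 x)"
  by (rule c00_eqI) simp

lemma tsirelson_iter_modulus: "tsirelson_iter m (modulus_c00 x) = tsirelson_iter m x"
proof (induction m arbitrary: x)
  case 0
  show ?case by (simp add: tsirelson_iter_0 sup_c00_def)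
next
  case (Suc m)
  have "sup_c00 (modulus_c00 x) = sup_c00 x" by (simp add: sup_c00_def)
  then show ?case
    unfolding tsirelson_iter_Suc tsirelson_rhs_def tsirelson_sums_def
    by (simp add: modulus_c00_proj[symmetric] Suc)
qed

lemma norm_modulus_c00: "norm (modulus_c00 x) = norm x"
  using tsirelson_iter_tendsto_norm[of "modulus_c00 x"] tsirelson_iter_tendsto_norm[of x]
  unfolding tsirelson_iter_modulus by (rule LIMSEQ_unique)

lift_definition embed_c00 :: "real c00 \<Rightarrow> 'k::real_normed_field c00" is "\<lambda>x i. of_real (x i)"
  by simp

declare embed_c00.rep_eq [simp]

lemma norm_embed_c00: "norm (embed_c00 x :: 'k::real_normed_field c00) = norm x"
proof -
  have "norm (modulus_c00 (embed_c00 x :: 'k c00)) = norm (modulus_c00 x)"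
    by (intro arg_cong[where f = norm] c00_eqI) simp
  then show ?thesis by (simp add: norm_modulus_c00)
qed

text \<open>These are the finitely supported nonnegative elements of the unit ball of the original
  Tsirelson space, given by their coefficients.\<close>

definition norming_functional :: "nat set \<Rightarrow> (nat \<Rightarrow> real) \<Rightarrow> bool" where
  "norming_functional F \<phi> \<longleftrightarrow> finite F \<and> (\<forall>i. 0 \<le> \<phi> i) \<and>
     (\<forall>z :: real c00. (\<Sum>i\<in>F. \<phi> i * \<bar>coord z i\<bar>) \<le> norm z)"

lemma norming_functional_unit: "norming_functional {n} (\<lambda>_. 1)"
proof -
  have "\<bar>coord z n\<bar> \<le> norm z" for z :: "real c00" using norm_coord_le[of z n] by simp
  then show ?thesis by (simp add: norming_functional_def)
qed

text \<open>The functional is read off a norming tree of depth \<open>m\<close>, which keeps it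
  explicit, nonnegative and finitely supported.\<close>

lemma ex_norming_functional:
  fixes x :: "real c00"
  shows "\<exists>F \<phi>. norming_functional F \<phi> \<and> tsirelson_iter m x \<le> (\<Sum>i\<in>F. \<phi> i * \<bar>coord x i\<bar>)"
proof (induction m arbitrary: x)
  case 0
  obtain n where "sup_c00 x = norm (coord x n)" by (rule sup_c00_attained)
  then show ?case
    by (intro exI[of _ "{n}"] exI[of _ "\<lambda>_. 1"]) (simp add: tsirelson_iter_0 norming_functional_unit)
next
  case (Suc m)
  show ?case
  proof -
    consider (coordinate) n where "tsirelson_rhs (tsirelson_iter m) x = norm (coord x n)"
      | (admissible) k E where "tsirelson_admissible k E"
        "tsirelson_rhs (tsirelson_iter m) x = 1/2 * (\<Sum>j=1..k. tsirelson_iter m (proj_c00 (E j) x))"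
      by (rule tsirelson_rhs_cases[OF seminorm_tsirelson_iter])
    then show ?thesis
    proof cases
      case (coordinate n)
      then show ?thesis
        by (intro exI[of _ "{n}"] exI[of _ "\<lambda>_. 1"]) (simp add: tsirelson_iter_Suc norming_functional_unit)
    next
      case (admissible k E)
      have "\<forall>j. \<exists>F \<phi>. norming_functional F \<phi> \<and>
          tsirelson_iter m (proj_c00 (E j) x) \<le> (\<Sum>i\<in>F. \<phi> i * \<bar>coord (proj_c00 (E j) x) i\<bar>)"
        using Suc by blast
      then obtain F \<phi> where F: "\<And>j. norming_functional (F j) (\<phi> j)"
        "\<And>j. tsirelson_iter m (proj_c00 (E j) x) \<le> (\<Sum>i\<in>F j. \<phi> j i * \<bar>coord (proj_c00 (E j) x) i\<bar>)"
        by metis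
      define G where "G = (\<Union>j\<in>{1..k}. F j)"
      \<comment> \<open>The supports \<open>F j\<close> may overlap and may leave
        \<open>E j\<close>, so each child functional is cut down to \<open>E j\<close> before half
        of their sum is taken.\<close>
      define \<psi> where "\<psi> i = 1/2 * (\<Sum>j=1..k. if i \<in> F j \<and> Suc i \<in> E j then \<phi> j i else 0)" for i
      have fin: "finite (F j)" and nn: "0 \<le> \<phi> j i" for j i using F(1)[of j] by (auto simp: norming_functional_def)
      have G: "finite G" using fin by (simp add: G_def)
      have eq: "(\<Sum>i\<in>G. \<psi> i * \<bar>coord z i\<bar>) =
          1/2 * (\<Sum>j=1..k. \<Sum>i\<in>F j. \<phi> j i * \<bar>coord (proj_c00 (E j) z) i\<bar>)" for z :: "real c00"
      proof -
        have "(\<Sum>i\<in>G. \<psi> i * \<bar>coord z i\<bar>) =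
            1/2 * (\<Sum>i\<in>G. \<Sum>j=1..k. (if i \<in> F j \<and> Suc i \<in> E j then \<phi> j i else 0) * \<bar>coord z i\<bar>)"
          unfolding \<psi>_def by (simp add: sum_distrib_left sum_distrib_right sum_divide_distrib)
        also have "(\<Sum>i\<in>G. \<Sum>j=1..k. (if i \<in> F j \<and> Suc i \<in> E j then \<phi> j i else 0) * \<bar>coord z i\<bar>) =
            (\<Sum>j=1..k. \<Sum>i\<in>G. (if i \<in> F j \<and> Suc i \<in> E j then \<phi> j i else 0) * \<bar>coord z i\<bar>)"
          by (rule sum.swap)
        also have "\<dots> = (\<Sum>j=1..k. \<Sum>i\<in>F j. \<phi> j i * \<bar>coord (proj_c00 (E j) z) i\<bar>)"
        proof (rule sum.cong[OF refl])
          fix j assume "j \<in> {1..k}"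
          then have "F j \<subseteq> G" by (auto simp: G_def)
          then show "(\<Sum>i\<in>G. (if i \<in> F j \<and> Suc i \<in> E j then \<phi> j i else 0) * \<bar>coord z i\<bar>) =
              (\<Sum>i\<in>F j. \<phi> j i * \<bar>coord (proj_c00 (E j) z) i\<bar>)"
            using G by (intro sum.mono_neutral_cong_right) auto
        qed
        finally show ?thesis .
      qed
      have "norming_functional G \<psi>"
        unfolding norming_functional_def
      proof (intro conjI allI)
        show "0 \<le> \<psi> i" for i unfolding \<psi>_def by (intro mult_nonneg_nonneg sum_nonneg) (auto simp: nn)
        fix z :: "real c00"
        have "(\<Sum>j=1..k. \<Sum>i\<in>F j. \<phi> j i * \<bar>coord (proj_c00 (E j) z) i\<bar>) \<le> (\<Sum>j=1..k. norm (proj_c00 (E j) z))"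
          by (rule sum_mono) (use F(1) in \<open>unfold norming_functional_def, blast\<close>)
        also have "\<dots> \<le> 2 * norm z" by (rule admissible_norm_sum_le[OF admissible(1)])
        finally show "(\<Sum>i\<in>G. \<psi> i * \<bar>coord z i\<bar>) \<le> norm z" unfolding eq by simp
      qed (rule G)
      moreover have "tsirelson_iter (Suc m) x \<le> (\<Sum>i\<in>G. \<psi> i * \<bar>coord x i\<bar>)"
        unfolding tsirelson_iter_Suc admissible(2) eq by (intro mult_left_mono sum_mono F(2)) simp
      ultimately show ?thesis by blast
    qed
  qed
qed

section \<open>Coordinates in the direct sum\<close>

definition sum_coord :: "'k::{real_normed_field,banach} tsirelson_sum_c0 \<Rightarrow> nat \<Rightarrow> nat \<Rightarrow> 'k" where
  "sum_coord x j i = apply_bcontfun (Rep_c0 (Rep_tsirelson_sum_c0 x j)) i"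

lemma sum_coord_eqI: "(\<And>j i. sum_coord x j i = sum_coord y j i) \<Longrightarrow> x = y"
  unfolding sum_coord_def
  by (metis Rep_c0_inject Rep_tsirelson_sum_c0_inject bcontfun_eqI ext)

lemma sum_coord_simps [simp]:
  "sum_coord 0 j i = 0"
  "sum_coord (x + y) j i = sum_coord x j i + sum_coord y j i"
  "sum_coord (x - y) j i = sum_coord x j i - sum_coord y j i"
  "sum_coord (scale_tsirelson_sum_c0 c x) j i = c * sum_coord x j i"
  by (simp_all add: sum_coord_def zero_tsirelson_sum_c0.rep_eq zero_c0.rep_eq plus_tsirelson_sum_c0.rep_eq
      plus_c0.rep_eq minus_tsirelson_sum_c0.rep_eq minus_c0.rep_eq scale_tsirelson_sum_c0.rep_eq Rep_scale_c0)

abbreviation sum_norm :: "'k::{real_normed_field,banach} tsirelson_sum_c0 \<Rightarrow> nat \<Rightarrow> real" where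
  "sum_norm x j \<equiv> norm (Rep_tsirelson_sum_c0 x j)"

lemma norm_sum_coord_le: "norm (sum_coord x j i) \<le> sum_norm x j"
  unfolding sum_coord_def norm_c0.rep_eq by (rule norm_bounded)

lemma sum_norm_le: "(\<And>i. norm (sum_coord x j i) \<le> c) \<Longrightarrow> sum_norm x j \<le> c"
  unfolding sum_coord_def norm_c0.rep_eq by (rule norm_bound)

lemma summable_sum_norm:
  fixes x :: "'k::{real_normed_field,banach} tsirelson_sum_c0"
  shows "summable (\<lambda>n. sum_norm x n *\<^sub>R (tsirelson_basis n :: 'k tsirelson \<Rightarrow>\<^sub>L 'k))"
  using Rep_tsirelson_sum_c0[of x] by simp

text \<open>A pair \<open>(j, i)\<close> stands for coordinate \<open>i\<close> in copy
  \<open>j\<close> of c_0. For finite \<open>A\<close> the representing sequences satisfy the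
  constraints of both types.\<close>

definition fin_sum :: "(nat \<times> nat) set \<Rightarrow> (nat \<Rightarrow> nat \<Rightarrow> 'k::{real_normed_field,banach}) \<Rightarrow> 'k tsirelson_sum_c0" where
  "fin_sum A w = Abs_tsirelson_sum_c0 (\<lambda>j. Abs_c0 (Bcontfun (\<lambda>i. if (j, i) \<in> A then w j i else 0)))"

lemma sum_coord_fin_sum:
  fixes w :: "nat \<Rightarrow> nat \<Rightarrow> 'k::{real_normed_field,banach}"
  assumes A: "finite A" shows "sum_coord (fin_sum A w) j i = (if (j, i) \<in> A then w j i else 0)"
proof -
  define v where "v j i = (if (j, i) \<in> A then w j i else 0)" for j i
  have fin: "finite {i. v j i \<noteq> 0}" for j
    by (rule finite_subset[of _ "snd ` A"]) (use A in \<open>force simp: v_def split: if_splits\<close>)+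
  have "finite (range (v j))" for j
  proof (rule finite_subset)
    show "range (v j) \<subseteq> insert 0 (v j ` {i. v j i \<noteq> 0})" by auto
  qed (use fin in simp)
  then have "bounded (range (v j))" for j by (rule finite_imp_bounded)
  then have bc: "v j \<in> bcontfun" for j by (simp add: bcontfun_def)
  have "v j \<longlonglongrightarrow> 0" for j
  proof (rule tendsto_eventually)
    obtain M where "\<And>i. v j i \<noteq> 0 \<Longrightarrow> i \<le> M" using fin[of j] finite_nat_set_iff_bounded_le by auto
    then show "\<forall>\<^sub>F i in sequentially. v j i = 0"
      unfolding eventually_sequentially by (intro exI[of _ "Suc M"]) force
  qed
  then have c0: "apply_bcontfun (Rep_c0 (Abs_c0 (Bcontfun (v j)))) = v j" for j
    using bc by (simp add: Abs_c0_inverse Bcontfun_inverse)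
  have "Abs_c0 (Bcontfun (v j)) = 0" if "j \<notin> fst ` A" for j
  proof (rule Rep_c0_inject[THEN iffD1], rule bcontfun_eqI)
    fix i show "apply_bcontfun (Rep_c0 (Abs_c0 (Bcontfun (v j)))) i = apply_bcontfun (Rep_c0 0) i"
      using that unfolding c0 by (force simp: v_def zero_c0.rep_eq)
  qed
  then have "summable (\<lambda>n. norm (Abs_c0 (Bcontfun (v n))) *\<^sub>R (tsirelson_basis n :: 'k tsirelson \<Rightarrow>\<^sub>L 'k))"
    using A by (intro summable_finite[of "fst ` A"]) auto
  then show ?thesis
    unfolding fin_sum_def sum_coord_def v_def[symmetric] by (simp add: Abs_tsirelson_sum_c0_inverse c0)
qed

definition sum_unit :: "nat \<Rightarrow> nat \<Rightarrow> 'k::{real_normed_field,banach} tsirelson_sum_c0" where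
  "sum_unit j i = fin_sum {(j, i)} (\<lambda>_ _. 1)"

lemma sum_coord_unit [simp]: "sum_coord (sum_unit j i) j' i' = (if j' = j \<and> i' = i then 1 else 0)"
  by (simp add: sum_unit_def sum_coord_fin_sum)

abbreviation sum_dual :: "('k::{real_normed_field,banach} tsirelson_sum_c0 \<Rightarrow>\<^sub>L 'k) set" where
  "sum_dual \<equiv> dual_space scale_tsirelson_sum_c0"

lemma dual_fin_sum:
  assumes f: "f \<in> sum_dual" and A: "finite A"
  shows "blinfun_apply f (fin_sum A w) = (\<Sum>(j, i)\<in>A. w j i * blinfun_apply f (sum_unit j i))"
  using A
proof (induction A)
  case empty
  have "fin_sum {} w = 0" by (rule sum_coord_eqI) (simp add: sum_coord_fin_sum)
  then show ?case by (simp add: blinfun.zero_right)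
next
  case (insert c A)
  obtain j i where c: "c = (j, i)" by force
  have "fin_sum (insert c A) w = fin_sum A w + scale_tsirelson_sum_c0 (w j i) (sum_unit j i)"
    using insert by (intro sum_coord_eqI) (auto simp: sum_coord_fin_sum c)
  then show ?case using insert f by (simp add: blinfun.add_right c dual_space_def add.commute)
qed

lemma norm_tsirelson_basis_le: "norm (tsirelson_basis n :: 'k::{real_normed_field,banach} tsirelson \<Rightarrow>\<^sub>L 'k) \<le> 1"
  by (rule norm_blinfun_bound) (simp_all add: tsirelson_basis_eq norm_coord_tsirelson_le)

text \<open>Since each copy carries the supremum norm, any number of entries of size
  \<open>\<phi> j\<close> may be put into copy \<open>j\<close>. The norms of the copies are then
  dominated by \<phi>, which belongs to the unit ball of the original Tsirelson space.\<close>

lemma norm_fin_sum_le_1: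
  fixes w :: "nat \<Rightarrow> nat \<Rightarrow> 'k::{real_normed_field,banach}"
  assumes A: "finite A" and \<phi>: "norming_functional F \<phi>"
    and w: "\<And>j i. norm (w j i) \<le> (if j \<in> F then \<phi> j else 0)"
  shows "norm (fin_sum A w) \<le> 1"
proof -
  let ?x = "fin_sum A w"
  have F: "finite F" and \<phi>0: "0 \<le> \<phi> j" for j using \<phi> by (auto simp: norming_functional_def)
  have x: "sum_norm ?x j \<le> (if j \<in> F then \<phi> j else 0)" for j
    by (rule sum_norm_le) (use w[of j] \<phi>0 in \<open>auto simp: sum_coord_fin_sum[OF A]\<close>)
  have "(\<Sum>n. sum_norm ?x n *\<^sub>R (tsirelson_basis n :: 'k tsirelson \<Rightarrow>\<^sub>L 'k)) =
      (\<Sum>n\<in>F. sum_norm ?x n *\<^sub>R tsirelson_basis n)"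
  proof (rule suminf_finite[OF F])
    fix n assume "n \<notin> F"
    then have "sum_norm ?x n = 0" using x[of n] by simp
    then show "sum_norm ?x n *\<^sub>R (tsirelson_basis n :: 'k tsirelson \<Rightarrow>\<^sub>L 'k) = 0" by simp
  qed
  then have "norm ?x = norm (\<Sum>n\<in>F. sum_norm ?x n *\<^sub>R (tsirelson_basis n :: 'k tsirelson \<Rightarrow>\<^sub>L 'k))"
    by (simp add: norm_tsirelson_sum_c0.rep_eq)
  also have "\<dots> \<le> 1"
  proof (rule norm_completion_blinfun_le)
    fix z :: "'k c00"
    have "norm (blinfun_apply (\<Sum>n\<in>F. sum_norm ?x n *\<^sub>R (tsirelson_basis n :: 'k tsirelson \<Rightarrow>\<^sub>L 'k)) (completion_of z)) =
        norm (\<Sum>n\<in>F. sum_norm ?x n *\<^sub>R coord z n)"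
      by (simp add: blinfun.sum_left blinfun.scaleR_left tsirelson_basis_eq)
    also have "\<dots> \<le> (\<Sum>n\<in>F. \<phi> n * \<bar>coord (modulus_c00 z) n\<bar>)"
    proof (rule order_trans[OF norm_sum sum_mono])
      fix n assume "n \<in> F"
      then have "sum_norm ?x n * norm (coord z n) \<le> \<phi> n * norm (coord z n)"
        using x[of n] by (intro mult_right_mono) simp_all
      then show "norm (sum_norm ?x n *\<^sub>R coord z n) \<le> \<phi> n * \<bar>coord (modulus_c00 z) n\<bar>" by simp
    qed
    also have "\<dots> \<le> norm (modulus_c00 z)" using \<phi> unfolding norming_functional_def by blast
    finally show "norm (blinfun_apply (\<Sum>n\<in>F. sum_norm ?x n *\<^sub>R (tsirelson_basis n :: 'k tsirelson \<Rightarrow>\<^sub>L 'k)) (completion_of z)) \<le> 1 * norm z"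
      by (simp add: norm_modulus_c00)
  qed simp
  finally show ?thesis .
qed

section \<open>The dual of the direct sum\<close>

text \<open>The coordinate at \<open>j\<close> is the l_1 norm of the part of \<open>f\<close> in
  copy \<open>j\<close> seen by \<open>A\<close>. For finite \<open>A\<close> the T norm of the
  profile is the norm that the restriction of \<open>f\<close> to \<open>A\<close> has in the T-sum
  of copies of l_1.\<close>

definition dual_profile :: "('k::{real_normed_field,banach} tsirelson_sum_c0 \<Rightarrow>\<^sub>L 'k) \<Rightarrow> (nat \<times> nat) set \<Rightarrow> real c00" where
  "dual_profile f A = (\<Sum>(j, i)\<in>A. norm (blinfun_apply f (sum_unit j i)) *\<^sub>R unit_c00 j)"

lemma coord_dual_profile:
  "coord (dual_profile f A) n = (\<Sum>(j, i)\<in>A. if n = j then norm (blinfun_apply f (sum_unit j i)) else 0)"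
  unfolding dual_profile_def coord_sum by (rule sum.cong) (auto split: prod.splits)

lemma coord_dual_profile_nonneg: "0 \<le> coord (dual_profile f A) n"
  unfolding coord_dual_profile by (rule sum_nonneg) auto

lemma sum_mult_coord_dual_profile:
  assumes "finite A" "finite F"
  shows "(\<Sum>n\<in>F. \<phi> n * coord (dual_profile f A) n) =
    (\<Sum>(j, i)\<in>A. (if j \<in> F then \<phi> j else 0) * norm (blinfun_apply f (sum_unit j i)))"
proof -
  have "(\<Sum>n\<in>F. \<phi> n * coord (dual_profile f A) n) =
      (\<Sum>n\<in>F. \<Sum>c\<in>A. if n = fst c then \<phi> n * norm (blinfun_apply f (sum_unit (fst c) (snd c))) else 0)"
    unfolding coord_dual_profile by (simp add: sum_distrib_left split_def if_distrib cong: if_cong)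
  also have "\<dots> = (\<Sum>c\<in>A. \<Sum>n\<in>F. if n = fst c then \<phi> n * norm (blinfun_apply f (sum_unit (fst c) (snd c))) else 0)"
    by (rule sum.swap)
  also have "\<dots> = (\<Sum>(j, i)\<in>A. (if j \<in> F then \<phi> j else 0) * norm (blinfun_apply f (sum_unit j i)))"
    using assms(2) by (intro sum.cong) (auto simp: split_def)
  finally show ?thesis .
qed

text \<open>Take a nonnegative functional \<phi> that norms the profile up to stage
  \<open>m\<close>, and apply \<open>f\<close> to the element with entries \<open>\<phi> j\<close>
  times the sign \<open>\<sigma>\<close> that makes each value of \<open>f\<close>
  nonnegative.\<close>

lemma norm_dual_profile_le:
  fixes f :: "'k::{real_normed_field,banach} tsirelson_sum_c0 \<Rightarrow>\<^sub>L 'k"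
  assumes f: "f \<in> sum_dual" and A: "finite A"
  shows "norm (dual_profile f A) \<le> norm f"
proof (rule norm_c00_le_of_iter)
  fix m
  let ?y = "dual_profile f A"
  obtain F \<phi> where \<phi>: "norming_functional F \<phi>"
    and le: "tsirelson_iter m ?y \<le> (\<Sum>i\<in>F. \<phi> i * \<bar>coord ?y i\<bar>)"
    using ex_norming_functional[of m ?y] by blast
  have F: "finite F" and \<phi>0: "0 \<le> \<phi> j" for j using \<phi> by (auto simp: norming_functional_def)
  define \<sigma> :: "'k \<Rightarrow> 'k" where "\<sigma> v = (if v = 0 then 0 else of_real (norm v) / v)" for v
  have \<sigma>: "norm (\<sigma> v) \<le> 1" "\<sigma> v * v = of_real (norm v)" for v by (simp_all add: \<sigma>_def norm_divide)
  define w where "w j i = (if j \<in> F then of_real (\<phi> j) * \<sigma> (blinfun_apply f (sum_unit j i)) else 0)" for j i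
  have "norm (w j i) \<le> (if j \<in> F then \<phi> j else 0)" for j i
    using mult_left_mono[OF \<sigma>(1) \<phi>0[of j]] \<phi>0[of j] by (simp add: w_def norm_mult)
  then have nx: "norm (fin_sum A w) \<le> 1" by (rule norm_fin_sum_le_1[OF A \<phi>])
  have "w j i * blinfun_apply f (sum_unit j i) =
      of_real ((if j \<in> F then \<phi> j else 0) * norm (blinfun_apply f (sum_unit j i)))" for j i
    by (simp add: w_def \<sigma>(2) mult.assoc)
  then have "blinfun_apply f (fin_sum A w) = of_real (\<Sum>n\<in>F. \<phi> n * coord ?y n)"
    unfolding dual_fin_sum[OF f A] sum_mult_coord_dual_profile[OF A F] by (simp add: split_def)
  moreover have "norm (blinfun_apply f (fin_sum A w)) \<le> norm f * 1"
    using norm_blinfun[of f "fin_sum A w"] mult_left_mono[OF nx norm_ge_zero[of f]] by linarith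
  ultimately have "\<bar>\<Sum>n\<in>F. \<phi> n * coord ?y n\<bar> \<le> norm f" by (simp del: of_real_sum of_real_mult)
  then have "(\<Sum>n\<in>F. \<phi> n * coord ?y n) \<le> norm f" by linarith
  then show "tsirelson_iter m ?y \<le> norm f" using le by (simp add: coord_dual_profile_nonneg)
qed

lemma sum_coord_tendsto_0: "(\<lambda>i. sum_coord x j i) \<longlonglongrightarrow> 0"
  unfolding sum_coord_def using Rep_c0[of "Rep_tsirelson_sum_c0 x j"] by simp

text \<open>The tail of the series takes care of all but \<open>N\<close> copies. In each of these
  only finitely many coordinates reach \<open>d\<close> in absolute value, and basis vectors have
  norm at most 1, so the remaining errors add up to at most \<open>N * d\<close>.\<close>

lemma fin_sum_approx:
  fixes x :: "'k::{real_normed_field,banach} tsirelson_sum_c0"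
  assumes e: "0 < e"
  obtains A where "finite A" "norm (x - fin_sum A (sum_coord x)) \<le> e"
proof -
  let ?e = "tsirelson_basis :: nat \<Rightarrow> 'k tsirelson \<Rightarrow>\<^sub>L 'k"
  obtain N where N: "\<And>m n. N \<le> m \<Longrightarrow> norm (\<Sum>j=m..<n. sum_norm x j *\<^sub>R ?e j) < e / 2"
    using summable_sum_norm[of x, unfolded summable_Cauchy, rule_format, OF half_gt_zero[OF e]] by blast
  define d where "d = e / (2 * (real N + 1))"
  have d: "0 < d" using e by (simp add: d_def)
  have "\<forall>j. \<exists>I. \<forall>i\<ge>I. norm (sum_coord x j i) < d"
    using LIMSEQ_D[OF sum_coord_tendsto_0 d, of x] by simp
  then obtain I where I: "\<And>j i. I j \<le> i \<Longrightarrow> norm (sum_coord x j i) < d" by metis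
  define A where "A = Sigma {..<N} (\<lambda>j. {..<I j})"
  have A: "finite A" by (simp add: A_def)
  let ?d = "x - fin_sum A (sum_coord x)"
  have coord: "sum_coord ?d j i = (if (j, i) \<in> A then 0 else sum_coord x j i)" for j i
    by (simp add: sum_coord_fin_sum[OF A])
  have small: "sum_norm ?d j \<le> d" if "j < N" for j
  proof (rule sum_norm_le)
    fix i show "norm (sum_coord ?d j i) \<le> d"
      using I[of j i] d that unfolding coord by (auto simp: A_def intro: less_imp_le)
  qed
  have le: "sum_norm ?d j \<le> sum_norm x j" for j
    by (rule sum_norm_le) (simp add: coord norm_sum_coord_le del: sum_coord_simps)
  have "norm (\<Sum>j<n. sum_norm ?d j *\<^sub>R ?e j) \<le> e" if "N \<le> n" for n
  proof -
    have eq: "(\<Sum>j<n. sum_norm ?d j *\<^sub>R ?e j) =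
        (\<Sum>j<N. sum_norm ?d j *\<^sub>R ?e j) + (\<Sum>j=N..<n. sum_norm ?d j *\<^sub>R ?e j)"
      using that by (simp add: lessThan_atLeast0 sum.atLeastLessThan_concat)
    have "norm (\<Sum>j<n. sum_norm ?d j *\<^sub>R ?e j) \<le>
        norm (\<Sum>j<N. sum_norm ?d j *\<^sub>R ?e j) + norm (\<Sum>j=N..<n. sum_norm ?d j *\<^sub>R ?e j)"
      unfolding eq by (rule norm_triangle_ineq)
    also have "norm (\<Sum>j<N. sum_norm ?d j *\<^sub>R ?e j) \<le> (\<Sum>j<N. d)"
    proof (rule order_trans[OF norm_sum sum_mono])
      fix j assume "j \<in> {..<N}"
      then have "sum_norm ?d j * norm (?e j) \<le> d * 1"
        using small[of j] d norm_tsirelson_basis_le by (intro mult_mono) auto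
      then show "norm (sum_norm ?d j *\<^sub>R ?e j) \<le> d" by simp
    qed
    also have "(\<Sum>j<N. d) \<le> e / 2" using e by (simp add: d_def field_simps)
    also have "norm (\<Sum>j=N..<n. sum_norm ?d j *\<^sub>R ?e j) \<le> norm (\<Sum>j=N..<n. sum_norm x j *\<^sub>R ?e j)"
      by (rule norm_tsirelson_basis_sum_mono) (use le in auto)
    also have "\<dots> \<le> e / 2" using N[of N n] by simp
    finally show ?thesis by simp
  qed
  then have "norm ?d \<le> e"
    unfolding norm_tsirelson_sum_c0.rep_eq
    by (intro LIMSEQ_le_const2[OF tendsto_norm[OF summable_LIMSEQ[OF summable_sum_norm]]]) blast
  then show ?thesis using that A by blast
qed

text \<open>This is the pairing of T with its dual: a partial sum of the series that defines
  \<open>norm x\<close> is evaluated at \<open>y\<close>.\<close>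

lemma sum_mult_coord_le:
  fixes x :: "'k::{real_normed_field,banach} tsirelson_sum_c0" and y :: "real c00"
  assumes F: "finite F"
  shows "(\<Sum>j\<in>F. sum_norm x j * coord y j) \<le> norm x * norm y"
proof -
  let ?g = "\<Sum>n\<in>F. sum_norm x n *\<^sub>R (tsirelson_basis n :: 'k tsirelson \<Rightarrow>\<^sub>L 'k)"
  have "blinfun_apply ?g (completion_of (embed_c00 y)) = of_real (\<Sum>j\<in>F. sum_norm x j * coord y j)"
    by (simp add: blinfun.sum_left blinfun.scaleR_left tsirelson_basis_eq scaleR_conv_of_real)
  then have "\<bar>\<Sum>j\<in>F. sum_norm x j * coord y j\<bar> = norm (blinfun_apply ?g (completion_of (embed_c00 y)))"
    by (simp del: of_real_sum)
  also have "\<dots> \<le> norm ?g * norm y"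
    using norm_blinfun[of ?g "completion_of (embed_c00 y)"] by (simp add: norm_embed_c00)
  also have "norm ?g \<le> norm x"
    unfolding norm_tsirelson_sum_c0.rep_eq by (rule norm_sum_le_suminf_tsirelson[OF summable_sum_norm F])
  finally show ?thesis by (simp add: mult_right_mono)
qed

text \<open>The converse of \<open>norm_dual_profile_le\<close>: by density of finitely supported
  elements and the pairing of T with its dual, the norm of \<open>f\<close> is controlled by its
  finite profiles.\<close>

lemma norm_dual_le:
  fixes f :: "'k::{real_normed_field,banach} tsirelson_sum_c0 \<Rightarrow>\<^sub>L 'k"
  assumes f: "f \<in> sum_dual" and c: "0 \<le> c" and le: "\<And>A. finite A \<Longrightarrow> norm (dual_profile f A) \<le> c"
  shows "norm f \<le> c"
proof (rule norm_blinfun_bound[OF c])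
  fix x
  have fin: "norm (blinfun_apply f (fin_sum A (sum_coord x))) \<le> c * norm x" if A: "finite A" for A
  proof -
    have "norm (blinfun_apply f (fin_sum A (sum_coord x))) \<le>
        (\<Sum>(j, i)\<in>A. sum_norm x j * norm (blinfun_apply f (sum_unit j i)))"
      unfolding dual_fin_sum[OF f A]
      by (rule order_trans[OF norm_sum sum_mono]) (auto simp: norm_mult norm_sum_coord_le mult_right_mono)
    also have "\<dots> = (\<Sum>n\<in>fst ` A. sum_norm x n * coord (dual_profile f A) n)"
      unfolding sum_mult_coord_dual_profile[OF A finite_imageI[OF A]] by (rule sum.cong) (simp_all add: split_def)
    also have "\<dots> \<le> norm x * norm (dual_profile f A)" by (rule sum_mult_coord_le) (use A in simp)
    also have "\<dots> \<le> norm x * c" by (intro mult_left_mono le[OF A]) simp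
    finally show ?thesis by (simp add: mult.commute)
  qed
  show "norm (blinfun_apply f x) \<le> c * norm x"
  proof (rule field_le_epsilon)
    fix e :: real assume "0 < e"
    define d where "d = e / (norm f + 1)"
    have nf: "0 < norm f + 1" by (simp add: add_nonneg_pos)
    then have "0 < d" using \<open>0 < e\<close> by (simp add: d_def)
    then obtain A where A: "finite A" "norm (x - fin_sum A (sum_coord x)) \<le> d" by (rule fin_sum_approx)
    have eq: "blinfun_apply f x = blinfun_apply f (fin_sum A (sum_coord x)) + blinfun_apply f (x - fin_sum A (sum_coord x))"
      by (simp add: blinfun.diff_right)
    have "norm (blinfun_apply f x) \<le> norm (blinfun_apply f (fin_sum A (sum_coord x))) +
        norm (blinfun_apply f (x - fin_sum A (sum_coord x)))" unfolding eq by (rule norm_triangle_ineq)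
    also have "\<dots> \<le> c * norm x + norm f * d"
      using fin[OF A(1)] norm_blinfun[of f "x - fin_sum A (sum_coord x)"]
        mult_left_mono[OF A(2) norm_ge_zero[of f]] by linarith
    also have "norm f * d \<le> (norm f + 1) * d" using \<open>0 < d\<close> by simp
    also have "\<dots> = e" using nf by (simp add: d_def)
    finally show "norm (blinfun_apply f x) \<le> c * norm x + e" by simp
  qed
qed

section \<open>Upper bounds for the Szlenk index\<close>

lemma linear_less_exponential:
  fixes \<eta> :: real assumes "0 < \<eta>" obtains K :: nat where "(5 + 2 * real K) * C < 2 ^ K * \<eta>"
proof -
  have "(\<lambda>K. 5 * C * (1 / 2) ^ K + 2 * C * (real K / 2 ^ K)) \<longlonglongrightarrow> 5 * C * 0 + 2 * C * 0"
    by (intro tendsto_intros LIMSEQ_power_zero lim_n_over_pown) auto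
  then have "\<forall>\<^sub>F K in sequentially. 5 * C * (1 / 2) ^ K + 2 * C * (real K / 2 ^ K) < \<eta>"
    using assms by (intro order_tendstoD(2)[where y = "5 * C * 0 + 2 * C * 0"]) auto
  then obtain K where "5 * C * (1 / 2) ^ K + 2 * C * (real K / 2 ^ K) < \<eta>"
    using eventually_happens'[OF sequentially_bot] by blast
  then show ?thesis using that[of K] by (simp add: power_divide field_simps)
qed

lemma norm_c00_mono_nonneg:
  fixes u v :: "real c00"
  assumes "\<And>i. 0 \<le> coord u i" "\<And>i. coord u i \<le> coord v i" shows "norm u \<le> norm v"
proof (rule norm_c00_unconditional)
  fix i show "norm (coord u i) \<le> norm (coord v i)" using assms(1)[of i] assms(2)[of i] by simp
qed

lemma dual_profile_Un_disjoint:
  "finite A \<Longrightarrow> finite B \<Longrightarrow> A \<inter> B = {} \<Longrightarrow> dual_profile f (A \<union> B) = dual_profile f A + dual_profile f B"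
  unfolding dual_profile_def by (rule sum.union_disjoint)

lemma norm_unit_c00_le: "norm (unit_c00 n :: 'k::real_normed_field c00) \<le> 1"
  using norm_c00_le_l1[of "{n}" "unit_c00 n :: 'k c00"] by auto

lemma norm_dual_profile_le_card:
  assumes "\<And>j i. (j, i) \<in> A \<Longrightarrow> norm (blinfun_apply f (sum_unit j i)) \<le> \<delta>"
  shows "norm (dual_profile f A) \<le> real (card A) * \<delta>"
proof -
  have "norm (dual_profile f A) \<le> (\<Sum>c\<in>A. \<delta>)"
    unfolding dual_profile_def
  proof (rule order_trans[OF norm_sum sum_mono])
    fix c assume c: "c \<in> A"
    obtain j i where ji: "c = (j, i)" by force
    have "norm (blinfun_apply f (sum_unit j i)) * norm (unit_c00 j :: real c00) \<le>
        norm (blinfun_apply f (sum_unit j i)) * 1" by (intro mult_left_mono norm_unit_c00_le) simp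
    also have "\<dots> \<le> \<delta>" using assms[of j i] c ji by simp
    finally show "norm (case c of (j, i) \<Rightarrow> norm (blinfun_apply f (sum_unit j i)) *\<^sub>R (unit_c00 j :: real c00)) \<le> \<delta>"
      by (simp add: ji)
  qed
  then show ?thesis by simp
qed

lemma coord_dual_profile_triangle:
  "coord (dual_profile f A) n \<le> coord (dual_profile g A) n + coord (dual_profile (g - f) A) n"
  unfolding coord_dual_profile sum.distrib[symmetric]
proof (rule sum_mono)
  fix c assume "c \<in> A"
  obtain j i where "c = (j, i)" by force
  moreover have "norm (blinfun_apply f (sum_unit j i)) \<le>
      norm (blinfun_apply g (sum_unit j i)) + norm (blinfun_apply (g - f) (sum_unit j i))"
    unfolding blinfun.diff_left by (metis add.commute norm_minus_commute norm_triangle_sub)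
  ultimately show "(case c of (j, i) \<Rightarrow> if n = j then norm (blinfun_apply f (sum_unit j i)) else 0)
     \<le> (case c of (j, i) \<Rightarrow> if n = j then norm (blinfun_apply g (sum_unit j i)) else 0) +
        (case c of (j, i) \<Rightarrow> if n = j then norm (blinfun_apply (g - f) (sum_unit j i)) else 0)"
    by simp
qed

text \<open>Otherwise there are arbitrarily many disjoint finite sets with profiles of norm at least
  \<eta>, whose sum is a profile of norm at most \<open>norm f\<close>. For 2^K of them the lower
  estimate bounds 2^K \<eta> by a linear function of K.\<close>

lemma dual_profile_tail:
  fixes f :: "'k::{real_normed_field,banach} tsirelson_sum_c0 \<Rightarrow>\<^sub>L 'k"
  assumes f: "f \<in> sum_dual" and \<eta>: "0 < \<eta>"
  obtains A0 where "finite A0" "\<And>A. finite A \<Longrightarrow> A \<inter> A0 = {} \<Longrightarrow> norm (dual_profile f A) < \<eta>"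
proof -
  have "\<exists>A0. finite A0 \<and> (\<forall>A. finite A \<longrightarrow> A \<inter> A0 = {} \<longrightarrow> norm (dual_profile f A) < \<eta>)"
  proof (rule ccontr)
    assume neg: "\<nexists>A0. finite A0 \<and> (\<forall>A. finite A \<longrightarrow> A \<inter> A0 = {} \<longrightarrow> norm (dual_profile f A) < \<eta>)"
    have build: "\<exists>as B. length as = n \<and> finite B \<and> (\<forall>a\<in>set as. (\<forall>i. 0 \<le> coord a i) \<and> \<eta> \<le> norm a) \<and>
        (\<forall>i. (\<Sum>a\<leftarrow>as. coord a i) \<le> coord (dual_profile f B) i)" for n
    proof (induction n)
      case 0
      show ?case by (intro exI[of _ "[]"] exI[of _ "{}"]) (simp add: coord_dual_profile)
    next
      case (Suc n)
      then obtain as B where as: "length as = n" "finite B" "\<forall>a\<in>set as. (\<forall>i. 0 \<le> coord a i) \<and> \<eta> \<le> norm a"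
        "\<forall>i. (\<Sum>a\<leftarrow>as. coord a i) \<le> coord (dual_profile f B) i" by blast
      have "\<not> (\<forall>A. finite A \<longrightarrow> A \<inter> B = {} \<longrightarrow> norm (dual_profile f A) < \<eta>)"
        using neg as(2) by blast
      then obtain A where A: "finite A" "A \<inter> B = {}" "\<eta> \<le> norm (dual_profile f A)"
        by (auto simp: not_less)
      show ?case
        using as A coord_dual_profile_nonneg[of f A]
        by (intro exI[of _ "dual_profile f A # as"] exI[of _ "A \<union> B"]) (simp add: dual_profile_Un_disjoint)
    qed
    have bound: "2 ^ K * \<eta> \<le> (5 + 2 * real K) * norm f" for K
    proof -
      obtain as B where as: "length as = 2 ^ K" "finite B" "\<And>a. a \<in> set as \<Longrightarrow> \<eta> \<le> norm a"
        "\<And>a i. a \<in> set as \<Longrightarrow> 0 \<le> coord a i" "\<And>i. (\<Sum>a\<leftarrow>as. coord a i) \<le> coord (dual_profile f B) i"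
        using build[of "2 ^ K"] by (elim exE conjE) simp
      have "2 ^ K * \<eta> = (\<Sum>a\<leftarrow>as. \<eta>)" by (simp add: as(1) sum_list_triv)
      also have "\<dots> \<le> (\<Sum>a\<leftarrow>as. norm a)" by (rule sum_list_mono) (rule as(3))
      also have "\<dots> \<le> (5 + 2 * real K) * norm (dual_profile f B)"
        by (rule tsirelson_lower_estimate) (use as in auto)
      also have "\<dots> \<le> (5 + 2 * real K) * norm f"
        by (intro mult_left_mono norm_dual_profile_le f as(2)) simp
      finally show ?thesis .
    qed
    obtain K :: nat where "(5 + 2 * real K) * norm f < 2 ^ K * \<eta>" by (rule linear_less_exponential[OF \<eta>])
    with bound[of K] show False by simp
  qed
  then show ?thesis using that by blast
qed

section \<open>Derived sets of the dual ball\<close>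

lemma bounded_dual_ball: "bounded (dual_ball sc)"
  by (rule boundedI[of _ 1]) (simp add: dual_ball_def)

lemma szlenk_derivation_subset: "szlenk_derivation sc \<epsilon> K \<subseteq> K"
  by (auto simp: szlenk_derivation_def)

lemma szlenk_iterate_subset: "(szlenk_derivation sc \<epsilon> ^^ n) K \<subseteq> K"
  by (induction n) (use szlenk_derivation_subset in fastforce)+

lemma dual_space_diff:
  "f \<in> dual_space sc \<Longrightarrow> g \<in> dual_space sc \<Longrightarrow> f - g \<in> dual_space sc"
  by (simp add: dual_space_def blinfun.diff_left right_diff_distrib)

text \<open>The conditions on \<open>A\<close> define a weak* neighbourhood of \<open>f\<close>. It
  contains two points of \<open>K\<close> at distance more than \<epsilon>, and one of them is
  farther than \<epsilon>/2 from \<open>f\<close>.\<close>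

lemma szlenk_derivation_far_point:
  fixes f :: "'k::{real_normed_field,banach} tsirelson_sum_c0 \<Rightarrow>\<^sub>L 'k"
  assumes f: "f \<in> szlenk_derivation scale_tsirelson_sum_c0 \<epsilon> K" and K: "K \<subseteq> dual_ball scale_tsirelson_sum_c0"
    and A: "finite A" and pos: "0 < \<epsilon>" "0 < \<delta>"
  obtains g where "g \<in> K" "\<epsilon> / 2 < norm (g - f)"
    "\<And>j i. (j, i) \<in> A \<Longrightarrow> norm (blinfun_apply (g - f) (sum_unit j i)) < \<delta>"
proof -
  define U where "U = {g :: 'k tsirelson_sum_c0 \<Rightarrow>\<^sub>L 'k. \<forall>c\<in>A. blinfun_apply g (sum_unit (fst c) (snd c)) \<in>
      ball (blinfun_apply f (sum_unit (fst c) (snd c))) \<delta>} \<inter> sum_dual"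
  have "openin (weak_star_topology scale_tsirelson_sum_c0) U"
    unfolding weak_star_topology_def U_def
    by (intro openin_subtopology_Int strong_operator_topology_basis A) simp
  moreover have fK: "f \<in> K" using f szlenk_derivation_subset by blast
  then have "f \<in> U" using K pos by (auto simp: U_def dual_ball_def)
  ultimately have "\<epsilon> < diameter (K \<inter> U)" using f by (simp add: szlenk_derivation_def)
  moreover have "bounded (K \<inter> U)" using bounded_dual_ball K bounded_subset by blast
  ultimately obtain g h where gh: "g \<in> K \<inter> U" "h \<in> K \<inter> U" "\<epsilon> < dist g h"
    using diameter_lower_bounded pos(1) by blast
  have "dist g h \<le> dist g f + dist h f" by (metis dist_commute dist_triangle)
  then have "\<epsilon> / 2 < dist g f \<or> \<epsilon> / 2 < dist h f" using gh(3) by linarith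
  then obtain g where g: "g \<in> K \<inter> U" "\<epsilon> / 2 < dist g f" using gh by blast
  show ?thesis
  proof (rule that)
    show "g \<in> K" "\<epsilon> / 2 < norm (g - f)" using g by (auto simp: dist_norm)
    fix j i assume "(j, i) \<in> A"
    then show "norm (blinfun_apply (g - f) (sum_unit j i)) < \<delta>"
      using g(1) by (force simp: U_def dist_norm norm_minus_commute blinfun.diff_left)
  qed
qed

text \<open>
  The new vector is the profile of a far point \<open>g\<close> on a finite set \<open>C\<close> outside \<open>B\<close>, where \<open>f\<close> is
  negligible, while \<open>g\<close> is close to \<open>f\<close> on \<open>B\<close>.
\<close>

lemma szlenk_iterate_branch:
  fixes f :: "'k::{real_normed_field,banach} tsirelson_sum_c0 \<Rightarrow>\<^sub>L 'k"
  assumes "f \<in> (szlenk_derivation scale_tsirelson_sum_c0 \<epsilon> ^^ n) (dual_ball scale_tsirelson_sum_c0)"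
    and "finite A" "0 < \<epsilon>" "0 < \<omega>"
  shows "\<exists>as x. length as = n \<and> (\<forall>a\<in>set as. (\<forall>i. 0 \<le> coord a i) \<and> \<epsilon> / 4 \<le> norm a) \<and> norm x \<le> 1 + \<omega> \<and>
    (\<forall>i. coord (dual_profile f A) i + (\<Sum>a\<leftarrow>as. coord a i) \<le> coord x i)"
  using assms
proof (induction n arbitrary: f A \<omega>)
  case 0
  then have "norm (dual_profile f A) \<le> norm f" "norm f \<le> 1"
    by (simp_all add: dual_ball_def norm_dual_profile_le)
  then show ?case using 0 by (intro exI[of _ "[]"] exI[of _ "dual_profile f A"]) simp
next
  case (Suc n)
  let ?sc = "scale_tsirelson_sum_c0 :: 'k \<Rightarrow> 'k tsirelson_sum_c0 \<Rightarrow> _"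
  let ?K = "(szlenk_derivation ?sc \<epsilon> ^^ n) (dual_ball ?sc)"
  note pos = Suc.prems(3,4)
  have f: "f \<in> szlenk_derivation ?sc \<epsilon> ?K" using Suc.prems(1) by simp
  have K: "?K \<subseteq> dual_ball ?sc" by (rule szlenk_iterate_subset)
  then have fd: "f \<in> sum_dual" using f szlenk_derivation_subset unfolding dual_ball_def by blast
  obtain A0 where A0: "finite A0" "\<And>A. finite A \<Longrightarrow> A \<inter> A0 = {} \<Longrightarrow> norm (dual_profile f A) < \<epsilon> / 16"
    using dual_profile_tail[OF fd, of "\<epsilon> / 16"] pos by auto
  define B where "B = A \<union> A0"
  have B: "finite B" using A0(1) Suc.prems(2) by (simp add: B_def)
  \<comment> \<open>Being within \<delta> of \<open>f\<close> at the \<open>card B\<close>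
    coordinates keeps the profile of \<open>g - f\<close> on \<open>B\<close> below one sixteenth of
    both parameters: of \<epsilon> for the size of the new vector, of \<omega> for the norm of the
    dominating vector.\<close>
  define \<delta> where "\<delta> = min \<epsilon> \<omega> / (16 * (real (card B) + 1))"
  have \<delta>: "0 < \<delta>" using pos by (simp add: \<delta>_def)
  have "real (card B) * \<delta> \<le> (real (card B) + 1) * \<delta>" using \<delta> by simp
  also have "\<dots> = min \<epsilon> \<omega> / 16" by (simp add: \<delta>_def field_simps add_eq_0_iff)
  finally have B\<delta>: "real (card B) * \<delta> \<le> min \<epsilon> \<omega> / 16" .
  obtain g where g: "g \<in> ?K" "\<epsilon> / 2 < norm (g - f)"
    "\<And>j i. (j, i) \<in> B \<Longrightarrow> norm (blinfun_apply (g - f) (sum_unit j i)) < \<delta>"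
    using szlenk_derivation_far_point[OF f K B pos(1) \<delta>] by blast
  have gd: "g \<in> sum_dual" using g(1) K unfolding dual_ball_def by blast
  have close: "norm (dual_profile (g - f) B) \<le> min \<epsilon> \<omega> / 16"
    by (rule order_trans[OF norm_dual_profile_le_card B\<delta>]) (use g(3) in \<open>auto intro: less_imp_le\<close>)
  have "\<not> (\<forall>D. finite D \<longrightarrow> norm (dual_profile (g - f) D) \<le> \<epsilon> / 2)"
    using norm_dual_le[OF dual_space_diff[OF gd fd], of "\<epsilon> / 2"] g(2) pos by auto
  then obtain D where D: "finite D" "\<epsilon> / 2 < norm (dual_profile (g - f) D)" by (auto simp: not_le)
  define C where "C = D - B"
  have C: "finite C" "C \<inter> B = {}" using D by (auto simp: C_def)
  have split: "dual_profile h (C \<union> B) = dual_profile h C + dual_profile h B" for h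
    by (rule dual_profile_Un_disjoint[OF C(1) B C(2)])
  have mono: "coord (dual_profile h P) i \<le> coord (dual_profile h Q) i" if "P \<subseteq> Q" "finite Q"
    for h :: "'k tsirelson_sum_c0 \<Rightarrow>\<^sub>L 'k" and P Q i
    unfolding coord_dual_profile by (rule sum_mono2) (use that in auto)
  have "norm (dual_profile (g - f) D) \<le> norm (dual_profile (g - f) (C \<union> B))"
    by (intro norm_c00_mono_nonneg coord_dual_profile_nonneg mono) (use B C in \<open>auto simp: C_def\<close>)
  also have "\<dots> \<le> norm (dual_profile (g - f) C) + norm (dual_profile (g - f) B)"
    unfolding split by (rule norm_triangle_ineq)
  also have "norm (dual_profile (g - f) C) \<le> norm (dual_profile g C + dual_profile f C)"
  proof (rule norm_c00_mono_nonneg[OF coord_dual_profile_nonneg])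
    fix i
    show "coord (dual_profile (g - f) C) i \<le> coord (dual_profile g C + dual_profile f C) i"
      using coord_dual_profile_triangle[of "g - f" C i g] by simp
  qed
  also have "\<dots> \<le> norm (dual_profile g C) + norm (dual_profile f C)" by (rule norm_triangle_ineq)
  also have "norm (dual_profile f C) \<le> \<epsilon> / 16"
    using A0(2)[OF C(1)] C(2) by (force simp: B_def)
  \<comment> \<open>From \<epsilon>/2 two losses of at most \<epsilon>/16 are subtracted:
    \<open>g - f\<close> on \<open>B\<close> and \<open>f\<close> on \<open>C\<close>.\<close>
  finally have gC: "\<epsilon> / 4 \<le> norm (dual_profile g C)" using D(2) close pos by linarith
  \<comment> \<open>On \<open>C \<union> B\<close> the profile of \<open>g\<close> splits. Its part
    on \<open>C\<close> is the new vector; its part on \<open>B\<close>, with the profile of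
    \<open>g - f\<close> added, dominates that of \<open>f\<close> on \<open>A\<close>. The
    correction is added to \<open>x\<close>, and \<omega>/2 + \<omega>/16 is within the allowance
    \<omega>.\<close>
  obtain as x where as: "length as = n" "\<forall>a\<in>set as. (\<forall>i. 0 \<le> coord a i) \<and> \<epsilon> / 4 \<le> norm a"
    and x: "norm x \<le> 1 + \<omega> / 2" "\<And>i. coord (dual_profile g (C \<union> B)) i + (\<Sum>a\<leftarrow>as. coord a i) \<le> coord x i"
    using Suc.IH[OF g(1), of "C \<union> B" "\<omega> / 2"] B C pos by auto
  show ?case
  proof (intro exI[of _ "dual_profile g C # as"] exI[of _ "x + dual_profile (g - f) B"] conjI allI)
    show "length (dual_profile g C # as) = Suc n" using as by simp
    show "\<forall>a\<in>set (dual_profile g C # as). (\<forall>i. 0 \<le> coord a i) \<and> \<epsilon> / 4 \<le> norm a"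
      using as(2) gC coord_dual_profile_nonneg by auto
    have "norm (x + dual_profile (g - f) B) \<le> norm x + norm (dual_profile (g - f) B)" by (rule norm_triangle_ineq)
    then show "norm (x + dual_profile (g - f) B) \<le> 1 + \<omega>" using x(1) close pos by linarith
    fix i
    have "coord (dual_profile f A) i \<le> coord (dual_profile f B) i" by (rule mono) (use B in \<open>auto simp: B_def\<close>)
    then show "coord (dual_profile f A) i + (\<Sum>a\<leftarrow>dual_profile g C # as. coord a i) \<le> coord (x + dual_profile (g - f) B) i"
      using x(2)[of i] coord_dual_profile_triangle[of f B i g] unfolding split by simp
  qed
qed

text \<open>The 8 is 4 from the lower bound \<epsilon>/4 for the vectors times the bound 2 for the
  norm of their sum.\<close>

lemma szlenk_iterate_nonempty_bound:
  assumes "(szlenk_derivation (scale_tsirelson_sum_c0 :: 'k::{real_normed_field,banach} \<Rightarrow> _) \<epsilon> ^^ n)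
      (dual_ball scale_tsirelson_sum_c0) \<noteq> {}" and \<epsilon>: "0 < \<epsilon>" and n: "n \<le> 2 ^ K"
  shows "real n * \<epsilon> \<le> 8 * (5 + 2 * real K)"
proof -
  obtain f where f: "f \<in> (szlenk_derivation (scale_tsirelson_sum_c0 :: 'k \<Rightarrow> _) \<epsilon> ^^ n)
      (dual_ball scale_tsirelson_sum_c0)" using assms(1) by blast
  obtain as x where as: "length as = n" "\<And>a. a \<in> set as \<Longrightarrow> \<epsilon> / 4 \<le> norm a" "\<And>a i. a \<in> set as \<Longrightarrow> 0 \<le> coord a i"
    and x: "norm x \<le> 2" "\<And>i. coord (dual_profile f {}) i + (\<Sum>a\<leftarrow>as. coord a i) \<le> coord x i"
    using szlenk_iterate_branch[OF f finite.emptyI \<epsilon>, of 1] by auto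
  have "real n * (\<epsilon> / 4) = (\<Sum>a\<leftarrow>as. \<epsilon> / 4)" by (simp add: as(1) sum_list_triv)
  also have "\<dots> \<le> (\<Sum>a\<leftarrow>as. norm a)" by (rule sum_list_mono) (rule as(2))
  also have "\<dots> \<le> (5 + 2 * real K) * norm x"
    by (rule tsirelson_lower_estimate) (use as x n in \<open>auto simp: coord_dual_profile\<close>)
  also have "\<dots> \<le> (5 + 2 * real K) * 2" by (intro mult_left_mono x) simp
  finally show ?thesis by simp
qed

section \<open>From the logarithmic bound to the power type\<close>

lemma szlenk_iterate_eventually_empty:
  assumes "0 < \<epsilon>"
  obtains n where "(szlenk_derivation (scale_tsirelson_sum_c0 :: 'k::{real_normed_field,banach} \<Rightarrow> _) \<epsilon> ^^ n)
      (dual_ball scale_tsirelson_sum_c0) = {}"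
proof -
  obtain K :: nat where K: "(5 + 2 * real K) * 8 < 2 ^ K * \<epsilon>" by (rule linear_less_exponential[OF assms])
  show ?thesis
  proof (rule that[of "2 ^ K"], rule ccontr)
    assume "(szlenk_derivation (scale_tsirelson_sum_c0 :: 'k \<Rightarrow> _) \<epsilon> ^^ (2 ^ K)) (dual_ball scale_tsirelson_sum_c0) \<noteq> {}"
    from szlenk_iterate_nonempty_bound[OF this assms order_refl] K show False by simp
  qed
qed

lemma linear_le_powr_2_power:
  assumes s: "0 < s" obtains C where "0 < C" "\<And>K :: nat. 5 + 2 * real K \<le> C * (2 ^ K) powr s"
proof -
  define b where "b = (2::real) powr s"
  have b: "1 < b" using s by (simp add: b_def)
  have pw: "(2 ^ K) powr s = b ^ K" for K :: nat
    unfolding b_def by (simp add: powr_realpow[symmetric] powr_powr mult.commute)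
  have "(\<lambda>K. 5 * (1 / b) ^ K + 2 * (real K / b ^ K)) \<longlonglongrightarrow> 5 * 0 + 2 * 0"
    using b by (intro tendsto_intros LIMSEQ_power_zero lim_n_over_pown) auto
  then have "Bseq (\<lambda>K. 5 * (1 / b) ^ K + 2 * (real K / b ^ K))" by (rule convergent_imp_Bseq[OF convergentI])
  then obtain C where C: "0 < C" "\<And>K. norm (5 * (1 / b) ^ K + 2 * (real K / b ^ K)) \<le> C"
    unfolding Bseq_def by blast
  have "5 + 2 * real K \<le> C * b ^ K" for K
  proof -
    have "5 + 2 * real K = (5 * (1 / b) ^ K + 2 * (real K / b ^ K)) * b ^ K"
      using b by (simp add: field_simps)
    also have "\<dots> \<le> C * b ^ K" using C(2)[of K] b by (intro mult_right_mono) auto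
    finally show ?thesis .
  qed
  then show ?thesis using that[OF C(1)] by (simp add: pw)
qed

lemma szlenk_power_bound:
  assumes q: "1 < q"
  obtains C where "\<And>\<epsilon>. 0 < \<epsilon> \<Longrightarrow> \<epsilon> < 1 \<Longrightarrow>
    ereal (\<epsilon> powr q) * ereal_of_enat (szlenk_index_at (scale_tsirelson_sum_c0 :: 'k::{real_normed_field,banach} \<Rightarrow> _) \<epsilon>)
      \<le> ereal C"
proof -
  let ?sc = "scale_tsirelson_sum_c0 :: 'k \<Rightarrow> 'k tsirelson_sum_c0 \<Rightarrow> _"
  \<comment> \<open>With this exponent a bound m \<epsilon> \<le> c m^s becomes m^(1/q) \<epsilon>
    \<le> c, that is, m \<epsilon>^q \<le> c^q. As s > 0, the power absorbs the logarithm.\<close>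
  define s where "s = 1 - 1 / q"
  have s: "0 < s" "s < 1" using q by (auto simp: s_def)
  obtain C where C: "0 < C" "\<And>K :: nat. 5 + 2 * real K \<le> C * (2 ^ K) powr s"
    using linear_le_powr_2_power[OF s(1)] by blast
  define D where "D = (8 * C * 2 powr s) powr q"
  have "ereal (\<epsilon> powr q) * ereal_of_enat (szlenk_index_at ?sc \<epsilon>) \<le> ereal (D + 1)" if \<epsilon>: "0 < \<epsilon>" "\<epsilon> < 1" for \<epsilon>
  proof -
    let ?E = "\<lambda>n. (szlenk_derivation ?sc \<epsilon> ^^ n) (dual_ball ?sc)"
    define N where "N = (LEAST n. ?E n = {})"
    have ex: "\<exists>n. ?E n = {}" using szlenk_iterate_eventually_empty[OF \<epsilon>(1)] by metis
    have N: "?E N = {}" unfolding N_def by (rule LeastI_ex[OF ex])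
    have "szlenk_index_at ?sc \<epsilon> \<le> enat N"
      unfolding szlenk_index_at_def by (rule Least_le) (simp add: szlenk_iterate_def N)
    then have idx: "ereal_of_enat (szlenk_index_at ?sc \<epsilon>) \<le> ereal (real N)"
      by (metis ereal_of_enat_le_iff ereal_of_enat_simps(1))
    have eq1: "\<epsilon> powr q \<le> 1" using \<epsilon> q by (simp add: powr_le1)
    have D0: "0 \<le> D" by (simp add: D_def)
    have "\<epsilon> powr q * real N \<le> D + 1"
    proof (cases "N \<le> 1")
      case True
      then have "\<epsilon> powr q * real N \<le> 1 * 1" using eq1 by (intro mult_mono) auto
      then show ?thesis using D0 by linarith
    next
      case False
      \<comment> \<open>This is the last index with a nonempty iterate. Passing from
        \<open>m\<close> back to \<open>N\<close> costs at most 1 since \<epsilon>^q \<le> 1, hence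
        the bound \<open>D + 1\<close>.\<close>
      define m where "m = N - 1"
      have m: "1 \<le> m" "N = m + 1" using False by (auto simp: m_def)
      have "?E m \<noteq> {}" using not_less_Least[of m "\<lambda>n. ?E n = {}"] m unfolding N_def[symmetric] by simp
      obtain k where k: "2 ^ k \<le> m" "m < 2 ^ (k + 1)" using ex_power_ivl1[of 2 m] m by auto
      have "real m * \<epsilon> \<le> 8 * (5 + 2 * real (k + 1))"
        by (rule szlenk_iterate_nonempty_bound[OF \<open>?E m \<noteq> {}\<close> \<epsilon>(1)]) (use k in simp)
      also have "\<dots> \<le> 8 * (C * (2 ^ (k + 1)) powr s)" by (intro mult_left_mono C(2)) simp
      also have "\<dots> \<le> 8 * (C * (2 * real m) powr s)"
      proof -
        have "(2::real) ^ k \<le> real m" using k(1) by (metis of_nat_le_iff of_nat_numeral of_nat_power)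
        then show ?thesis using C(1) s by (intro mult_left_mono powr_mono2) auto
      qed
      also have "\<dots> = 8 * C * 2 powr s * real m powr s" by (simp add: powr_mult)
      finally have "real m * \<epsilon> \<le> 8 * C * 2 powr s * real m powr s" .
      moreover have "real m = real m powr s * real m powr (1 / q)"
        using m by (simp add: powr_add[symmetric] s_def)
      ultimately have "real m powr s * (real m powr (1 / q) * \<epsilon>) \<le> real m powr s * (8 * C * 2 powr s)"
        by (metis mult.assoc mult.commute)
      then have "real m powr (1 / q) * \<epsilon> \<le> 8 * C * 2 powr s" using m by simp
      then have "(real m powr (1 / q) * \<epsilon>) powr q \<le> D"
        unfolding D_def using \<epsilon> q by (intro powr_mono2) auto
      then have "real m * \<epsilon> powr q \<le> D" using m q \<epsilon> by (simp add: powr_mult powr_powr)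
      then show ?thesis using eq1 by (simp add: m(2) algebra_simps)
    qed
    then have "ereal (\<epsilon> powr q) * ereal (real N) \<le> ereal (D + 1)" by simp
    moreover have "ereal (\<epsilon> powr q) * ereal_of_enat (szlenk_index_at ?sc \<epsilon>) \<le> ereal (\<epsilon> powr q) * ereal (real N)"
      by (intro ereal_mult_left_mono idx) simp
    ultimately show ?thesis by (rule order_trans[rotated])
  qed
  then show ?thesis using that by blast
qed

proposition tsirelson_sum_has_szlenk_power_type_1:
  "has_szlenk_power_type (scale_tsirelson_sum_c0 :: 'k::{real_normed_field,banach} \<Rightarrow> _) 1"
proof -
  let ?sc = "scale_tsirelson_sum_c0 :: 'k \<Rightarrow> 'k tsirelson_sum_c0 \<Rightarrow> _"
  let ?Q = "{ereal q | q. q \<ge> 1 \<and>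
     (SUP \<epsilon>\<in>{0<..<1}. ereal (\<epsilon> powr q) * ereal_of_enat (szlenk_index_at ?sc \<epsilon>)) < \<infinity>}"
  have omega: "szlenk_le_omega ?sc"
    unfolding szlenk_le_omega_def
  proof (intro allI impI)
    fix \<epsilon> :: real assume "0 < \<epsilon>"
    then obtain n where "(szlenk_derivation ?sc \<epsilon> ^^ n) (dual_ball ?sc) = {}"
      by (rule szlenk_iterate_eventually_empty)
    then show "\<exists>\<alpha>. szlenk_iterate ?sc \<epsilon> \<alpha> (dual_ball ?sc) = {}"
      by (intro exI[of _ "enat n"]) (simp add: szlenk_iterate_def)
  qed
  have Inf_le: "Inf ?Q \<le> ereal q" if q: "1 < q" for q
  proof (rule Inf_lower)
    obtain C where "\<And>\<epsilon>. 0 < \<epsilon> \<Longrightarrow> \<epsilon> < 1 \<Longrightarrow>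
        ereal (\<epsilon> powr q) * ereal_of_enat (szlenk_index_at ?sc \<epsilon>) \<le> ereal C"
      using szlenk_power_bound[OF q] by blast
    then have "(SUP \<epsilon>\<in>{0<..<1}. ereal (\<epsilon> powr q) * ereal_of_enat (szlenk_index_at ?sc \<epsilon>)) \<le> ereal C"
      by (intro SUP_least) auto
    then have "(SUP \<epsilon>\<in>{0<..<1}. ereal (\<epsilon> powr q) * ereal_of_enat (szlenk_index_at ?sc \<epsilon>)) < \<infinity>"
      by (rule le_less_trans) simp
    then show "ereal q \<in> ?Q" using q by auto
  qed
  have "Inf ?Q \<le> ereal 1"
  proof (rule ereal_le_epsilon2)
    fix e :: real assume "0 < e"
    then show "Inf ?Q \<le> ereal 1 + ereal e" using Inf_le[of "1 + e"] by simp
  qed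
  moreover have "ereal 1 \<le> Inf ?Q" by (rule Inf_greatest) auto
  ultimately show ?thesis
    using omega unfolding has_szlenk_power_type_def szlenk_power_type_def by (auto intro: antisym)
qed

section \<open>Failure of summability\<close>

lemma sum_norm_le_norm: "sum_norm x j \<le> norm x"
  unfolding norm_tsirelson_sum_c0.rep_eq by (rule tsirelson_norm_ge_coordinate[OF summable_sum_norm])

lemma norm_sum_unit_le: "norm (sum_unit j i :: 'k::{real_normed_field,banach} tsirelson_sum_c0) \<le> 1"
proof -
  have eq: "sum_unit j i = (fin_sum {(j, i)} (\<lambda>j' _. if j' = j then 1 else 0) :: 'k tsirelson_sum_c0)"
    by (rule sum_coord_eqI) (simp add: sum_coord_fin_sum)
  show ?thesis
    unfolding eq by (rule norm_fin_sum_le_1[OF _ norming_functional_unit[of j]]) auto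
qed

lemma bounded_linear_sum_coord:
  "bounded_linear (\<lambda>x :: 'k::{real_normed_field,banach} tsirelson_sum_c0. sum_coord x j i)"
proof (rule bounded_linear_intro[of _ 1])
  fix x :: "'k tsirelson_sum_c0" and r :: real
  show "sum_coord (r *\<^sub>R x) j i = r *\<^sub>R sum_coord x j i"
    by (simp add: scale_tsirelson_sum_c0_of_real[symmetric] scaleR_conv_of_real)
  show "norm (sum_coord x j i) \<le> norm x * 1"
    using order_trans[OF norm_sum_coord_le sum_norm_le_norm] by simp
qed simp

lift_definition sum_eval :: "nat \<Rightarrow> nat \<Rightarrow> 'k::{real_normed_field,banach} tsirelson_sum_c0 \<Rightarrow>\<^sub>L 'k"
  is "\<lambda>j i x. sum_coord x j i"
  by (rule bounded_linear_sum_coord)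

declare sum_eval.rep_eq [simp]

text \<open>An element of the T-sum of copies of l_1 with at most one nonzero entry per copy. Moving
  a single \<open>\<iota> j\<close> to infinity makes that entry weak* null while its norm is
  kept.\<close>

definition branch_functional ::
    "real c00 \<Rightarrow> nat set \<Rightarrow> (nat \<Rightarrow> nat) \<Rightarrow> 'k::{real_normed_field,banach} tsirelson_sum_c0 \<Rightarrow>\<^sub>L 'k" where
  "branch_functional y R \<iota> = (\<Sum>j\<in>R. coord y j *\<^sub>R sum_eval j (\<iota> j))"

lemma branch_functional_apply:
  "blinfun_apply (branch_functional y R \<iota>) x = (\<Sum>j\<in>R. coord y j *\<^sub>R sum_coord x j (\<iota> j))"
  by (simp add: branch_functional_def blinfun.sum_left blinfun.scaleR_left)

lemma branch_functional_in_dual_ball: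
  assumes "finite R" "\<And>j. 0 \<le> coord y j" "norm y \<le> 1"
  shows "(branch_functional y R \<iota> :: 'k::{real_normed_field,banach} tsirelson_sum_c0 \<Rightarrow>\<^sub>L 'k) \<in>
    dual_ball scale_tsirelson_sum_c0"
proof -
  let ?f = "branch_functional y R \<iota> :: 'k tsirelson_sum_c0 \<Rightarrow>\<^sub>L 'k"
  have "?f \<in> sum_dual"
    by (simp add: dual_space_def branch_functional_apply sum_distrib_left mult_scaleR_right)
  moreover have "norm ?f \<le> 1"
  proof (rule norm_blinfun_bound)
    fix x :: "'k tsirelson_sum_c0"
    have "norm (blinfun_apply ?f x) \<le> (\<Sum>j\<in>R. sum_norm x j * coord y j)"
      unfolding branch_functional_apply
    proof (rule order_trans[OF norm_sum sum_mono])
      fix j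
      show "norm (coord y j *\<^sub>R sum_coord x j (\<iota> j)) \<le> sum_norm x j * coord y j"
        using mult_right_mono[OF norm_sum_coord_le[of x j "\<iota> j"] assms(2)[of j]] assms(2)[of j]
        by (simp add: mult.commute)
    qed
    also have "\<dots> \<le> norm x * norm y" by (rule sum_mult_coord_le[OF assms(1)])
    also have "\<dots> \<le> norm x * 1" by (intro mult_left_mono assms) simp
    finally show "norm (blinfun_apply ?f x) \<le> 1 * norm x" by simp
  qed simp
  ultimately show ?thesis by (simp add: dual_ball_def)
qed

lemma weak_star_eventually_in_open:
  assumes U: "openin (weak_star_topology sc) U" "f \<in> U" and g: "\<And>i. g i \<in> dual_space sc"
    and lim: "\<And>x. ((\<lambda>i. blinfun_apply (g i) x) \<longlongrightarrow> blinfun_apply f x) F"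
  shows "\<forall>\<^sub>F i in F. g i \<in> U"
proof -
  obtain V where V: "openin strong_operator_topology V" "U = V \<inter> dual_space sc"
    using U(1) unfolding weak_star_topology_def openin_subtopology by blast
  obtain W where W: "open W" "V = blinfun_apply -` W"
    using V(1) unfolding strong_operator_topology_def openin_pullback_topology by auto
  have "limitin (product_topology (\<lambda>_. euclidean) UNIV) (\<lambda>i. blinfun_apply (g i)) (blinfun_apply f) F"
    unfolding limitin_componentwise using lim by simp
  then have "((\<lambda>i. blinfun_apply (g i)) \<longlongrightarrow> blinfun_apply f) F"
    by (simp add: euclidean_product_topology)
  then have "\<forall>\<^sub>F i in F. blinfun_apply (g i) \<in> W"
    by (rule topological_tendstoD[OF _ W(1)]) (use U(2) V(2) W(2) in auto)
  then show ?thesis by eventually_elim (use g V(2) W(2) in auto)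
qed

lemma szlenk_derivationI:
  "f \<in> K \<Longrightarrow> (\<And>U. openin (weak_star_topology sc) U \<Longrightarrow> f \<in> U \<Longrightarrow> \<epsilon> < diameter (K \<inter> U)) \<Longrightarrow>
    f \<in> szlenk_derivation sc \<epsilon> K"
  unfolding szlenk_derivation_def by blast

text \<open>The positions \<iota> are arbitrary in the induction, so for the entry in copy
  \<open>j\<close> all positions \<open>i\<close> are available at once. The functionals
  \<open>g i\<close> with this entry converge weak* to the one without it and stay at distance at
  least \<open>coord y j\<close>.\<close>

lemma branch_functional_in_iterate:
  fixes y :: "real c00"
  assumes y: "\<And>j. 0 \<le> coord y j" "norm y \<le> 1"
    and js: "distinct js" "set js \<subseteq> {j. coord y j \<noteq> 0}" and R: "R \<subseteq> {j. coord y j \<noteq> 0} - set js"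
  shows "(branch_functional y R \<iota> :: 'k::{real_normed_field,banach} tsirelson_sum_c0 \<Rightarrow>\<^sub>L 'k) \<in>
    foldr (szlenk_derivation scale_tsirelson_sum_c0) (map (\<lambda>j. coord y j / 2) js) (dual_ball scale_tsirelson_sum_c0)"
  using js R
proof (induction js arbitrary: R \<iota>)
  case Nil
  then have "finite R" using finite_subset[OF _ finite_support[of y]] by simp
  then show ?case by (simp add: branch_functional_in_dual_ball y)
next
  case (Cons j js)
  let ?sc = "scale_tsirelson_sum_c0 :: 'k \<Rightarrow> 'k tsirelson_sum_c0 \<Rightarrow> _"
  let ?K = "foldr (szlenk_derivation ?sc) (map (\<lambda>j. coord y j / 2) js) (dual_ball ?sc)"
  let ?f = "branch_functional y R \<iota> :: 'k tsirelson_sum_c0 \<Rightarrow>\<^sub>L 'k"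
  \<comment> \<open>In \<open>foldr\<close> the derivation of the head \<open>j\<close> acts last.
    Both \<open>R\<close> and \<open>insert j R\<close> avoid the remaining list \<open>js\<close>,
    so the induction hypothesis puts \<open>?f\<close> and every \<open>g i\<close> into
    \<open>?K\<close>.\<close>
  define g where "g i = (branch_functional y (insert j R) (\<iota>(j := i)) :: 'k tsirelson_sum_c0 \<Rightarrow>\<^sub>L 'k)" for i
  have R: "finite R" "j \<notin> R"
    using Cons.prems finite_subset[OF _ finite_support[of y]] by auto
  have j: "0 < coord y j" using Cons.prems(2) y(1)[of j] by (simp add: less_le)
  have fK: "?f \<in> ?K" by (rule Cons.IH) (use Cons.prems in auto)
  have gK: "g i \<in> ?K" for i unfolding g_def by (rule Cons.IH) (use Cons.prems in auto)
  have "foldr (szlenk_derivation ?sc) \<epsilon>s L \<subseteq> L" for \<epsilon>s L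
    by (induction \<epsilon>s) (use szlenk_derivation_subset in fastforce)+
  then have K: "bounded ?K" using bounded_dual_ball bounded_subset by blast
  have g: "blinfun_apply (g i) x = blinfun_apply ?f x + coord y j *\<^sub>R sum_coord x j i" for i x
  proof -
    have "(\<Sum>l\<in>R. coord y l *\<^sub>R sum_coord x l ((\<iota>(j := i)) l)) = (\<Sum>l\<in>R. coord y l *\<^sub>R sum_coord x l (\<iota> l))"
      using R(2) by (intro sum.cong) auto
    then show ?thesis using R by (simp add: g_def branch_functional_apply)
  qed
  have "?f \<in> szlenk_derivation ?sc (coord y j / 2) ?K"
  proof (rule szlenk_derivationI[OF fK])
    fix U assume U: "openin (weak_star_topology ?sc) U" "?f \<in> U"
    have "(\<lambda>i. blinfun_apply (g i) x) \<longlonglongrightarrow> blinfun_apply ?f x" for x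
      unfolding g using tendsto_add[OF tendsto_const tendsto_scaleR[OF tendsto_const sum_coord_tendsto_0[of x j]]]
      by fastforce
    moreover have "g i \<in> sum_dual" for i
      using branch_functional_in_dual_ball[of "insert j R" y] R y unfolding g_def dual_ball_def by blast
    ultimately have "\<forall>\<^sub>F i in sequentially. g i \<in> U"
      using weak_star_eventually_in_open[OF U] by blast
    then obtain i where i: "g i \<in> U" using eventually_happens'[OF sequentially_bot] by blast
    have "coord y j = norm (blinfun_apply (g i - ?f) (sum_unit j i))"
      using j by (simp add: blinfun.diff_left g)
    also have "\<dots> \<le> norm (g i - ?f) * norm (sum_unit j i :: 'k tsirelson_sum_c0)" by (rule norm_blinfun)
    also have "\<dots> \<le> norm (g i - ?f) * 1"
      by (intro mult_left_mono norm_sum_unit_le) simp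
    also have "\<dots> = dist (g i) ?f" by (simp add: dist_norm)
    also have "\<dots> \<le> diameter (?K \<inter> U)"
      by (rule diameter_bounded_bound) (use K U(2) i fK gK in \<open>auto intro: bounded_subset\<close>)
    \<comment> \<open>The derivation asks for a diameter strictly above its parameter; the half
      provides the strictness.\<close>
    finally show "coord y j / 2 < diameter (?K \<inter> U)" using j by linarith
  qed
  then show ?case by simp
qed

proposition tsirelson_sum_not_summable_szlenk_index:
  "\<not> summable_szlenk_index (scale_tsirelson_sum_c0 :: 'k::{real_normed_field,banach} \<Rightarrow> _)"
proof
  let ?sc = "scale_tsirelson_sum_c0 :: 'k \<Rightarrow> 'k tsirelson_sum_c0 \<Rightarrow> _"
  assume "summable_szlenk_index ?sc"
  then obtain M where M: "\<And>\<epsilon>s. (\<forall>\<epsilon>\<in>set \<epsilon>s. 0 < \<epsilon>) \<Longrightarrow>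
     foldr (szlenk_derivation ?sc) \<epsilon>s (dual_ball ?sc) \<noteq> {} \<Longrightarrow> sum_list \<epsilon>s \<le> M"
    unfolding summable_szlenk_index_def by blast
  obtain y :: "real c00" where y: "\<And>i. 0 \<le> coord y i" "norm y \<le> 1" "2 * M < mass_c00 y"
    by (rule tsirelson_not_l1) blast
  define js where "js = sorted_list_of_set {j. coord y j \<noteq> 0}"
  have js: "distinct js" "set js = {j. coord y j \<noteq> 0}" by (simp_all add: js_def)
  let ?\<epsilon>s = "map (\<lambda>j. coord y j / 2) js"
  have "foldr (szlenk_derivation ?sc) ?\<epsilon>s (dual_ball ?sc) \<noteq> {}"
    using branch_functional_in_iterate[OF y(1,2) js(1), of "{}" id, where 'k = 'k] js(2) by auto
  moreover have "\<forall>\<epsilon>\<in>set ?\<epsilon>s. 0 < \<epsilon>" using y(1) js(2) by (auto simp: less_le)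
  ultimately have "sum_list ?\<epsilon>s \<le> M" by (intro M)
  moreover have "sum_list ?\<epsilon>s = mass_c00 y / 2"
    using js by (simp add: sum_list_distinct_conv_sum_set mass_c00_def sum_divide_distrib)
  ultimately show False using y(3) by simp
qed

theorem corollary5p11:
  shows
    "(has_szlenk_power_type (scale_tsirelson_sum_c0 :: real \<Rightarrow> real tsirelson_sum_c0 \<Rightarrow> real tsirelson_sum_c0) 1 \<and>
      \<not> summable_szlenk_index (scale_tsirelson_sum_c0 :: real \<Rightarrow> real tsirelson_sum_c0 \<Rightarrow> real tsirelson_sum_c0)) \<and>
     (has_szlenk_power_type (scale_tsirelson_sum_c0 :: complex \<Rightarrow> complex tsirelson_sum_c0 \<Rightarrow> complex tsirelson_sum_c0) 1 \<and>
      \<not> summable_szlenk_index (scale_tsirelson_sum_c0 :: complex \<Rightarrow> complex tsirelson_sum_c0 \<Rightarrow> complex tsirelson_sum_c0))"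
  by (intro conjI tsirelson_sum_has_szlenk_power_type_1 tsirelson_sum_not_summable_szlenk_index)

end
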